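(* Let $w$ be a weight structure on a triangulated category $\mathcal C$ with heart $Hw$, and let $X,X'$ denote arbitrary objects of $\mathcal C$. I.1. The (single) weight decomposition of objects and morphisms gives a functor $WD:\mathcal C\to K_{\mathfrak w}^{[0,1]}(\mathcal C)$, sending $X$ to the two-term complex $X^{w\le 0}\xrightarrow{f} X^{w\ge 1}$ placed in degrees $0,1$, and sending $g\in\mathcal C(X,X')$ to the class of any pair $(h,i)$ completing $g$ to a morphism of the chosen weight decompositions. 2. Morphisms $g\in\mathcal C(X,X')$, $h\in\mathcal C(X^{w\le 0},X'^{w\le 0})$ and $i\in\mathcal C(X^{w\ge 1},X'^{w\ge 1})$ give a morphism of weight decompositions (of $X$ and $X'$) if and only if $(h,i)=WD(g)$ in $K_{\mathfrak w}(\mathcal C)$ (that is, $(h,i)$ is a morphism of two-term complexes whose class is $WD(g)$). 3. The homomorphism $\mathcal C(X,X')\to K_{\mathfrak w}^{[0,1]}(\mathcal C)(WD(X),WD(X'))$ is surjective. 4. For all $X,X'$ consider the groups $T(X,X')=\mathrm{Ker}\bigl(\mathcal C(X,X')\to K_{\mathfrak w}(\mathcal C)(WD(X),WD(X'))\bigr)$. Then $T$ is a two-sided ideal of morphisms of $\mathcal C$, and $T^2=0$. 5. If $WD(X)\cong WD(X')$ in $K_{\mathfrak w}(\mathcal C)$ then $X\cong X'$ in $\mathcal C$. 6. For any $X\in\mathrm{Obj}\,\mathcal C$ and $p\in\mathcal C(X,X)$, if $WD(p)$ is idempotent then $WD(p)$ can be lifted to an idempotent $p'\in\mathcal C(X,X)$.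 II. The correspondence $X\mapsto t(X)$ (the weight complex of $X$) gives a functor $\mathcal C\to K_{\mathfrak w}(Hw)$.
   Context: For classes of objects, $D\perp E$ means $\mathcal C(X,Y)=0$ for all $X\in D$, $Y\in E$. A weight structure $w$ on a triangulated category $\mathcal C$ is a pair of subclasses $\mathcal C^{w\le 0},\mathcal C^{w\ge 0}\subset\mathrm{Obj}\,\mathcal C$ such that: (i) both are additive and Karoubi-closed in $\mathcal C$ (contain all retracts of their objects); (ii) $\mathcal C^{w\ge 0}\subset \mathcal C^{w\ge 0}[1]$ and $\mathcal C^{w\le 0}[1]\subset \mathcal C^{w\le 0}$; (iii) $\mathcal C^{w\ge 0}\perp\mathcal C^{w\le 0}[1]$; (iv) for every $X$ there is a distinguished triangle $B[-1]\to X\to A\to B$ with $A\in\mathcal C^{w\le 0}$, $B\in\mathcal C^{w\ge 0}$ (a weight decomposition of $X$). The heart $Hw$ is the full subcategory with objects $\mathcal C^{w=0}=\mathcal C^{w\ge 0}\cap\mathcal C^{w\le 0}$. For each $k\in\mathbb Z$ choose a weight decomposition $X[k]\to X^{w\le k}\xrightarrow{f^k}X^{w\ge k+1}\to X[k+1]$ ($X^{w\le k}\in\mathcal C^{w\le0}$, $X^{w\ge k+1}\in\mathcal C^{w\ge 0}$); $f=f^0$. Any $g:X\to X'$ extends (non-uniquely) to a morphism of weight decompositions, i.e. there are $h:X^{w\le 0}\to X'^{w\le 0}$, $i:X^{w\ge1}\to X'^{w\ge1}$ such that $(g,h,i)$ is a morphism of triangles. There are unique morphisms $X^{w\le k}[-1]\to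 X^{w\le k-1}$ and $X^{w\ge k+1}[-1]\to X^{w\ge k}$ compatible with the chosen triangles and $\mathrm{id}_X$, and there are $X^k\in\mathcal C^{w=0}$ and distinguished triangles $X^{w\le k}[-1]\to X^{w\le k-1}\xrightarrow{c^k}X^k\xrightarrow{d^k}X^{w\le k}$ and $X^k[-1]\xrightarrow{x^k}X^{w\ge k+1}[-1]\to X^{w\ge k}\xrightarrow{y^k}X^k$ with $c^k=y^k\circ f^{k-1}$, $x^k=(f^k\circ d^k)[-1]$ (a weight Postnikov tower). The weight complex $t(X)$ is the complex $(X^i,h^i)$ with $h^i=c^{i+1}\circ d^i$; on a morphism $g:X\to X'$, $t(g)$ is the class of the morphism of complexes given by any extension of $g$ to a morphism of weight Postnikov towers. A class $T$ of morphisms of an additive category is a two-sided ideal if it is closed under sums and differences (inside a morphism group), finite direct sums, and compositions with arbitrary morphisms; $T^2=0$ means that all compositions of two elements of $T$ vanish. For an additive category $A$, $K(A)$ is the homotopy category of (cohomological) complexes. For complexes $X,Y$ let $Z(X,Y)\subset K(A)(X,Y)$ consist of the morphisms that can be presented as $(s^{i+1}\circ d^i_X+d^{i-1}_Y\circ t^i)_i$ for some $s^i,t^i\in A(X^i,Y^{i-1})$; this is a two-sided ideal. $K_{\mathfrak w}(A)$ is $K(A)/Z$ (morphism groups $K(A)(X,Y)/Z(X,Y)$) with isomorphic objects (homotopy equivalent complexes) identified; $K_{\mathfrak w}^{[0,1]}(A)$ is its full subcategory of complexes concentrated in degrees $0,1$. *)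

theory Defs
  imports "HOL-Algebra.Coset"
begin

section \<open>Preadditive and additive categories\<close>

text \<open>Arrows carry their domain and codomain, so hom-sets of a category are disjoint;
  \<open>Comp C g f\<close> is \<open>g\<close> after \<open>f\<close>.\<close>

record ('o, 'm) lin_cat =
  Ob :: "'o set"
  Arr :: "'m set"
  Dom :: "'m \<Rightarrow> 'o"
  Cod :: "'m \<Rightarrow> 'o"
  Ide :: "'o \<Rightarrow> 'm"
  Comp :: "'m \<Rightarrow> 'm \<Rightarrow> 'm" (infixl "\<cdot>\<index>" 70)
  AddM :: "'m \<Rightarrow> 'm \<Rightarrow> 'm" (infixl "\<boxplus>\<index>" 65)
  ZeroM :: "'o \<Rightarrow> 'o \<Rightarrow> 'm"

definition Hom :: "('o, 'm, 'z) lin_cat_scheme \<Rightarrow> 'o \<Rightarrow> 'o \<Rightarrow> 'm set" where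
  "Hom C X Y = {f \<in> Arr C. Dom C f = X \<and> Cod C f = Y}"

text \<open>The additive group of morphisms, written multiplicatively as in the library.\<close>

definition hom_grp :: "('o, 'm, 'z) lin_cat_scheme \<Rightarrow> 'o \<Rightarrow> 'o \<Rightarrow> 'm monoid" where
  "hom_grp C X Y = \<lparr>carrier = Hom C X Y, mult = AddM C, one = ZeroM C X Y\<rparr>"

definition neg :: "('o, 'm, 'z) lin_cat_scheme \<Rightarrow> 'm \<Rightarrow> 'm" where
  "neg C f = inv\<^bsub>hom_grp C (Dom C f) (Cod C f)\<^esub> f"

definition is_iso :: "('o, 'm, 'z) lin_cat_scheme \<Rightarrow> 'm \<Rightarrow> bool" where
  "is_iso C f \<longleftrightarrow> f \<in> Arr C \<and> (\<exists>g \<in> Hom C (Cod C f) (Dom C f).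
     g \<cdot>\<^bsub>C\<^esub> f = Ide C (Dom C f) \<and> f \<cdot>\<^bsub>C\<^esub> g = Ide C (Cod C f))"

definition inv_arr :: "('o, 'm, 'z) lin_cat_scheme \<Rightarrow> 'm \<Rightarrow> 'm" where
  "inv_arr C f = (THE g. g \<in> Hom C (Cod C f) (Dom C f) \<and>
     g \<cdot>\<^bsub>C\<^esub> f = Ide C (Dom C f) \<and> f \<cdot>\<^bsub>C\<^esub> g = Ide C (Cod C f))"

definition isomorphic :: "('o, 'm, 'z) lin_cat_scheme \<Rightarrow> 'o \<Rightarrow> 'o \<Rightarrow> bool" where
  "isomorphic C X Y \<longleftrightarrow> (\<exists>f \<in> Hom C X Y. is_iso C f)"

definition is_zero_ob :: "('o, 'm, 'z) lin_cat_scheme \<Rightarrow> 'o \<Rightarrow> bool" where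
  "is_zero_ob C Z \<longleftrightarrow> Z \<in> Ob C \<and> (\<forall>X \<in> Ob C. (\<exists>!f. f \<in> Hom C X Z) \<and> (\<exists>!f. f \<in> Hom C Z X))"

definition zero_ob :: "('o, 'm, 'z) lin_cat_scheme \<Rightarrow> 'o" where
  "zero_ob C = (SOME Z. is_zero_ob C Z)"

definition is_dsum :: "('o, 'm, 'z) lin_cat_scheme \<Rightarrow> 'o \<Rightarrow> 'o \<Rightarrow> 'o \<Rightarrow> 'm \<Rightarrow> 'm \<Rightarrow> 'm \<Rightarrow> 'm \<Rightarrow> bool" where
  "is_dsum C X Y S i j p q \<longleftrightarrow>
     S \<in> Ob C \<and> i \<in> Hom C X S \<and> j \<in> Hom C Y S \<and> p \<in> Hom C S X \<and> q \<in> Hom C S Y \<and>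
     p \<cdot>\<^bsub>C\<^esub> i = Ide C X \<and> q \<cdot>\<^bsub>C\<^esub> j = Ide C Y \<and>
     p \<cdot>\<^bsub>C\<^esub> j = ZeroM C Y X \<and> q \<cdot>\<^bsub>C\<^esub> i = ZeroM C X Y \<and>
     (i \<cdot>\<^bsub>C\<^esub> p) \<boxplus>\<^bsub>C\<^esub> (j \<cdot>\<^bsub>C\<^esub> q) = Ide C S"

locale preadditive_category =
  fixes C (structure)
  assumes Dom_Ob: "f \<in> Arr C \<Longrightarrow> Dom C f \<in> Ob C"
    and Cod_Ob: "f \<in> Arr C \<Longrightarrow> Cod C f \<in> Ob C"
    and Ide_Hom: "X \<in> Ob C \<Longrightarrow> Ide C X \<in> Hom C X X"
    and Comp_Hom: "\<lbrakk>f \<in> Hom C X Y; g \<in> Hom C Y Z\<rbrakk> \<Longrightarrow> g \<cdot> f \<in> Hom C X Z"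
    and Comp_assoc: "\<lbrakk>f \<in> Hom C X Y; g \<in> Hom C Y Z; h \<in> Hom C Z V\<rbrakk>
           \<Longrightarrow> (h \<cdot> g) \<cdot> f = h \<cdot> (g \<cdot> f)"
    and Ide_left: "f \<in> Hom C X Y \<Longrightarrow> Ide C Y \<cdot> f = f"
    and Ide_right: "f \<in> Hom C X Y \<Longrightarrow> f \<cdot> Ide C X = f"
    and hom_comm_group: "\<lbrakk>X \<in> Ob C; Y \<in> Ob C\<rbrakk> \<Longrightarrow> comm_group (hom_grp C X Y)"
    and Comp_add_right: "\<lbrakk>f \<in> Hom C X Y; f' \<in> Hom C X Y; g \<in> Hom C Y Z\<rbrakk>
           \<Longrightarrow> g \<cdot> (f \<boxplus> f') = (g \<cdot> f) \<boxplus> (g \<cdot> f')"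
    and Comp_add_left: "\<lbrakk>f \<in> Hom C X Y; g \<in> Hom C Y Z; g' \<in> Hom C Y Z\<rbrakk>
           \<Longrightarrow> (g \<boxplus> g') \<cdot> f = (g \<cdot> f) \<boxplus> (g' \<cdot> f)"

locale additive_category = preadditive_category +
  assumes ex_zero_ob: "\<exists>Z. is_zero_ob C Z"
    and ex_dsum: "\<lbrakk>X \<in> Ob C; Y \<in> Ob C\<rbrakk> \<Longrightarrow> \<exists>S i j p q. is_dsum C X Y S i j p q"

definition is_functor ::
  "('o, 'm, 'z) lin_cat_scheme \<Rightarrow> ('p, 'n, 'y) lin_cat_scheme \<Rightarrow> ('o \<Rightarrow> 'p) \<Rightarrow> ('m \<Rightarrow> 'n) \<Rightarrow> bool" where
  "is_functor C D Fo Fm \<longleftrightarrow>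
     (\<forall>X \<in> Ob C. Fo X \<in> Ob D) \<and>
     (\<forall>X \<in> Ob C. \<forall>Y \<in> Ob C. \<forall>f \<in> Hom C X Y. Fm f \<in> Hom D (Fo X) (Fo Y)) \<and>
     (\<forall>X \<in> Ob C. Fm (Ide C X) = Ide D (Fo X)) \<and>
     (\<forall>X \<in> Ob C. \<forall>Y \<in> Ob C. \<forall>Z \<in> Ob C. \<forall>f \<in> Hom C X Y. \<forall>g \<in> Hom C Y Z.
        Fm (g \<cdot>\<^bsub>C\<^esub> f) = Fm g \<cdot>\<^bsub>D\<^esub> Fm f)"

definition full_subcat :: "('o, 'm, 'z) lin_cat_scheme \<Rightarrow> 'o set \<Rightarrow> ('o, 'm) lin_cat" where
  "full_subcat C D = \<lparr>Ob = Ob C \<inter> D, Arr = {f \<in> Arr C. Dom C f \<in> D \<and> Cod C f \<in> D},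
     Dom = Dom C, Cod = Cod C, Ide = Ide C, Comp = Comp C, AddM = AddM C, ZeroM = ZeroM C\<rparr>"

section \<open>Ideals, quotients, identification of isomorphic objects\<close>

text \<open>Finite direct sums are the binary ones together with the empty one (\<open>ideal_zero\<close>).\<close>

locale two_sided_ideal =
  fixes C (structure) and T
  assumes ideal_Arr: "T \<subseteq> Arr C"
    and ideal_add: "\<lbrakk>f \<in> T; g \<in> T; f \<in> Hom C X Y; g \<in> Hom C X Y\<rbrakk> \<Longrightarrow> f \<boxplus> g \<in> T"
    and ideal_diff: "\<lbrakk>f \<in> T; g \<in> T; f \<in> Hom C X Y; g \<in> Hom C X Y\<rbrakk> \<Longrightarrow> f \<boxplus> neg C g \<in> T"
    and ideal_zero: "is_zero_ob C Z \<Longrightarrow> ZeroM C Z Z \<in> T"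
    and ideal_dsum: "\<lbrakk>f \<in> T; f' \<in> T; f \<in> Hom C X Y; f' \<in> Hom C X' Y';
           is_dsum C X X' S i i' p p'; is_dsum C Y Y' S' j j' q q'\<rbrakk>
           \<Longrightarrow> (j \<cdot> f \<cdot> p) \<boxplus> (j' \<cdot> f' \<cdot> p') \<in> T"
    and ideal_comp_left: "\<lbrakk>f \<in> T; f \<in> Hom C X Y; g \<in> Hom C Y Z\<rbrakk> \<Longrightarrow> g \<cdot> f \<in> T"
    and ideal_comp_right: "\<lbrakk>f \<in> T; f \<in> Hom C X Y; g \<in> Hom C Z X\<rbrakk> \<Longrightarrow> f \<cdot> g \<in> T"

definition ideal_square_zero :: "('o, 'm, 'z) lin_cat_scheme \<Rightarrow> 'm set \<Rightarrow> bool" where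
  "ideal_square_zero C T \<longleftrightarrow>
     (\<forall>f \<in> T. \<forall>g \<in> T. Dom C g = Cod C f \<longrightarrow> g \<cdot>\<^bsub>C\<^esub> f = ZeroM C (Dom C f) (Cod C g))"

definition quot_class :: "('o, 'm, 'z) lin_cat_scheme \<Rightarrow> 'm set \<Rightarrow> 'm \<Rightarrow> 'm set" where
  "quot_class C T f =
     (T \<inter> Hom C (Dom C f) (Cod C f)) #>\<^bsub>hom_grp C (Dom C f) (Cod C f)\<^esub> f"

definition quot_cat :: "('o, 'm, 'z) lin_cat_scheme \<Rightarrow> 'm set \<Rightarrow> ('o, 'm set) lin_cat" where
  "quot_cat C T = \<lparr>Ob = Ob C, Arr = quot_class C T ` Arr C,
     Dom = (\<lambda>F. Dom C (SOME f. f \<in> F)), Cod = (\<lambda>F. Cod C (SOME f. f \<in> F)),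
     Ide = (\<lambda>X. quot_class C T (Ide C X)),
     Comp = (\<lambda>G F. quot_class C T ((SOME g. g \<in> G) \<cdot>\<^bsub>C\<^esub> (SOME f. f \<in> F))),
     AddM = (\<lambda>F G. quot_class C T ((SOME f. f \<in> F) \<boxplus>\<^bsub>C\<^esub> (SOME g. g \<in> G))),
     ZeroM = (\<lambda>X Y. quot_class C T (ZeroM C X Y))\<rparr>"

definition iso_class :: "('o, 'm, 'z) lin_cat_scheme \<Rightarrow> 'o \<Rightarrow> 'o set" where
  "iso_class C X = {Y \<in> Ob C. isomorphic C X Y}"

definition iso_rep :: "('o, 'm, 'z) lin_cat_scheme \<Rightarrow> 'o \<Rightarrow> 'o" where
  "iso_rep C X = (SOME Y. Y \<in> iso_class C X)"

text \<open>The category obtained by identifying isomorphic objects: its objects are the isomorphism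
  classes, its morphisms \<open>a \<rightarrow> b\<close> those between the chosen members of \<open>a\<close> and \<open>b\<close>.  There is no
  canonical way to identify the morphism groups of isomorphic objects;
  \<open>ident_iso C X : X \<rightarrow> iso_rep C X\<close> is the isomorphism chosen for this purpose, and
  \<open>iso_class C\<close>, \<open>ident_arr C\<close> form the (fully faithful) projection functor.\<close>

definition identify_iso :: "('o, 'm, 'z) lin_cat_scheme \<Rightarrow> ('o set, 'm) lin_cat" where
  "identify_iso C = \<lparr>Ob = iso_class C ` Ob C,
     Arr = {f \<in> Arr C. Dom C f = iso_rep C (Dom C f) \<and> Cod C f = iso_rep C (Cod C f)},
     Dom = (\<lambda>f. iso_class C (Dom C f)), Cod = (\<lambda>f. iso_class C (Cod C f)),
     Ide = (\<lambda>a. Ide C (SOME X. X \<in> a)), Comp = Comp C, AddM = AddM C,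
     ZeroM = (\<lambda>a b. ZeroM C (SOME X. X \<in> a) (SOME Y. Y \<in> b))\<rparr>"

definition ident_iso :: "('o, 'm, 'z) lin_cat_scheme \<Rightarrow> 'o \<Rightarrow> 'm" where
  "ident_iso C X = (if iso_rep C X = X then Ide C X
     else (SOME u. u \<in> Hom C X (iso_rep C X) \<and> is_iso C u))"

definition ident_arr :: "('o, 'm, 'z) lin_cat_scheme \<Rightarrow> 'm \<Rightarrow> 'm" where
  "ident_arr C f = ident_iso C (Cod C f) \<cdot>\<^bsub>C\<^esub> f \<cdot>\<^bsub>C\<^esub> inv_arr C (ident_iso C (Dom C f))"

section \<open>Complexes\<close>

datatype ('o, 'm) cpx = Cpx (cob: "int \<Rightarrow> 'o") (cdiff: "int \<Rightarrow> 'm")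

datatype ('o, 'm) chmap =
  ChMap (cdom: "('o, 'm) cpx") (ccod: "('o, 'm) cpx") (ccomp: "int \<Rightarrow> 'm")

definition is_complex :: "('o, 'm, 'z) lin_cat_scheme \<Rightarrow> ('o, 'm) cpx \<Rightarrow> bool" where
  "is_complex A X \<longleftrightarrow>
     (\<forall>i. cob X i \<in> Ob A \<and> cdiff X i \<in> Hom A (cob X i) (cob X (i + 1)) \<and>
        cdiff X (i + 1) \<cdot>\<^bsub>A\<^esub> cdiff X i = ZeroM A (cob X i) (cob X (i + 2)))"

definition is_chmap :: "('o, 'm, 'z) lin_cat_scheme \<Rightarrow> ('o, 'm) chmap \<Rightarrow> bool" where
  "is_chmap A \<phi> \<longleftrightarrow> is_complex A (cdom \<phi>) \<and> is_complex A (ccod \<phi>) \<and>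
     (\<forall>i. ccomp \<phi> i \<in> Hom A (cob (cdom \<phi>) i) (cob (ccod \<phi>) i) \<and>
        ccomp \<phi> (i + 1) \<cdot>\<^bsub>A\<^esub> cdiff (cdom \<phi>) i = cdiff (ccod \<phi>) i \<cdot>\<^bsub>A\<^esub> ccomp \<phi> i)"

definition cpx_cat ::
  "('o, 'm, 'z) lin_cat_scheme \<Rightarrow> (('o, 'm) cpx, ('o, 'm) chmap) lin_cat" where
  "cpx_cat A = \<lparr>Ob = {X. is_complex A X}, Arr = {\<phi>. is_chmap A \<phi>}, Dom = cdom, Cod = ccod,
     Ide = (\<lambda>X. ChMap X X (\<lambda>i. Ide A (cob X i))),
     Comp = (\<lambda>\<psi> \<phi>. ChMap (cdom \<phi>) (ccod \<psi>) (\<lambda>i. ccomp \<psi> i \<cdot>\<^bsub>A\<^esub> ccomp \<phi> i)),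
     AddM = (\<lambda>\<phi> \<psi>. ChMap (cdom \<phi>) (ccod \<phi>) (\<lambda>i. ccomp \<phi> i \<boxplus>\<^bsub>A\<^esub> ccomp \<psi> i)),
     ZeroM = (\<lambda>X Y. ChMap X Y (\<lambda>i. ZeroM A (cob X i) (cob Y i)))\<rparr>"

definition sd_dt_form ::
  "('o, 'm, 'z) lin_cat_scheme \<Rightarrow> ('o, 'm) chmap \<Rightarrow> (int \<Rightarrow> 'm) \<Rightarrow> (int \<Rightarrow> 'm) \<Rightarrow> bool" where
  "sd_dt_form A \<phi> s t \<longleftrightarrow>
     (\<forall>i. s i \<in> Hom A (cob (cdom \<phi>) i) (cob (ccod \<phi>) (i - 1)) \<and>
          t i \<in> Hom A (cob (cdom \<phi>) i) (cob (ccod \<phi>) (i - 1))) \<and>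
     (\<forall>i. ccomp \<phi> i = (s (i + 1) \<cdot>\<^bsub>A\<^esub> cdiff (cdom \<phi>) i)
                        \<boxplus>\<^bsub>A\<^esub> (cdiff (ccod \<phi>) (i - 1) \<cdot>\<^bsub>A\<^esub> t i))"

definition null_homotopic :: "('o, 'm, 'z) lin_cat_scheme \<Rightarrow> ('o, 'm) chmap set" where
  "null_homotopic A = {\<phi>. is_chmap A \<phi> \<and> (\<exists>s. sd_dt_form A \<phi> s s)}"

definition K_cat ::
  "('o, 'm, 'z) lin_cat_scheme \<Rightarrow> (('o, 'm) cpx, ('o, 'm) chmap set) lin_cat" where
  "K_cat A = quot_cat (cpx_cat A) (null_homotopic A)"

definition Z_ideal :: "('o, 'm, 'z) lin_cat_scheme \<Rightarrow> ('o, 'm) chmap set set" where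
  "Z_ideal A = {quot_class (cpx_cat A) (null_homotopic A) \<phi> | \<phi>.
     is_chmap A \<phi> \<and> (\<exists>s t. sd_dt_form A \<phi> s t)}"

definition KZ_cat ::
  "('o, 'm, 'z) lin_cat_scheme \<Rightarrow> (('o, 'm) cpx, ('o, 'm) chmap set set) lin_cat" where
  "KZ_cat A = quot_cat (K_cat A) (Z_ideal A)"

definition Kw_cat ::
  "('o, 'm, 'z) lin_cat_scheme \<Rightarrow> (('o, 'm) cpx set, ('o, 'm) chmap set set) lin_cat" where
  "Kw_cat A = identify_iso (KZ_cat A)"

definition Kw_ob :: "('o, 'm, 'z) lin_cat_scheme \<Rightarrow> ('o, 'm) cpx \<Rightarrow> ('o, 'm) cpx set" where
  "Kw_ob A X = iso_class (KZ_cat A) X"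

definition Kw_arr :: "('o, 'm, 'z) lin_cat_scheme \<Rightarrow> ('o, 'm) chmap \<Rightarrow> ('o, 'm) chmap set set" where
  "Kw_arr A \<phi> = ident_arr (KZ_cat A)
     (quot_class (K_cat A) (Z_ideal A) (quot_class (cpx_cat A) (null_homotopic A) \<phi>))"

definition Kw01_cat ::
  "('o, 'm, 'z) lin_cat_scheme \<Rightarrow> (('o, 'm) cpx set, ('o, 'm) chmap set set) lin_cat" where
  "Kw01_cat A = full_subcat (Kw_cat A)
     {Kw_ob A X | X. is_complex A X \<and> (\<forall>i. i \<noteq> 0 \<and> i \<noteq> 1 \<longrightarrow> is_zero_ob A (cob X i))}"

definition two_term :: "('o, 'm, 'z) lin_cat_scheme \<Rightarrow> 'm \<Rightarrow> ('o, 'm) cpx" where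
  "two_term A f =
     (let X = (\<lambda>i::int. if i = 0 then Dom A f else if i = 1 then Cod A f else zero_ob A)
      in Cpx X (\<lambda>i. if i = 0 then f else ZeroM A (X i) (X (i + 1))))"

definition two_term_map ::
  "('o, 'm, 'z) lin_cat_scheme \<Rightarrow> 'm \<Rightarrow> 'm \<Rightarrow> 'm \<Rightarrow> 'm \<Rightarrow> ('o, 'm) chmap" where
  "two_term_map A f f' h i = ChMap (two_term A f) (two_term A f')
     (\<lambda>n::int. if n = 0 then h else if n = 1 then i else ZeroM A (zero_ob A) (zero_ob A))"

section \<open>Triangulated categories\<close>

record ('o, 'm) tri_cat = "('o, 'm) lin_cat" +
  ShO :: "'o \<Rightarrow> 'o"
  ShM :: "'m \<Rightarrow> 'm"
  Tri :: "('m \<times> 'm \<times> 'm) set"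

text \<open>\<open>shO C k X\<close> is \<open>X[k]\<close> and \<open>shM C k f\<close> is \<open>f[k]\<close>; the shift is an automorphism
  of the category.\<close>

definition shO :: "('o, 'm, 'z) tri_cat_scheme \<Rightarrow> int \<Rightarrow> 'o \<Rightarrow> 'o" where
  "shO C k X = (if 0 \<le> k then (ShO C ^^ nat k) X else (inv_into (Ob C) (ShO C) ^^ nat (- k)) X)"

definition shM :: "('o, 'm, 'z) tri_cat_scheme \<Rightarrow> int \<Rightarrow> 'm \<Rightarrow> 'm" where
  "shM C k f = (if 0 \<le> k then (ShM C ^^ nat k) f else (inv_into (Arr C) (ShM C) ^^ nat (- k)) f)"

definition is_triangle :: "('o, 'm, 'z) tri_cat_scheme \<Rightarrow> 'm \<Rightarrow> 'm \<Rightarrow> 'm \<Rightarrow> bool" where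
  "is_triangle C u v w \<longleftrightarrow> u \<in> Arr C \<and> v \<in> Arr C \<and> w \<in> Arr C \<and>
     Dom C v = Cod C u \<and> Dom C w = Cod C v \<and> Cod C w = ShO C (Dom C u)"

definition tri_mor ::
  "('o, 'm, 'z) tri_cat_scheme \<Rightarrow> 'm \<times> 'm \<times> 'm \<Rightarrow> 'm \<times> 'm \<times> 'm \<Rightarrow> 'm \<Rightarrow> 'm \<Rightarrow> 'm \<Rightarrow> bool" where
  "tri_mor C \<Delta> \<Delta>' f g h \<longleftrightarrow> (case (\<Delta>, \<Delta>') of ((u, v, w), (u', v', w')) \<Rightarrow>
     f \<in> Hom C (Dom C u) (Dom C u') \<and> g \<in> Hom C (Cod C u) (Cod C u') \<and>
     h \<in> Hom C (Cod C v) (Cod C v') \<and>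
     g \<cdot>\<^bsub>C\<^esub> u = u' \<cdot>\<^bsub>C\<^esub> f \<and> h \<cdot>\<^bsub>C\<^esub> v = v' \<cdot>\<^bsub>C\<^esub> g \<and> ShM C f \<cdot>\<^bsub>C\<^esub> w = w' \<cdot>\<^bsub>C\<^esub> h)"

locale triangulated_category = additive_category C
  for C :: "('o, 'm, 'z) tri_cat_scheme" (structure) +
  assumes shift_functor: "is_functor C C (ShO C) (ShM C)"
    and shift_add: "\<lbrakk>f \<in> Hom C X Y; g \<in> Hom C X Y\<rbrakk> \<Longrightarrow> ShM C (f \<boxplus> g) = ShM C f \<boxplus> ShM C g"
    and shift_bij_Ob: "bij_betw (ShO C) (Ob C) (Ob C)"
    and shift_bij_Arr: "bij_betw (ShM C) (Arr C) (Arr C)"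
    and Tri_triangle: "(u, v, w) \<in> Tri C \<Longrightarrow> is_triangle C u v w"
    and TR1_iso: "\<lbrakk>(u, v, w) \<in> Tri C; is_triangle C u' v' w';
           tri_mor C (u, v, w) (u', v', w') f g h; is_iso C f; is_iso C g; is_iso C h\<rbrakk>
           \<Longrightarrow> (u', v', w') \<in> Tri C"
    and TR1_id: "\<lbrakk>X \<in> Ob C; is_zero_ob C Z\<rbrakk>
           \<Longrightarrow> (Ide C X, ZeroM C X Z, ZeroM C Z (ShO C X)) \<in> Tri C"
    and TR1_cone: "u \<in> Arr C \<Longrightarrow> \<exists>v w. (u, v, w) \<in> Tri C"
    and TR2: "is_triangle C u v w
           \<Longrightarrow> (u, v, w) \<in> Tri C \<longleftrightarrow> (v, w, neg C (ShM C u)) \<in> Tri C"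
    and TR3: "\<lbrakk>(u, v, w) \<in> Tri C; (u', v', w') \<in> Tri C;
           f \<in> Hom C (Dom C u) (Dom C u'); g \<in> Hom C (Cod C u) (Cod C u'); g \<cdot> u = u' \<cdot> f\<rbrakk>
           \<Longrightarrow> \<exists>h. tri_mor C (u, v, w) (u', v', w') f g h"
    and TR4: "\<lbrakk>f \<in> Hom C X Y; g \<in> Hom C Y Z;
           (f, a, a') \<in> Tri C; (g \<cdot> f, b, b') \<in> Tri C; (g, c, c') \<in> Tri C\<rbrakk>
           \<Longrightarrow> \<exists>u v. (u, v, ShM C a \<cdot> c') \<in> Tri C \<and>
                 u \<in> Hom C (Cod C a) (Cod C b) \<and> v \<in> Hom C (Cod C b) (Cod C c) \<and>
                 u \<cdot> a = b \<cdot> g \<and> b' \<cdot> u = a' \<and> v \<cdot> b = c \<and> c' \<cdot> v = ShM C f \<cdot> b'"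

section \<open>Weight structures\<close>

definition orthogonal :: "('o, 'm, 'z) lin_cat_scheme \<Rightarrow> 'o set \<Rightarrow> 'o set \<Rightarrow> bool" where
  "orthogonal C D E \<longleftrightarrow> (\<forall>X \<in> D. \<forall>Y \<in> E. Hom C X Y = {ZeroM C X Y})"

definition additive_subclass :: "('o, 'm, 'z) lin_cat_scheme \<Rightarrow> 'o set \<Rightarrow> bool" where
  "additive_subclass C D \<longleftrightarrow> D \<subseteq> Ob C \<and> (\<forall>Z. is_zero_ob C Z \<longrightarrow> Z \<in> D) \<and>
     (\<forall>X \<in> D. \<forall>Y \<in> D. \<forall>S i j p q. is_dsum C X Y S i j p q \<longrightarrow> S \<in> D)"

definition Karoubi_closed :: "('o, 'm, 'z) lin_cat_scheme \<Rightarrow> 'o set \<Rightarrow> bool" where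
  "Karoubi_closed C D \<longleftrightarrow> (\<forall>X \<in> D. \<forall>Y \<in> Ob C.
     (\<exists>i \<in> Hom C Y X. \<exists>p \<in> Hom C X Y. p \<cdot>\<^bsub>C\<^esub> i = Ide C Y) \<longrightarrow> Y \<in> D)"

locale weight_structure = triangulated_category C
  for C :: "('o, 'm, 'z) tri_cat_scheme" (structure) and Wle Wge :: "'o set" +
  assumes Wle_additive: "additive_subclass C Wle"
    and Wge_additive: "additive_subclass C Wge"
    and Wle_Karoubi: "Karoubi_closed C Wle"
    and Wge_Karoubi: "Karoubi_closed C Wge"
    and Wge_shift: "Wge \<subseteq> ShO C ` Wge"
    and Wle_shift: "ShO C ` Wle \<subseteq> Wle"
    and W_orthogonal: "orthogonal C Wge (ShO C ` Wle)"
    and W_decomposition: "X \<in> Ob C \<Longrightarrow> \<exists>A \<in> Wle. \<exists>B \<in> Wge.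
           \<exists>b \<in> Hom C (shO C (- 1) B) X. \<exists>x \<in> Hom C X A. \<exists>f \<in> Hom C A B. (b, x, f) \<in> Tri C"

definition heart :: "('o, 'm, 'z) lin_cat_scheme \<Rightarrow> 'o set \<Rightarrow> 'o set \<Rightarrow> ('o, 'm) lin_cat" where
  "heart C Wle Wge = full_subcat C (Wge \<inter> Wle)"

section \<open>Weight decompositions\<close>

text \<open>A weight decomposition of \<open>X\<close>, in the rotated form
  \<open>X \<rightarrow> X^(w\<le>0) \<rightarrow> X^(w\<ge>1) \<rightarrow> X[1]\<close>.\<close>

definition weight_dec ::
  "('o, 'm, 'z) tri_cat_scheme \<Rightarrow> 'o set \<Rightarrow> 'o set \<Rightarrow> 'o \<Rightarrow> 'm \<times> 'm \<times> 'm \<Rightarrow> bool" where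
  "weight_dec C Wle Wge X \<Delta> \<longleftrightarrow> (case \<Delta> of (x, f, y) \<Rightarrow>
     (x, f, y) \<in> Tri C \<and> Dom C x = X \<and> Cod C x \<in> Wle \<and> Cod C f \<in> Wge)"

text \<open>The middle arrow \<open>f\<close> of the decomposition \<open>W X\<close> chosen for \<open>X\<close>; its domain and codomain
  are \<open>X^(w\<le>0)\<close> and \<open>X^(w\<ge>1)\<close>.\<close>

definition dec_map :: "('o \<Rightarrow> 'm \<times> 'm \<times> 'm) \<Rightarrow> 'o \<Rightarrow> 'm" where
  "dec_map W X = fst (snd (W X))"

definition WD_ob ::
  "('o, 'm, 'z) tri_cat_scheme \<Rightarrow> ('o \<Rightarrow> 'm \<times> 'm \<times> 'm) \<Rightarrow> 'o \<Rightarrow> ('o, 'm) cpx set" where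
  "WD_ob C W X = Kw_ob C (two_term C (dec_map W X))"

definition pair_map ::
  "('o, 'm, 'z) tri_cat_scheme \<Rightarrow> ('o \<Rightarrow> 'm \<times> 'm \<times> 'm) \<Rightarrow> 'o \<Rightarrow> 'o \<Rightarrow> 'm \<Rightarrow> 'm \<Rightarrow> ('o, 'm) chmap" where
  "pair_map C W X X' h i = two_term_map C (dec_map W X) (dec_map W X') h i"

definition WD_arr ::
  "('o, 'm, 'z) tri_cat_scheme \<Rightarrow> ('o \<Rightarrow> 'm \<times> 'm \<times> 'm) \<Rightarrow> 'm \<Rightarrow> ('o, 'm) chmap set set" where
  "WD_arr C W g = (let X = Dom C g; X' = Cod C g;
       (h, i) = (SOME (h, i). tri_mor C (W X) (W X') g h i)
     in Kw_arr C (pair_map C W X X' h i))"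

definition WD_ker ::
  "('o, 'm, 'z) tri_cat_scheme \<Rightarrow> ('o \<Rightarrow> 'm \<times> 'm \<times> 'm) \<Rightarrow> 'o \<Rightarrow> 'o \<Rightarrow> 'm set" where
  "WD_ker C W X X' =
     kernel (hom_grp C X X') (hom_grp (Kw_cat C) (WD_ob C W X) (WD_ob C W X')) (WD_arr C W)"

definition WD_ideal :: "('o, 'm, 'z) tri_cat_scheme \<Rightarrow> ('o \<Rightarrow> 'm \<times> 'm \<times> 'm) \<Rightarrow> 'm set" where
  "WD_ideal C W = (\<Union>X \<in> Ob C. \<Union>X' \<in> Ob C. WD_ker C W X X')"

section \<open>Weight Postnikov towers and the weight complex\<close>

text \<open>\<open>tw_dec P k\<close> is \<open>X[k] \<rightarrow> X^(w\<le>k) \<rightarrow> X^(w\<ge>k+1) \<rightarrow> X[k+1]\<close>, with arrows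
  \<open>tw_u P k\<close>, \<open>tw_f P k\<close>, \<open>tw_v P k\<close>;
  \<open>tw_a P k : X^(w\<le>k)[-1] \<rightarrow> X^(w\<le>k-1)\<close> and
  \<open>tw_e P k : X^(w\<ge>k+1)[-1] \<rightarrow> X^(w\<ge>k)\<close> are the compatible morphisms.\<close>

record ('o, 'm) tower =
  tw_dec :: "int \<Rightarrow> 'm \<times> 'm \<times> 'm"
  tw_ob :: "int \<Rightarrow> 'o"
  tw_a :: "int \<Rightarrow> 'm"
  tw_c :: "int \<Rightarrow> 'm"
  tw_d :: "int \<Rightarrow> 'm"
  tw_x :: "int \<Rightarrow> 'm"
  tw_e :: "int \<Rightarrow> 'm"
  tw_y :: "int \<Rightarrow> 'm"

definition tw_u :: "('o, 'm) tower \<Rightarrow> int \<Rightarrow> 'm" where "tw_u P k = fst (tw_dec P k)"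
definition tw_f :: "('o, 'm) tower \<Rightarrow> int \<Rightarrow> 'm" where "tw_f P k = fst (snd (tw_dec P k))"
definition tw_v :: "('o, 'm) tower \<Rightarrow> int \<Rightarrow> 'm" where "tw_v P k = snd (snd (tw_dec P k))"
definition tw_le :: "('o, 'm, 'z) tri_cat_scheme \<Rightarrow> ('o, 'm) tower \<Rightarrow> int \<Rightarrow> 'o" where
  "tw_le C P k = Cod C (tw_u P k)"
text \<open>\<open>tw_ge C P k\<close> is \<open>X^(w\<ge>k)\<close>, which occurs in the decomposition of \<open>X[k-1]\<close>.\<close>
definition tw_ge :: "('o, 'm, 'z) tri_cat_scheme \<Rightarrow> ('o, 'm) tower \<Rightarrow> int \<Rightarrow> 'o" where
  "tw_ge C P k = Cod C (tw_f P (k - 1))"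

text \<open>The morphisms \<open>tw_a\<close>, \<open>tw_e\<close> are characterised by the two squares that involve the
  identity of \<open>X\<close>.  Shifting a distinguished triangle by \<open>[-1]\<close> changes the sign of one
  arrow, so the square involving the maps \<open>f\<close> then commutes up to the sign \<open>-1\<close>:
  \<open>e^k \<circ> f^k[-1] = - f^(k-1) \<circ> a^k\<close>.  With this choice of \<open>tw_e\<close> the second family of
  triangles, given by the octahedron axiom, is distinguished with \<open>x^k = (f^k \<circ> d^k)[-1]\<close>
  and no further sign.\<close>

definition is_tower ::
  "('o, 'm, 'z) tri_cat_scheme \<Rightarrow> 'o set \<Rightarrow> 'o set \<Rightarrow> 'o \<Rightarrow> ('o, 'm) tower \<Rightarrow> bool" where
  "is_tower C Wle Wge X P \<longleftrightarrow> (\<forall>k.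
     weight_dec C Wle Wge (shO C k X) (tw_dec P k) \<and>
     tw_ob P k \<in> Wge \<inter> Wle \<and>
     tw_a P k \<in> Hom C (shO C (- 1) (tw_le C P k)) (tw_le C P (k - 1)) \<and>
     tw_a P k \<cdot>\<^bsub>C\<^esub> shM C (- 1) (tw_u P k) = tw_u P (k - 1) \<and>
     tw_e P k \<in> Hom C (shO C (- 1) (tw_ge C P (k + 1))) (tw_ge C P k) \<and>
     tw_v P (k - 1) \<cdot>\<^bsub>C\<^esub> tw_e P k = shM C (- 1) (tw_v P k) \<and>
     tw_c P k \<in> Hom C (tw_le C P (k - 1)) (tw_ob P k) \<and>
     tw_d P k \<in> Hom C (tw_ob P k) (tw_le C P k) \<and>
     (tw_a P k, tw_c P k, tw_d P k) \<in> Tri C \<and>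
     tw_x P k \<in> Hom C (shO C (- 1) (tw_ob P k)) (shO C (- 1) (tw_ge C P (k + 1))) \<and>
     tw_y P k \<in> Hom C (tw_ge C P k) (tw_ob P k) \<and>
     (tw_x P k, tw_e P k, tw_y P k) \<in> Tri C \<and>
     tw_c P k = tw_y P k \<cdot>\<^bsub>C\<^esub> tw_f P (k - 1) \<and>
     tw_x P k = shM C (- 1) (tw_f P k \<cdot>\<^bsub>C\<^esub> tw_d P k))"

text \<open>An extension of \<open>g\<close> to a morphism of towers: morphisms of weight decompositions
  \<open>(g[k], h k, i k)\<close> and morphisms of the triangles
  \<open>X^(w\<le>k)[-1] \<rightarrow> X^(w\<le>k-1) \<rightarrow> X^k \<rightarrow> X^(w\<le>k)\<close>.
  Compatibility with \<open>tw_e\<close> and \<open>tw_x\<close> follows.  Compatibility with \<open>tw_y\<close> is not required: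
  the equations of a tower do not determine \<open>y^k\<close> from \<open>d^k\<close> (for \<open>X\<close> in the heart and
  \<open>X^(w\<le>-1) = 0\<close> both \<open>d^0\<close> and \<open>y^0\<close> are arbitrary isomorphisms), and the weight complex
  does not involve \<open>y^k\<close> except through \<open>c^k\<close>.\<close>

definition is_tower_mor ::
  "('o, 'm, 'z) tri_cat_scheme \<Rightarrow> ('o, 'm) tower \<Rightarrow> ('o, 'm) tower \<Rightarrow> 'm \<Rightarrow>
   (int \<Rightarrow> 'm) \<Rightarrow> (int \<Rightarrow> 'm) \<Rightarrow> (int \<Rightarrow> 'm) \<Rightarrow> bool" where
  "is_tower_mor C P P' g h i \<phi> \<longleftrightarrow> (\<forall>k.
     tri_mor C (tw_dec P k) (tw_dec P' k) (shM C k g) (h k) (i k) \<and>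
     tri_mor C (tw_a P k, tw_c P k, tw_d P k) (tw_a P' k, tw_c P' k, tw_d P' k)
       (shM C (- 1) (h k)) (h (k - 1)) (\<phi> k))"

definition weight_complex :: "('o, 'm, 'z) tri_cat_scheme \<Rightarrow> ('o, 'm) tower \<Rightarrow> ('o, 'm) cpx" where
  "weight_complex C P = Cpx (tw_ob P) (\<lambda>i. tw_c P (i + 1) \<cdot>\<^bsub>C\<^esub> tw_d P i)"

definition wc_ob ::
  "('o, 'm, 'z) tri_cat_scheme \<Rightarrow> 'o set \<Rightarrow> 'o set \<Rightarrow> ('o \<Rightarrow> ('o, 'm) tower) \<Rightarrow> 'o
     \<Rightarrow> ('o, 'm) cpx set" where
  "wc_ob C Wle Wge P X = Kw_ob (heart C Wle Wge) (weight_complex C (P X))"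

definition wc_map ::
  "('o, 'm, 'z) tri_cat_scheme \<Rightarrow> ('o \<Rightarrow> ('o, 'm) tower) \<Rightarrow> 'o \<Rightarrow> 'o \<Rightarrow> (int \<Rightarrow> 'm)
     \<Rightarrow> ('o, 'm) chmap" where
  "wc_map C P X X' \<phi> = ChMap (weight_complex C (P X)) (weight_complex C (P X')) \<phi>"

definition wc_arr ::
  "('o, 'm, 'z) tri_cat_scheme \<Rightarrow> 'o set \<Rightarrow> 'o set \<Rightarrow> ('o \<Rightarrow> ('o, 'm) tower) \<Rightarrow> 'm
     \<Rightarrow> ('o, 'm) chmap set set" where
  "wc_arr C Wle Wge P g = (let X = Dom C g; X' = Cod C g;
       \<phi> = (SOME \<phi>. \<exists>h i. is_tower_mor C (P X) (P X') g h i \<phi>)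
     in Kw_arr (heart C Wle Wge) (wc_map C P X X' \<phi>))"

end

theory Submission
  imports Defs
begin

text \<open>By orthogonality and the axiom TR3 every \<open>g : X \<rightarrow> X'\<close> extends to a morphism
  \<open>(g, h, i)\<close> of weight decompositions.  A difference of two extensions has \<open>h\<close> vanishing on
  \<open>X \<rightarrow> X^(w\<le>0)\<close> and \<open>i\<close> killed by \<open>X'^(w\<ge>1) \<rightarrow> X'[1]\<close>, so \<open>h = s f\<close> and \<open>i = f' t\<close>: this is
  exactly the relation \<open>s d + d t\<close> on two-term complexes.  Hence \<open>g\<close> lies in the kernel \<open>T\<close> iff
  \<open>(g, 0, 0)\<close> is a morphism of decompositions; such a \<open>g\<close> factors through \<open>X'^(w\<ge>1)[-1] \<rightarrow> X'\<close>
  and kills the corresponding arrow for \<open>X\<close>, whence \<open>T\<^sup>2 = 0\<close>, and units and idempotents lift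
  along a square-zero ideal.

  For towers, let \<open>(h, \<phi>)\<close> be the difference of two extensions of \<open>g\<close>.  Then \<open>h^k\<close> vanishes on
  \<open>X[k]\<close>, so by orthogonality \<open>h^k d^k = d'^k s c^(k+1) d^k\<close> for some \<open>s\<close>; the rest
  \<open>\<phi>^k - s c^(k+1) d^k\<close> is killed by \<open>d'^k\<close> and lifts to \<open>c'^k d'^(k-1) t\<close>.\<close>

section \<open>Preadditive categories\<close>

text \<open>The maps \<open>s\<close> and \<open>t\<close> come from opposite sides:
  \<open>s\<close> from factoring through an arrow in the data of \<open>X\<close>, \<open>t\<close>
  from lifting along an arrow in the data of \<open>X'\<close>. Nothing in the construction relates
  them, so differences of extensions have no reason to be null-homotopic; dividing by all
  \<open>s d + d t\<close> with independent \<open>s\<close> and \<open>t\<close> restores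
  uniqueness. This is also why a tower can be treated one degree at a time: a homotopy would require
  the \<open>s\<close> found in degree \<open>k\<close> to agree with the \<open>t\<close> found in
  degree \<open>k + 1\<close>. A morphism of the target category is a class of classes of chain
  maps, transported to chosen members of isomorphism classes. Equalities there are therefore
  reduced, once and for all, to the existence of \<open>s\<close> and \<open>t\<close> for a
  difference of chain maps. Surjectivity of \<open>WD\<close> on morphisms is TR3 for rotated
  triangles: a commutative square on \<open>f\<close> and \<open>f'\<close> is completed on the left
  by some \<open>g\<close>. Claims involving \<open>[-1]\<close> are shifted by \<open>[1]\<close>
  and recovered from the injectivity of the shift.\<close>

lemma Hom_iff: "f \<in> Hom C X Y \<longleftrightarrow> f \<in> Arr C \<and> Dom C f = X \<and> Cod C f = Y"
  by (simp add: Hom_def)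

lemma hom_grp_simps [simp]:
  "carrier (hom_grp C X Y) = Hom C X Y" "mult (hom_grp C X Y) = AddM C"
  "one (hom_grp C X Y) = ZeroM C X Y"
  by (simp_all add: hom_grp_def)

context preadditive_category
begin

lemma Ob_Dom [simp]: "f \<in> Arr C \<Longrightarrow> Dom C f \<in> Ob C" by (rule Dom_Ob)
lemma Ob_Cod [simp]: "f \<in> Arr C \<Longrightarrow> Cod C f \<in> Ob C" by (rule Cod_Ob)

lemma Comp_props [simp]:
  assumes "f \<in> Arr C" "g \<in> Arr C" "Dom C g = Cod C f"
  shows "g \<cdot> f \<in> Arr C" "Dom C (g \<cdot> f) = Dom C f" "Cod C (g \<cdot> f) = Cod C g"
  using assms Comp_Hom[of f "Dom C f" "Cod C f" g "Cod C g"] by (auto simp: Hom_iff)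

lemma Comp_assoc' [simp]:
  assumes "f \<in> Arr C" "g \<in> Arr C" "h \<in> Arr C" "Dom C g = Cod C f" "Dom C h = Cod C g"
  shows "(h \<cdot> g) \<cdot> f = h \<cdot> (g \<cdot> f)"
  using assms Comp_assoc by (auto simp: Hom_iff)

lemma Ide_props [simp]:
  assumes "X \<in> Ob C"
  shows "Ide C X \<in> Arr C" "Dom C (Ide C X) = X" "Cod C (Ide C X) = X"
  using assms Ide_Hom by (auto simp: Hom_iff)

lemma Ide_neutral [simp]:
  "\<lbrakk>f \<in> Arr C; Cod C f = Y\<rbrakk> \<Longrightarrow> Ide C Y \<cdot> f = f"
  "\<lbrakk>f \<in> Arr C; Dom C f = X\<rbrakk> \<Longrightarrow> f \<cdot> Ide C X = f"
  using Ide_left Ide_right by (auto simp: Hom_iff)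

lemma group_hom_grp: "\<lbrakk>X \<in> Ob C; Y \<in> Ob C\<rbrakk> \<Longrightarrow> group (hom_grp C X Y)"
  using hom_comm_group comm_group.axioms(2) by blast

lemma Zero_props [simp]:
  assumes "X \<in> Ob C" "Y \<in> Ob C"
  shows "ZeroM C X Y \<in> Arr C" "Dom C (ZeroM C X Y) = X" "Cod C (ZeroM C X Y) = Y"
  using monoid.one_closed[OF group.is_monoid[OF group_hom_grp[OF assms]]] by (auto simp: Hom_iff)

lemma Add_props [simp]:
  assumes "f \<in> Arr C" "g \<in> Arr C" "Dom C g = Dom C f" "Cod C g = Cod C f"
  shows "f \<boxplus> g \<in> Arr C" "Dom C (f \<boxplus> g) = Dom C f" "Cod C (f \<boxplus> g) = Cod C f"
  using assms monoid.m_closed[OF group.is_monoid[OF group_hom_grp[of "Dom C f" "Cod C f"]]]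
  by (auto simp: Hom_iff)

lemma neg_props [simp]:
  assumes "f \<in> Arr C"
  shows "neg C f \<in> Arr C" "Dom C (neg C f) = Dom C f" "Cod C (neg C f) = Cod C f"
  using assms group.inv_closed[OF group_hom_grp[of "Dom C f" "Cod C f"]]
  by (auto simp: Hom_iff neg_def)

lemma Add_assoc:
  assumes "f \<in> Arr C" "g \<in> Arr C" "h \<in> Arr C" "Dom C g = Dom C f" "Cod C g = Cod C f"
    "Dom C h = Dom C f" "Cod C h = Cod C f"
  shows "(f \<boxplus> g) \<boxplus> h = f \<boxplus> (g \<boxplus> h)"
  using assms monoid.m_assoc[OF group.is_monoid[OF group_hom_grp[of "Dom C f" "Cod C f"]]]
  by (auto simp: Hom_iff)

lemma Add_commute:
  assumes "f \<in> Arr C" "g \<in> Arr C" "Dom C g = Dom C f" "Cod C g = Cod C f"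
  shows "f \<boxplus> g = g \<boxplus> f"
  using assms comm_monoid.m_comm[OF comm_group.axioms(1)[OF hom_comm_group[of "Dom C f" "Cod C f"]]]
  by (auto simp: Hom_iff)

lemma Add_left_commute:
  assumes "f \<in> Arr C" "g \<in> Arr C" "h \<in> Arr C" "Dom C g = Dom C f" "Cod C g = Cod C f"
    "Dom C h = Dom C f" "Cod C h = Cod C f"
  shows "f \<boxplus> (g \<boxplus> h) = g \<boxplus> (f \<boxplus> h)"
  by (metis Add_assoc Add_commute assms)

lemmas Add_ac = Add_assoc Add_commute Add_left_commute

lemma Add_Zero [simp]:
  assumes "f \<in> Arr C" "Dom C f = X" "Cod C f = Y"
  shows "ZeroM C X Y \<boxplus> f = f" "f \<boxplus> ZeroM C X Y = f"
  using assms monoid.l_one[OF group.is_monoid[OF group_hom_grp[of X Y]]]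
    monoid.r_one[OF group.is_monoid[OF group_hom_grp[of X Y]]]
  by (auto simp: Hom_iff)

lemma Add_neg [simp]:
  assumes "f \<in> Arr C"
  shows "neg C f \<boxplus> f = ZeroM C (Dom C f) (Cod C f)" "f \<boxplus> neg C f = ZeroM C (Dom C f) (Cod C f)"
  using assms group.l_inv[OF group_hom_grp[of "Dom C f" "Cod C f"]]
    group.r_inv[OF group_hom_grp[of "Dom C f" "Cod C f"]]
  by (auto simp: Hom_iff neg_def)

lemma Add_neg_cancel [simp]:
  assumes "f \<in> Arr C" "g \<in> Arr C" "Dom C g = Dom C f" "Cod C g = Cod C f"
  shows "f \<boxplus> (neg C f \<boxplus> g) = g" "neg C f \<boxplus> (f \<boxplus> g) = g"
  using assms by (simp_all flip: Add_assoc)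

lemma Add_left_cancel:
  assumes "f \<in> Arr C" "g \<in> Arr C" "h \<in> Arr C" "Dom C g = Dom C f" "Cod C g = Cod C f"
    "Dom C h = Dom C f" "Cod C h = Cod C f"
  shows "f \<boxplus> g = f \<boxplus> h \<longleftrightarrow> g = h"
  using assms by (metis Add_neg_cancel(2))

lemma neg_unique:
  assumes "f \<in> Arr C" "g \<in> Arr C" "Dom C g = Dom C f" "Cod C g = Cod C f"
    "f \<boxplus> g = ZeroM C (Dom C f) (Cod C f)"
  shows "g = neg C f"
proof -
  have "g = neg C f \<boxplus> (f \<boxplus> g)" using assms(1-4) by simp
  also have "\<dots> = neg C f" using assms by simp
  finally show ?thesis .
qed

lemma neg_neg [simp]: "f \<in> Arr C \<Longrightarrow> neg C (neg C f) = f"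
  by (rule neg_unique[symmetric]) simp_all

lemma neg_Zero [simp]: "\<lbrakk>X \<in> Ob C; Y \<in> Ob C\<rbrakk> \<Longrightarrow> neg C (ZeroM C X Y) = ZeroM C X Y"
  by (rule neg_unique[symmetric]) simp_all

lemma neg_Add [simp]:
  assumes "f \<in> Arr C" "g \<in> Arr C" "Dom C g = Dom C f" "Cod C g = Cod C f"
  shows "neg C (f \<boxplus> g) = neg C f \<boxplus> neg C g"
  using assms by (intro neg_unique[symmetric]) (simp_all add: Add_ac)

lemma diff_zero_iff:
  assumes "f \<in> Arr C" "g \<in> Arr C" "Dom C g = Dom C f" "Cod C g = Cod C f"
  shows "f \<boxplus> neg C g = ZeroM C (Dom C f) (Cod C f) \<longleftrightarrow> f = g"
proof
  assume h: "f \<boxplus> neg C g = ZeroM C (Dom C f) (Cod C f)"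
  have "f = (f \<boxplus> neg C g) \<boxplus> g" using assms by (simp add: Add_assoc)
  then show "f = g" using assms by (simp add: h)
qed (use assms in simp)

lemma distrib [simp]:
  "\<lbrakk>f \<in> Arr C; f' \<in> Arr C; g \<in> Arr C; Dom C f' = Dom C f; Cod C f' = Cod C f; Dom C g = Cod C f\<rbrakk>
    \<Longrightarrow> g \<cdot> (f \<boxplus> f') = (g \<cdot> f) \<boxplus> (g \<cdot> f')"
  "\<lbrakk>f \<in> Arr C; g \<in> Arr C; g' \<in> Arr C; Dom C g' = Dom C g; Cod C g' = Cod C g; Dom C g = Cod C f\<rbrakk>
    \<Longrightarrow> (g \<boxplus> g') \<cdot> f = (g \<cdot> f) \<boxplus> (g' \<cdot> f)"
  using Comp_add_right Comp_add_left by (auto simp: Hom_iff)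

text \<open>A group has no idempotent but its unit. Hence every operation respecting addition, such
  as composition or the shift, sends zero morphisms to zero morphisms.\<close>

lemma idem_zero:
  assumes "f \<in> Arr C" "f \<boxplus> f = f"
  shows "f = ZeroM C (Dom C f) (Cod C f)"
proof -
  have "f \<boxplus> f = f \<boxplus> ZeroM C (Dom C f) (Cod C f)" using assms by simp
  then show ?thesis using assms(1) by (subst (asm) Add_left_cancel) simp_all
qed

lemma Comp_Zero [simp]:
  assumes "f \<in> Arr C" "Z \<in> Ob C"
  shows "Y = Cod C f \<Longrightarrow> ZeroM C Y Z \<cdot> f = ZeroM C (Dom C f) Z"
    "Y = Dom C f \<Longrightarrow> f \<cdot> ZeroM C Z Y = ZeroM C Z (Cod C f)"
proof -
  let ?z = "ZeroM C (Cod C f) Z"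
  have "(?z \<boxplus> ?z) \<cdot> f = (?z \<cdot> f) \<boxplus> (?z \<cdot> f)" using assms by (intro distrib) simp_all
  then have "?z \<cdot> f \<boxplus> ?z \<cdot> f = ?z \<cdot> f" using assms by simp
  from idem_zero[OF _ this] show "Y = Cod C f \<Longrightarrow> ZeroM C Y Z \<cdot> f = ZeroM C (Dom C f) Z"
    using assms by simp
  let ?y = "ZeroM C Z (Dom C f)"
  have "f \<cdot> (?y \<boxplus> ?y) = (f \<cdot> ?y) \<boxplus> (f \<cdot> ?y)" using assms by (intro distrib) simp_all
  then have "f \<cdot> ?y \<boxplus> f \<cdot> ?y = f \<cdot> ?y" using assms by simp
  from idem_zero[OF _ this] show "Y = Dom C f \<Longrightarrow> f \<cdot> ZeroM C Z Y = ZeroM C Z (Cod C f)"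
    using assms by simp
qed

lemma Comp_neg [simp]:
  assumes "f \<in> Arr C" "g \<in> Arr C" "Dom C g = Cod C f"
  shows "neg C g \<cdot> f = neg C (g \<cdot> f)" "g \<cdot> neg C f = neg C (g \<cdot> f)"
  using assms by (intro neg_unique, simp_all flip: distrib)+

text \<open>With zero morphisms at hand, unique existence of morphisms collapses to one equation,
  which the shift visibly preserves.\<close>

lemma is_zero_ob_iff: "is_zero_ob C Z \<longleftrightarrow> Z \<in> Ob C \<and> Ide C Z = ZeroM C Z Z"
proof
  assume z: "is_zero_ob C Z"
  then have "Z \<in> Ob C" by (simp add: is_zero_ob_def)
  moreover from this z have "\<exists>!f. f \<in> Hom C Z Z" by (simp add: is_zero_ob_def)
  ultimately show "Z \<in> Ob C \<and> Ide C Z = ZeroM C Z Z" by (auto simp: Hom_iff)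
next
  assume z: "Z \<in> Ob C \<and> Ide C Z = ZeroM C Z Z"
  have "f = ZeroM C X Z" if "f \<in> Hom C X Z" for X f
    using Ide_neutral(1)[of f Z] that z by (auto simp: Hom_iff)
  moreover have "f = ZeroM C Z X" if "f \<in> Hom C Z X" for X f
    using Ide_neutral(2)[of f Z] that z by (auto simp: Hom_iff)
  moreover have "ZeroM C X Z \<in> Hom C X Z \<and> ZeroM C Z X \<in> Hom C Z X" if "X \<in> Ob C" for X
    using that z by (auto simp: Hom_iff)
  ultimately show "is_zero_ob C Z" unfolding is_zero_ob_def using z by blast
qed

end

lemma full_subcat_simps [simp]:
  "Ob (full_subcat C D) = Ob C \<inter> D" "Dom (full_subcat C D) = Dom C" "Cod (full_subcat C D) = Cod C"
  "Arr (full_subcat C D) = {f \<in> Arr C. Dom C f \<in> D \<and> Cod C f \<in> D}"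
  "Ide (full_subcat C D) = Ide C" "Comp (full_subcat C D) = Comp C"
  "AddM (full_subcat C D) = AddM C" "ZeroM (full_subcat C D) = ZeroM C"
  by (simp_all add: full_subcat_def)

lemma Hom_full_subcat:
  "\<lbrakk>X \<in> D; Y \<in> D\<rbrakk> \<Longrightarrow> Hom (full_subcat C D) X Y = Hom C X Y"
  by (auto simp: Hom_iff)

lemma hom_grp_full_subcat:
  "\<lbrakk>X \<in> D; Y \<in> D\<rbrakk> \<Longrightarrow> hom_grp (full_subcat C D) X Y = hom_grp C X Y"
  by (simp add: hom_grp_def Hom_full_subcat)

lemma neg_full_subcat: "f \<in> Arr (full_subcat C D) \<Longrightarrow> neg (full_subcat C D) f = neg C f"
  by (simp add: neg_def hom_grp_full_subcat)

text \<open>Makes the theory of complexes below, developed over any preadditive category, available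
  for the heart.\<close>

lemma (in preadditive_category) preadditive_full_subcat: "preadditive_category (full_subcat C D)"
  by (rule preadditive_category.intro)
    (auto simp: Hom_iff hom_grp_full_subcat hom_comm_group)

section \<open>Full additive functors, quotients and identification of isomorphic objects\<close>

text \<open>Fullness is expressed as an equality of images of morphism groups. In this form it
  survives composition, so surjectivity passes through all the projections leading from complexes to
  \<open>Kw_cat\<close>.\<close>

definition full_additive_functor ::
  "('o, 'm, 'z) lin_cat_scheme \<Rightarrow> ('p, 'n, 'y) lin_cat_scheme \<Rightarrow> ('o \<Rightarrow> 'p) \<Rightarrow> ('m \<Rightarrow> 'n) \<Rightarrow> bool" where
  "full_additive_functor C D Fo Fm \<longleftrightarrow> is_functor C D Fo Fm \<and>
     (\<forall>X \<in> Ob C. \<forall>Y \<in> Ob C. Fm ` Hom C X Y = Hom D (Fo X) (Fo Y)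
        \<and> Fm (ZeroM C X Y) = ZeroM D (Fo X) (Fo Y)
        \<and> (\<forall>f \<in> Hom C X Y. \<forall>g \<in> Hom C X Y. Fm (f \<boxplus>\<^bsub>C\<^esub> g) = Fm f \<boxplus>\<^bsub>D\<^esub> Fm g))"

lemma full_additive_functorD:
  assumes "full_additive_functor C D Fo Fm"
  shows "X \<in> Ob C \<Longrightarrow> Fo X \<in> Ob D"
    "\<lbrakk>X \<in> Ob C; Y \<in> Ob C\<rbrakk> \<Longrightarrow> Fm ` Hom C X Y = Hom D (Fo X) (Fo Y)"
    "X \<in> Ob C \<Longrightarrow> Fm (Ide C X) = Ide D (Fo X)"
    "\<lbrakk>X \<in> Ob C; Y \<in> Ob C; Z \<in> Ob C; f \<in> Hom C X Y; g \<in> Hom C Y Z\<rbrakk>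
      \<Longrightarrow> Fm (g \<cdot>\<^bsub>C\<^esub> f) = Fm g \<cdot>\<^bsub>D\<^esub> Fm f"
    "\<lbrakk>X \<in> Ob C; Y \<in> Ob C\<rbrakk> \<Longrightarrow> Fm (ZeroM C X Y) = ZeroM D (Fo X) (Fo Y)"
    "\<lbrakk>X \<in> Ob C; Y \<in> Ob C; f \<in> Hom C X Y; g \<in> Hom C X Y\<rbrakk>
      \<Longrightarrow> Fm (f \<boxplus>\<^bsub>C\<^esub> g) = Fm f \<boxplus>\<^bsub>D\<^esub> Fm g"
  using assms by (simp_all add: full_additive_functor_def is_functor_def)

lemma full_additive_functor_comp:
  assumes F: "full_additive_functor C D Fo Fm" and G: "full_additive_functor D E Go Gm"
  shows "full_additive_functor C E (\<lambda>X. Go (Fo X)) (\<lambda>f. Gm (Fm f))"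
proof -
  note FD = full_additive_functorD[OF F] and GD = full_additive_functorD[OF G]
  have hom: "Fm f \<in> Hom D (Fo X) (Fo Y)" if "X \<in> Ob C" "Y \<in> Ob C" "f \<in> Hom C X Y" for X Y f
    using FD(2) that by blast
  have full: "(\<lambda>f. Gm (Fm f)) ` Hom C X Y = Hom E (Go (Fo X)) (Go (Fo Y))"
    if "X \<in> Ob C" "Y \<in> Ob C" for X Y
    using that by (simp add: FD(1,2) GD(2) flip: image_image)
  have comp: "Gm (Fm (Comp C g f)) = Comp E (Gm (Fm g)) (Gm (Fm f))"
    if "X \<in> Ob C" "Y \<in> Ob C" "Z \<in> Ob C" "f \<in> Hom C X Y" "g \<in> Hom C Y Z" for X Y Z f g
    using that
    by (simp add: FD(4)[OF that] GD(4)[OF FD(1) FD(1) FD(1) hom hom, OF that(1,2,3,1,2,4,2,3,5)])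
  have add: "Gm (Fm (AddM C f g)) = AddM E (Gm (Fm f)) (Gm (Fm g))"
    if "X \<in> Ob C" "Y \<in> Ob C" "f \<in> Hom C X Y" "g \<in> Hom C X Y" for X Y f g
    using that
    by (simp add: FD(6)[OF that] GD(6)[OF FD(1) FD(1) hom hom, OF that(1,2,1,2,3,1,2,4)])
  have ide: "Gm (Fm (Ide C X)) = Ide E (Go (Fo X))" if "X \<in> Ob C" for X
    using that by (simp add: FD(1,3) GD(3))
  have zero: "Gm (Fm (ZeroM C X Y)) = ZeroM E (Go (Fo X)) (Go (Fo Y))"
    if "X \<in> Ob C" "Y \<in> Ob C" for X Y
    using that by (simp add: FD(1,5) GD(5))
  have hom2: "Gm (Fm f) \<in> Hom E (Go (Fo X)) (Go (Fo Y))"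
    if "X \<in> Ob C" "Y \<in> Ob C" "f \<in> Hom C X Y" for X Y f
    using full[OF that(1,2)] that(3) by blast
  have is_fun: "is_functor C E (\<lambda>X. Go (Fo X)) (\<lambda>f. Gm (Fm f))"
    unfolding is_functor_def
    by (intro conjI ballI; (rule hom2 ide comp; assumption)?) (simp add: FD(1) GD(1))
  show ?thesis
    unfolding full_additive_functor_def
    by (intro conjI ballI is_fun; rule full zero add; assumption)
qed

text \<open>Sums, negatives and zeros make \<open>T\<close> a subgroup of each morphism group, which
  is what cosets require. Closure under direct sums follows from addition and composition, see
  \<open>two_sided\<close>.\<close>

locale hom_ideal = preadditive_category +
  fixes T
  assumes T_Arr: "T \<subseteq> Arr C"
    and T_add: "\<lbrakk>f \<in> T; g \<in> T; Dom C g = Dom C f; Cod C g = Cod C f\<rbrakk> \<Longrightarrow> f \<boxplus> g \<in> T"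
    and T_neg: "f \<in> T \<Longrightarrow> neg C f \<in> T"
    and T_zero: "\<lbrakk>X \<in> Ob C; Y \<in> Ob C\<rbrakk> \<Longrightarrow> ZeroM C X Y \<in> T"
    and T_left: "\<lbrakk>f \<in> T; g \<in> Arr C; Dom C g = Cod C f\<rbrakk> \<Longrightarrow> g \<cdot> f \<in> T"
    and T_right: "\<lbrakk>f \<in> T; g \<in> Arr C; Cod C g = Dom C f\<rbrakk> \<Longrightarrow> f \<cdot> g \<in> T"
begin

lemma TD: "f \<in> T \<Longrightarrow> f \<in> Arr C"
  using T_Arr by blast

lemma quot_class_eq:
  assumes "f \<in> Arr C"
  shows "quot_class C T f = {g \<in> Arr C. Dom C g = Dom C f \<and> Cod C g = Cod C f \<and> g \<boxplus> neg C f \<in> T}"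
proof (intro equalityI subsetI)
  fix g assume "g \<in> quot_class C T f"
  then obtain h where h: "h \<in> T" "h \<in> Hom C (Dom C f) (Cod C f)" "g = h \<boxplus> f"
    by (auto simp: quot_class_def r_coset_def)
  then have "g \<boxplus> neg C f = h"
    using assms by (auto simp: Hom_iff Add_assoc)
  then show "g \<in> {g \<in> Arr C. Dom C g = Dom C f \<and> Cod C g = Cod C f \<and> g \<boxplus> neg C f \<in> T}"
    using h assms by (auto simp: Hom_iff)
next
  fix g assume g: "g \<in> {g \<in> Arr C. Dom C g = Dom C f \<and> Cod C g = Cod C f \<and> g \<boxplus> neg C f \<in> T}"
  then have "g = (g \<boxplus> neg C f) \<boxplus> f" using assms by (auto simp: Add_assoc)
  then show "g \<in> quot_class C T f"
    using g assms by (auto simp: quot_class_def r_coset_def Hom_iff)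
qed

lemma T_diff_sym:
  assumes "f \<in> Arr C" "g \<in> Arr C" "Dom C g = Dom C f" "Cod C g = Cod C f" "f \<boxplus> neg C g \<in> T"
  shows "g \<boxplus> neg C f \<in> T"
  using T_neg[OF assms(5)] assms by (simp add: Add_commute)

lemma T_diff_trans:
  assumes "f \<in> Arr C" "g \<in> Arr C" "h \<in> Arr C" "Dom C g = Dom C f" "Cod C g = Cod C f"
    "Dom C h = Dom C f" "Cod C h = Cod C f" "f \<boxplus> neg C g \<in> T" "g \<boxplus> neg C h \<in> T"
  shows "f \<boxplus> neg C h \<in> T"
  using T_add[OF assms(8,9)] assms by (simp add: Add_assoc)

lemma quot_class_cong:
  assumes "f \<in> Arr C" "g \<in> Arr C"
  shows "quot_class C T f = quot_class C T g \<longleftrightarrow>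
    Dom C g = Dom C f \<and> Cod C g = Cod C f \<and> f \<boxplus> neg C g \<in> T"
proof
  assume "quot_class C T f = quot_class C T g"
  moreover have "f \<in> quot_class C T f"
    using assms T_zero by (simp add: quot_class_eq)
  ultimately have "f \<in> quot_class C T g" by simp
  then show "Dom C g = Dom C f \<and> Cod C g = Cod C f \<and> f \<boxplus> neg C g \<in> T"
    using assms by (auto simp: quot_class_eq)
next
  assume h: "Dom C g = Dom C f \<and> Cod C g = Cod C f \<and> f \<boxplus> neg C g \<in> T"
  then have "g \<boxplus> neg C f \<in> T" using assms T_diff_sym by simp
  then show "quot_class C T f = quot_class C T g"
    using h assms by (auto simp: quot_class_eq intro: T_diff_trans[of _ f g] T_diff_trans[of _ g f])
qed

text \<open>Operations of \<open>quot_cat\<close> are computed on members picked by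
  \<open>SOME\<close>; what is known of such a member is that it has the ends of \<open>f\<close>
  and differs from \<open>f\<close> by an element of \<open>T\<close>.\<close>

lemma some_quot_class:
  assumes "f \<in> Arr C"
  obtains g where "(SOME g. g \<in> quot_class C T f) = g" "g \<in> Arr C" "Dom C g = Dom C f"
    "Cod C g = Cod C f" "g \<boxplus> neg C f \<in> T"
proof -
  have "f \<in> quot_class C T f" using assms T_zero by (simp add: quot_class_eq)
  then have "(SOME g. g \<in> quot_class C T f) \<in> quot_class C T f" by (rule someI)
  with that show thesis using assms by (simp add: quot_class_eq)
qed

lemma quot_cat_Dom_Cod [simp]:
  assumes "f \<in> Arr C"
  shows "Dom (quot_cat C T) (quot_class C T f) = Dom C f"
    "Cod (quot_cat C T) (quot_class C T f) = Cod C f"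
  by (rule some_quot_class[OF assms]; simp add: quot_cat_def)+

lemma quot_cat_Comp [simp]:
  assumes "f \<in> Arr C" "g \<in> Arr C" "Dom C g = Cod C f"
  shows "quot_class C T g \<cdot>\<^bsub>quot_cat C T\<^esub> quot_class C T f = quot_class C T (g \<cdot> f)"
proof -
  obtain f' where f': "(SOME g. g \<in> quot_class C T f) = f'" "f' \<in> Arr C" "Dom C f' = Dom C f"
    "Cod C f' = Cod C f" "f' \<boxplus> neg C f \<in> T" by (rule some_quot_class[OF assms(1)])
  obtain g' where g': "(SOME h. h \<in> quot_class C T g) = g'" "g' \<in> Arr C" "Dom C g' = Dom C g"
    "Cod C g' = Cod C g" "g' \<boxplus> neg C g \<in> T" by (rule some_quot_class[OF assms(2)])
  \<comment> \<open>Telescoping: \<open>g' f' - g f = g' (f' - f) + (g' - g) f\<close>.\<close>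
  have "g' \<cdot> (f' \<boxplus> neg C f) \<boxplus> (g' \<boxplus> neg C g) \<cdot> f \<in> T"
    using f' g' assms by (intro T_add T_left[OF f'(5)] T_right[OF g'(5)]) simp_all
  then have "g' \<cdot> f' \<boxplus> neg C (g \<cdot> f) \<in> T"
    using f' g' assms by (simp add: Add_assoc)
  then show ?thesis
    using f' g' assms by (simp add: quot_cat_def quot_class_cong)
qed

lemma quot_cat_AddM [simp]:
  assumes "f \<in> Arr C" "g \<in> Arr C" "Dom C g = Dom C f" "Cod C g = Cod C f"
  shows "quot_class C T f \<boxplus>\<^bsub>quot_cat C T\<^esub> quot_class C T g = quot_class C T (f \<boxplus> g)"
proof -
  obtain f' where f': "(SOME g. g \<in> quot_class C T f) = f'" "f' \<in> Arr C" "Dom C f' = Dom C f"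
    "Cod C f' = Cod C f" "f' \<boxplus> neg C f \<in> T" by (rule some_quot_class[OF assms(1)])
  obtain g' where g': "(SOME h. h \<in> quot_class C T g) = g'" "g' \<in> Arr C" "Dom C g' = Dom C g"
    "Cod C g' = Cod C g" "g' \<boxplus> neg C g \<in> T" by (rule some_quot_class[OF assms(2)])
  have "(f' \<boxplus> neg C f) \<boxplus> (g' \<boxplus> neg C g) \<in> T"
    using f' g' assms by (intro T_add[OF f'(5) g'(5)]) simp_all
  then have "(f' \<boxplus> g') \<boxplus> neg C (f \<boxplus> g) \<in> T"
    using f' g' assms by (simp add: Add_ac)
  then show ?thesis
    using f' g' assms by (simp add: quot_cat_def quot_class_cong)
qed

lemma quot_cat_simps [simp]:
  "Ob (quot_cat C T) = Ob C" "Arr (quot_cat C T) = quot_class C T ` Arr C"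
  "Ide (quot_cat C T) X = quot_class C T (Ide C X)"
  "ZeroM (quot_cat C T) X Y = quot_class C T (ZeroM C X Y)"
  by (simp_all add: quot_cat_def)

lemma Hom_quot_cat: "Hom (quot_cat C T) X Y = quot_class C T ` Hom C X Y"
  by (auto simp: Hom_iff)

lemma full_additive_quot_class: "full_additive_functor C (quot_cat C T) (\<lambda>X. X) (quot_class C T)"
  by (auto simp: full_additive_functor_def is_functor_def Hom_quot_cat Hom_iff)

lemma comm_group_quot_cat:
  assumes "X \<in> Ob C" "Y \<in> Ob C"
  shows "comm_group (hom_grp (quot_cat C T) X Y)"
proof (rule comm_groupI)
  fix F assume "F \<in> carrier (hom_grp (quot_cat C T) X Y)"
  then obtain f where f: "f \<in> Hom C X Y" "F = quot_class C T f" by (auto simp: Hom_quot_cat)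
  have "quot_class C T (neg C f) \<boxplus>\<^bsub>quot_cat C T\<^esub> F = ZeroM (quot_cat C T) X Y"
    using f by (auto simp: Hom_iff)
  moreover have "quot_class C T (neg C f) \<in> Hom (quot_cat C T) X Y"
    using f by (auto simp: Hom_quot_cat Hom_iff)
  ultimately show "\<exists>G\<in>carrier (hom_grp (quot_cat C T) X Y).
      G \<otimes>\<^bsub>hom_grp (quot_cat C T) X Y\<^esub> F = \<one>\<^bsub>hom_grp (quot_cat C T) X Y\<^esub>"
    by auto
qed (use assms in \<open>auto simp: Hom_quot_cat Hom_iff Add_ac\<close>)

lemma preadditive_quot_cat: "preadditive_category (quot_cat C T)"
  by (rule preadditive_category.intro) (auto simp: Hom_quot_cat Hom_iff comm_group_quot_cat)

lemma quot_cat_neg [simp]: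
  assumes "f \<in> Arr C"
  shows "neg (quot_cat C T) (quot_class C T f) = quot_class C T (neg C f)"
proof -
  interpret Q: preadditive_category "quot_cat C T" by (rule preadditive_quot_cat)
  show ?thesis using assms by (intro Q.neg_unique[symmetric]) simp_all
qed

text \<open>Because \<open>J\<close> contains \<open>T\<close>, it is a union of
  \<open>T\<close>-classes, so membership of a class can be tested on any representative. This
  brings questions about Z, an ideal of the homotopy category, back to chain maps.\<close>

lemma quot_class_mem_image:
  assumes J: "hom_ideal C J" "T \<subseteq> J" and f: "f \<in> Arr C"
  shows "quot_class C T f \<in> quot_class C T ` J \<longleftrightarrow> f \<in> J"
proof
  assume "quot_class C T f \<in> quot_class C T ` J"
  then obtain g where g: "g \<in> J" "quot_class C T f = quot_class C T g" by auto
  then have gA: "g \<in> Arr C" using hom_ideal.TD[OF J(1)] by simp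
  with g f have h: "Dom C g = Dom C f" "Cod C g = Cod C f" "f \<boxplus> neg C g \<in> T"
    by (simp_all add: quot_class_cong)
  have "f \<boxplus> neg C g \<in> J" using J(2) h(3) by blast
  then have "(f \<boxplus> neg C g) \<boxplus> g \<in> J"
    using g f gA h by (intro hom_ideal.T_add[OF J(1) _ g(1)]) simp_all
  then show "f \<in> J" using f gA h by (simp add: Add_assoc)
qed simp

text \<open>Correspondence of ideals under a quotient; it yields the ideal axioms for Z from those
  for chain maps of the form \<open>s d + d t\<close>.\<close>

lemma hom_ideal_quot_cat:
  assumes "hom_ideal C J" "T \<subseteq> J"
  shows "hom_ideal (quot_cat C T) (quot_class C T ` J)"
proof -
  interpret J: hom_ideal C J by fact
  interpret Q: preadditive_category "quot_cat C T" by (rule preadditive_quot_cat)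
  show ?thesis
    by unfold_locales (auto simp: J.TD J.T_neg J.T_zero intro!: imageI intro: J.T_add J.T_left J.T_right)
qed

end

section \<open>Isomorphisms and the identification of isomorphic objects\<close>

context preadditive_category
begin

lemma is_isoI:
  assumes "f \<in> Arr C" "g \<in> Arr C" "Dom C g = Cod C f" "Cod C g = Dom C f"
    "g \<cdot> f = Ide C (Dom C f)" "f \<cdot> g = Ide C (Cod C f)"
  shows "is_iso C f"
  unfolding is_iso_def using assms by (intro conjI bexI[of _ g]) (simp_all add: Hom_iff)

lemma inv_arr_props:
  assumes "is_iso C f"
  shows "inv_arr C f \<in> Arr C" "Dom C (inv_arr C f) = Cod C f" "Cod C (inv_arr C f) = Dom C f"
    "inv_arr C f \<cdot> f = Ide C (Dom C f)" "f \<cdot> inv_arr C f = Ide C (Cod C f)"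
proof -
  have fA: "f \<in> Arr C" using assms by (simp add: is_iso_def)
  let ?P = "\<lambda>g. g \<in> Hom C (Cod C f) (Dom C f) \<and> g \<cdot> f = Ide C (Dom C f) \<and> f \<cdot> g = Ide C (Cod C f)"
  obtain g where g: "?P g" using assms unfolding is_iso_def by blast
  have "h = g" if h: "?P h" for h
  proof -
    have "h = h \<cdot> (f \<cdot> g)" using g h by (auto simp: Hom_iff)
    also have "\<dots> = (h \<cdot> f) \<cdot> g" using g h fA by (subst Comp_assoc') (auto simp: Hom_iff)
    also have "\<dots> = g" using g h by (auto simp: Hom_iff)
    finally show ?thesis .
  qed
  with g have "inv_arr C f = g" unfolding inv_arr_def by (intro the_equality)
  with g show "inv_arr C f \<in> Arr C" "Dom C (inv_arr C f) = Cod C f" "Cod C (inv_arr C f) = Dom C f"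
    "inv_arr C f \<cdot> f = Ide C (Dom C f)" "f \<cdot> inv_arr C f = Ide C (Cod C f)"
    by (auto simp: Hom_iff)
qed

lemma inv_arr_cancel:
  assumes "is_iso C f" "g \<in> Arr C"
  shows "Cod C g = Dom C f \<Longrightarrow> inv_arr C f \<cdot> (f \<cdot> g) = g"
    "Cod C g = Cod C f \<Longrightarrow> f \<cdot> (inv_arr C f \<cdot> g) = g"
proof -
  have "f \<in> Arr C" using assms by (simp add: is_iso_def)
  then show "Cod C g = Dom C f \<Longrightarrow> inv_arr C f \<cdot> (f \<cdot> g) = g"
    "Cod C g = Cod C f \<Longrightarrow> f \<cdot> (inv_arr C f \<cdot> g) = g"
    using assms inv_arr_props[OF assms(1)] by (simp_all flip: Comp_assoc')
qed

lemma is_iso_inv_arr: "is_iso C f \<Longrightarrow> is_iso C (inv_arr C f)"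
  by (rule is_isoI[of _ f]) (simp_all add: inv_arr_props, simp_all add: is_iso_def)

lemma is_iso_Ide: "X \<in> Ob C \<Longrightarrow> is_iso C (Ide C X)"
  by (rule is_isoI[of _ "Ide C X"]) simp_all

lemma is_iso_Comp:
  assumes "is_iso C f" "is_iso C g" "Dom C g = Cod C f"
  shows "is_iso C (g \<cdot> f)"
proof -
  have "f \<in> Arr C" "g \<in> Arr C" using assms by (simp_all add: is_iso_def)
  then show ?thesis
    using assms inv_arr_props[OF assms(1)] inv_arr_props[OF assms(2)]
    by (intro is_isoI[of _ "inv_arr C f \<cdot> inv_arr C g"]) (simp_all add: inv_arr_cancel)
qed

lemma isomorphic_refl: "X \<in> Ob C \<Longrightarrow> isomorphic C X X"
  using is_iso_Ide Ide_Hom unfolding isomorphic_def by blast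

lemma isomorphic_sym:
  assumes "isomorphic C X Y"
  shows "isomorphic C Y X"
proof -
  obtain f where "f \<in> Hom C X Y" "is_iso C f" using assms by (auto simp: isomorphic_def)
  then have "inv_arr C f \<in> Hom C Y X" "is_iso C (inv_arr C f)"
    by (auto simp: Hom_iff inv_arr_props is_iso_inv_arr)
  then show ?thesis by (auto simp: isomorphic_def)
qed

lemma isomorphic_trans:
  assumes "isomorphic C X Y" "isomorphic C Y Z"
  shows "isomorphic C X Z"
proof -
  obtain f where "f \<in> Hom C X Y" "is_iso C f" using assms by (auto simp: isomorphic_def)
  moreover obtain g where "g \<in> Hom C Y Z" "is_iso C g" using assms by (auto simp: isomorphic_def)
  ultimately have "g \<cdot> f \<in> Hom C X Z" "is_iso C (g \<cdot> f)"
    by (auto simp: Hom_iff is_iso_Comp)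
  then show ?thesis by (auto simp: isomorphic_def)
qed

lemma iso_class_cong:
  assumes "isomorphic C X Y"
  shows "iso_class C X = iso_class C Y"
  using assms isomorphic_sym isomorphic_trans unfolding iso_class_def by blast

lemma iso_rep_props:
  assumes "X \<in> Ob C"
  shows "iso_rep C X \<in> Ob C" "isomorphic C X (iso_rep C X)"
proof -
  have "X \<in> iso_class C X" using assms by (simp add: iso_class_def isomorphic_refl)
  then have "iso_rep C X \<in> iso_class C X" unfolding iso_rep_def by (rule someI)
  then show "iso_rep C X \<in> Ob C" "isomorphic C X (iso_rep C X)" by (simp_all add: iso_class_def)
qed

text \<open>\<open>iso_rep\<close> chooses from the class as a set, and isomorphic objects have the
  same class; the chosen member is therefore its own choice.\<close>

lemma iso_rep_idem:
  assumes "X \<in> Ob C"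
  shows "iso_rep C (iso_rep C X) = iso_rep C X"
  unfolding iso_rep_def[of C X] iso_rep_def[of C "SOME Y. Y \<in> iso_class C X"]
  using iso_class_cong[OF iso_rep_props(2)[OF assms]] unfolding iso_rep_def by simp

lemma ident_iso_props:
  assumes "X \<in> Ob C"
  shows "ident_iso C X \<in> Arr C" "Dom C (ident_iso C X) = X" "Cod C (ident_iso C X) = iso_rep C X"
    "is_iso C (ident_iso C X)"
proof -
  have "ident_iso C X \<in> Hom C X (iso_rep C X) \<and> is_iso C (ident_iso C X)"
  proof (cases "iso_rep C X = X")
    case True
    then show ?thesis using assms by (simp add: ident_iso_def Hom_iff is_iso_Ide)
  next
    case False
    have "\<exists>u. u \<in> Hom C X (iso_rep C X) \<and> is_iso C u"
      using iso_rep_props(2)[OF assms] by (auto simp: isomorphic_def)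
    then have "(SOME u. u \<in> Hom C X (iso_rep C X) \<and> is_iso C u) \<in> Hom C X (iso_rep C X)
      \<and> is_iso C (SOME u. u \<in> Hom C X (iso_rep C X) \<and> is_iso C u)" by (rule someI_ex)
    then show ?thesis using False by (simp add: ident_iso_def)
  qed
  then show "ident_iso C X \<in> Arr C" "Dom C (ident_iso C X) = X"
    "Cod C (ident_iso C X) = iso_rep C X" "is_iso C (ident_iso C X)" by (simp_all add: Hom_iff)
qed

lemmas ident_inv_props = inv_arr_props[OF ident_iso_props(4)]

lemma ident_arr_props:
  assumes "f \<in> Arr C"
  shows "ident_arr C f \<in> Arr C" "Dom C (ident_arr C f) = iso_rep C (Dom C f)"
    "Cod C (ident_arr C f) = iso_rep C (Cod C f)"
  using assms by (simp_all add: ident_arr_def ident_iso_props ident_inv_props)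

lemma ident_arr_Comp:
  assumes "f \<in> Arr C" "g \<in> Arr C" "Dom C g = Cod C f"
  shows "ident_arr C (g \<cdot> f) = ident_arr C g \<cdot> ident_arr C f"
  using assms
  by (simp add: ident_arr_def ident_iso_props ident_inv_props inv_arr_cancel)

text \<open>Conjugation by isomorphisms can be undone, so identifying isomorphic objects never
  merges two parallel morphisms.\<close>

lemma ident_arr_inj:
  assumes "f \<in> Arr C" "g \<in> Arr C" "Dom C g = Dom C f" "Cod C g = Cod C f"
  shows "ident_arr C f = ident_arr C g \<longleftrightarrow> f = g"
proof
  let ?u = "ident_iso C (Dom C f)" and ?v = "ident_iso C (Cod C f)"
  have *: "h = inv_arr C ?v \<cdot> (ident_arr C h \<cdot> ?u)"
    if "h \<in> Arr C" "Dom C h = Dom C f" "Cod C h = Cod C f" for h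
    using that assms(1)
    by (simp add: ident_arr_def ident_iso_props ident_inv_props inv_arr_cancel)
  assume eq: "ident_arr C f = ident_arr C g"
  have "f = inv_arr C ?v \<cdot> (ident_arr C g \<cdot> ?u)"
    unfolding eq[symmetric] by (rule *) (use assms in simp_all)
  also have "\<dots> = g"
    by (rule *[symmetric]) (use assms in simp_all)
  finally show "f = g" .
qed simp

lemma Hom_identify_iso:
  assumes "X \<in> Ob C" "Y \<in> Ob C"
  shows "Hom (identify_iso C) (iso_class C X) (iso_class C Y) = Hom C (iso_rep C X) (iso_rep C Y)"
proof -
  \<comment> \<open>Arrows kept by \<open>identify_iso\<close> run between fixed points of
    \<open>iso_rep\<close>, and each isomorphism class contains exactly one such point.\<close>
  have *: "V = iso_rep C V \<and> iso_class C V = iso_class C U \<longleftrightarrow> V = iso_rep C U"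
    if "U \<in> Ob C" for U V
  proof
    assume "V = iso_rep C V \<and> iso_class C V = iso_class C U"
    then show "V = iso_rep C U" unfolding iso_rep_def by metis
  next
    assume V: "V = iso_rep C U"
    then show "V = iso_rep C V \<and> iso_class C V = iso_class C U"
      using iso_rep_idem[OF that] iso_class_cong[OF iso_rep_props(2)[OF that]] by simp
  qed
  have "f \<in> Hom (identify_iso C) (iso_class C X) (iso_class C Y) \<longleftrightarrow>
      f \<in> Arr C \<and> (Dom C f = iso_rep C (Dom C f) \<and> iso_class C (Dom C f) = iso_class C X)
        \<and> (Cod C f = iso_rep C (Cod C f) \<and> iso_class C (Cod C f) = iso_class C Y)" for f
    by (simp only: Hom_def identify_iso_def lin_cat.simps mem_Collect_eq) blast
  then show ?thesis
    unfolding *[OF assms(1)] *[OF assms(2)] by (simp add: set_eq_iff Hom_iff[of _ C])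
qed

lemma full_additive_ident_arr:
  "full_additive_functor C (identify_iso C) (iso_class C) (ident_arr C)"
proof -
  have hom: "ident_arr C ` Hom C X Y = Hom (identify_iso C) (iso_class C X) (iso_class C Y)"
    if "X \<in> Ob C" "Y \<in> Ob C" for X Y
  proof -
    have "g \<in> ident_arr C ` Hom C X Y" if g: "g \<in> Hom C (iso_rep C X) (iso_rep C Y)" for g
    proof
      \<comment> \<open>The preimage is \<open>g\<close> conjugated back from the chosen
        representatives to \<open>X\<close> and \<open>Y\<close>.\<close>
      let ?f = "inv_arr C (ident_iso C Y) \<cdot> (g \<cdot> ident_iso C X)"
      show "?f \<in> Hom C X Y" "g = ident_arr C ?f"
        using g \<open>X \<in> Ob C\<close> \<open>Y \<in> Ob C\<close>
        by (auto simp: Hom_iff ident_arr_def ident_iso_props ident_inv_props inv_arr_cancel)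
    qed
    then show ?thesis
      using that by (auto simp: Hom_identify_iso Hom_iff ident_arr_props)
  qed
  have hom1: "ident_arr C f \<in> Hom (identify_iso C) (iso_class C X) (iso_class C Y)"
    if "X \<in> Ob C" "Y \<in> Ob C" "f \<in> Hom C X Y" for X Y f
    using hom that by blast
  have "ident_arr C (f \<boxplus> g) = ident_arr C f \<boxplus> ident_arr C g"
    if "f \<in> Hom C X Y" "g \<in> Hom C X Y" for X Y f g
    using that by (auto simp: Hom_iff ident_arr_def ident_iso_props ident_inv_props)
  moreover have "ident_arr C (ZeroM C X Y) = ZeroM C (iso_rep C X) (iso_rep C Y)"
    "ident_arr C (Ide C X) = Ide C (iso_rep C X)"
    if "X \<in> Ob C" "Y \<in> Ob C" for X Y
    using that by (simp_all add: ident_arr_def ident_iso_props ident_inv_props iso_rep_props)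
  moreover have "ident_arr C (g \<cdot> f) = ident_arr C g \<cdot> ident_arr C f"
    if "f \<in> Hom C X Y" "g \<in> Hom C Y Z" for X Y Z f g
    using that by (auto simp: Hom_iff ident_arr_Comp)
  ultimately show ?thesis
    unfolding full_additive_functor_def is_functor_def
    by (intro conjI ballI hom hom1) (auto simp: identify_iso_def iso_rep_def)
qed

end

section \<open>Complexes\<close>

text \<open>The flag separates honest homotopies (\<open>s = t\<close>) from independent pairs, so
  that a single proof of the ideal axioms serves both the null-homotopic maps and the maps defining
  Z.\<close>

definition sd_dt_maps :: "('o, 'm, 'z) lin_cat_scheme \<Rightarrow> bool \<Rightarrow> ('o, 'm) chmap set" where
  "sd_dt_maps A same = {\<phi>. is_chmap A \<phi> \<and> (\<exists>s t. sd_dt_form A \<phi> s t \<and> (same \<longrightarrow> s = t))}"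

lemma sd_dt_mapsI:
  "\<lbrakk>is_chmap A \<phi>; sd_dt_form A \<phi> s t; same \<longrightarrow> s = t\<rbrakk> \<Longrightarrow> \<phi> \<in> sd_dt_maps A same"
  by (auto simp: sd_dt_maps_def)

lemma sd_dt_mapsE:
  assumes "\<phi> \<in> sd_dt_maps A same"
  obtains s t where "is_chmap A \<phi>" "sd_dt_form A \<phi> s t" "same \<longrightarrow> s = t"
  using assms by (auto simp: sd_dt_maps_def)

lemma cpx_cat_simps [simp]:
  "Ob (cpx_cat A) = {X. is_complex A X}" "Arr (cpx_cat A) = {\<phi>. is_chmap A \<phi>}"
  "Dom (cpx_cat A) = cdom" "Cod (cpx_cat A) = ccod"
  "Ide (cpx_cat A) X = ChMap X X (\<lambda>i. Ide A (cob X i))"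
  "Comp (cpx_cat A) \<psi> \<phi> = ChMap (cdom \<phi>) (ccod \<psi>) (\<lambda>i. ccomp \<psi> i \<cdot>\<^bsub>A\<^esub> ccomp \<phi> i)"
  "AddM (cpx_cat A) \<phi> \<psi> = ChMap (cdom \<phi>) (ccod \<phi>) (\<lambda>i. ccomp \<phi> i \<boxplus>\<^bsub>A\<^esub> ccomp \<psi> i)"
  "ZeroM (cpx_cat A) X Y = ChMap X Y (\<lambda>i. ZeroM A (cob X i) (cob Y i))"
  by (simp_all add: cpx_cat_def)

lemma chmap_eqI: "\<lbrakk>cdom \<phi> = cdom \<psi>; ccod \<phi> = ccod \<psi>; \<And>i. ccomp \<phi> i = ccomp \<psi> i\<rbrakk> \<Longrightarrow> \<phi> = \<psi>"
  by (cases \<phi>; cases \<psi>) auto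

context preadditive_category
begin

lemma complexD:
  assumes "is_complex C X"
  shows "cob X i \<in> Ob C" "cdiff X i \<in> Arr C" "Dom C (cdiff X i) = cob X i"
    "Cod C (cdiff X i) = cob X (i + 1)" "cdiff X (i + 1) \<cdot> cdiff X i = ZeroM C (cob X i) (cob X (i + 2))"
  using assms by (auto simp: is_complex_def Hom_iff)

lemma chmapD:
  assumes "is_chmap C \<phi>"
  shows "is_complex C (cdom \<phi>)" "is_complex C (ccod \<phi>)"
    "ccomp \<phi> i \<in> Arr C" "Dom C (ccomp \<phi> i) = cob (cdom \<phi>) i" "Cod C (ccomp \<phi> i) = cob (ccod \<phi>) i"
    "ccomp \<phi> (i + 1) \<cdot> cdiff (cdom \<phi>) i = cdiff (ccod \<phi>) i \<cdot> ccomp \<phi> i"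
  using assms by (auto simp: is_chmap_def Hom_iff)

lemma chmap_dom_cod_simps:
  assumes "is_chmap C \<phi>"
  shows "cob (cdom \<phi>) i \<in> Ob C" "cdiff (cdom \<phi>) i \<in> Arr C"
    "Dom C (cdiff (cdom \<phi>) i) = cob (cdom \<phi>) i" "Cod C (cdiff (cdom \<phi>) i) = cob (cdom \<phi>) (i + 1)"
    "cob (ccod \<phi>) i \<in> Ob C" "cdiff (ccod \<phi>) i \<in> Arr C"
    "Dom C (cdiff (ccod \<phi>) i) = cob (ccod \<phi>) i" "Cod C (cdiff (ccod \<phi>) i) = cob (ccod \<phi>) (i + 1)"
  using assms complexD chmapD by metis+

lemmas cpx_simps = chmapD(1-5) chmap_dom_cod_simps

lemma is_chmapI:
  assumes "is_complex C X" "is_complex C Y"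
    "\<And>i. f i \<in> Arr C" "\<And>i. Dom C (f i) = cob X i" "\<And>i. Cod C (f i) = cob Y i"
    "\<And>i. f (i + 1) \<cdot> cdiff X i = cdiff Y i \<cdot> f i"
  shows "is_chmap C (ChMap X Y f)"
  using assms by (simp add: is_chmap_def Hom_iff)

lemma chmap_Comp:
  assumes "is_chmap C \<phi>" "is_chmap C \<psi>" "cdom \<psi> = ccod \<phi>"
  shows "is_chmap C (ChMap (cdom \<phi>) (ccod \<psi>) (\<lambda>i. ccomp \<psi> i \<cdot> ccomp \<phi> i))"
proof (rule is_chmapI)
  note [simp] = cpx_simps[OF assms(1)] cpx_simps[OF assms(2)] assms(3)
  fix i
  have "ccomp \<psi> (i + 1) \<cdot> ccomp \<phi> (i + 1) \<cdot> cdiff (cdom \<phi>) i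
      = ccomp \<psi> (i + 1) \<cdot> (cdiff (cdom \<psi>) i \<cdot> ccomp \<phi> i)"
    by (simp add: chmapD(6)[OF assms(1)])
  also have "\<dots> = (ccomp \<psi> (i + 1) \<cdot> cdiff (cdom \<psi>) i) \<cdot> ccomp \<phi> i" by simp
  also have "\<dots> = cdiff (ccod \<psi>) i \<cdot> (ccomp \<psi> i \<cdot> ccomp \<phi> i)"
    unfolding chmapD(6)[OF assms(2)] by simp
  finally show "ccomp \<psi> (i + 1) \<cdot> ccomp \<phi> (i + 1) \<cdot> cdiff (cdom \<phi>) i
      = cdiff (ccod \<psi>) i \<cdot> (ccomp \<psi> i \<cdot> ccomp \<phi> i)" .
qed (simp_all add: cpx_simps assms)

lemma chmap_Add:
  assumes "is_chmap C \<phi>" "is_chmap C \<psi>" "cdom \<psi> = cdom \<phi>" "ccod \<psi> = ccod \<phi>"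
  shows "is_chmap C (ChMap (cdom \<phi>) (ccod \<phi>) (\<lambda>i. ccomp \<phi> i \<boxplus> ccomp \<psi> i))"
  using cpx_simps[OF assms(1)] cpx_simps[OF assms(2)] chmapD(6)[OF assms(1)] chmapD(6)[OF assms(2)] assms
  by (intro is_chmapI) simp_all

lemma chmap_neg:
  assumes "is_chmap C \<phi>"
  shows "is_chmap C (ChMap (cdom \<phi>) (ccod \<phi>) (\<lambda>i. neg C (ccomp \<phi> i)))"
  using cpx_simps[OF assms(1)] chmapD(6)[OF assms(1)]
  by (intro is_chmapI) simp_all

lemma chmap_zero:
  assumes "is_complex C X" "is_complex C Y"
  shows "is_chmap C (ChMap X Y (\<lambda>i. ZeroM C (cob X i) (cob Y i)))"
  using complexD[OF assms(1)] complexD[OF assms(2)] assms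
  by (intro is_chmapI) simp_all

lemma chmap_Ide: "is_complex C X \<Longrightarrow> is_chmap C (ChMap X X (\<lambda>i. Ide C (cob X i)))"
  by (intro is_chmapI) (simp_all add: complexD)

lemma comm_group_cpx_cat:
  assumes "is_complex C X" "is_complex C Y"
  shows "comm_group (hom_grp (cpx_cat C) X Y)"
proof (rule comm_groupI)
  fix \<phi> assume "\<phi> \<in> carrier (hom_grp (cpx_cat C) X Y)"
  then have \<phi>: "is_chmap C \<phi>" "cdom \<phi> = X" "ccod \<phi> = Y" by (auto simp: Hom_iff)
  let ?n = "ChMap X Y (\<lambda>i. neg C (ccomp \<phi> i))"
  have "?n \<in> Hom (cpx_cat C) X Y" using chmap_neg[OF \<phi>(1)] \<phi> by (simp add: Hom_iff)
  moreover have "AddM (cpx_cat C) ?n \<phi> = ZeroM (cpx_cat C) X Y"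
    using \<phi> by (simp add: chmapD[OF \<phi>(1)])
  ultimately show "\<exists>\<psi>\<in>carrier (hom_grp (cpx_cat C) X Y).
      \<psi> \<otimes>\<^bsub>hom_grp (cpx_cat C) X Y\<^esub> \<phi> = \<one>\<^bsub>hom_grp (cpx_cat C) X Y\<^esub>"
    unfolding hom_grp_simps by (rule bexI[rotated])
qed (use assms in \<open>auto simp: Hom_iff chmap_Add chmap_zero chmapD Add_ac intro!: chmap_eqI\<close>)

lemma preadditive_cpx_cat: "preadditive_category (cpx_cat C)"
  by (rule preadditive_category.intro)
    (auto simp: Hom_iff cpx_simps chmap_Comp chmap_Ide comm_group_cpx_cat intro!: chmap_eqI)

lemma neg_cpx_cat:
  assumes "is_chmap C \<phi>"
  shows "neg (cpx_cat C) \<phi> = ChMap (cdom \<phi>) (ccod \<phi>) (\<lambda>i. neg C (ccomp \<phi> i))"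
proof -
  interpret K: preadditive_category "cpx_cat C" by (rule preadditive_cpx_cat)
  show ?thesis
    using assms by (intro K.neg_unique[symmetric]) (simp_all add: chmap_neg chmapD)
qed

section \<open>Chain maps of the form \<open>s d + d t\<close> as an ideal\<close>

lemma sd_dt_formD:
  assumes "sd_dt_form C \<phi> s t"
  shows "s i \<in> Arr C" "Dom C (s i) = cob (cdom \<phi>) i" "Cod C (s i) = cob (ccod \<phi>) (i - 1)"
    "t i \<in> Arr C" "Dom C (t i) = cob (cdom \<phi>) i" "Cod C (t i) = cob (ccod \<phi>) (i - 1)"
    "ccomp \<phi> i = (s (i + 1) \<cdot> cdiff (cdom \<phi>) i) \<boxplus> (cdiff (ccod \<phi>) (i - 1) \<cdot> t i)"
  using assms by (auto simp: sd_dt_form_def Hom_iff)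

lemma sd_dt_form_Add:
  assumes "is_chmap C \<phi>" "is_chmap C \<psi>" "cdom \<psi> = cdom \<phi>" "ccod \<psi> = ccod \<phi>"
    "sd_dt_form C \<phi> s t" "sd_dt_form C \<psi> s' t'"
  shows "sd_dt_form C (AddM (cpx_cat C) \<phi> \<psi>) (\<lambda>i. s i \<boxplus> s' i) (\<lambda>i. t i \<boxplus> t' i)"
  using cpx_simps[OF assms(1)] sd_dt_formD[OF assms(5)] sd_dt_formD[OF assms(6)] assms(3,4)
  by (simp add: sd_dt_form_def Hom_iff Add_ac)

lemma sd_dt_form_neg:
  assumes "is_chmap C \<phi>" "sd_dt_form C \<phi> s t"
  shows "sd_dt_form C (neg (cpx_cat C) \<phi>) (\<lambda>i. neg C (s i)) (\<lambda>i. neg C (t i))"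
  using cpx_simps[OF assms(1)] sd_dt_formD[OF assms(2)]
  by (simp add: sd_dt_form_def Hom_iff neg_cpx_cat[OF assms(1)])

lemma sd_dt_form_zero:
  assumes "is_complex C X" "is_complex C Y"
  shows "sd_dt_form C (ZeroM (cpx_cat C) X Y)
    (\<lambda>i. ZeroM C (cob X i) (cob Y (i - 1))) (\<lambda>i. ZeroM C (cob X i) (cob Y (i - 1)))"
  using complexD[OF assms(1)] complexD[OF assms(2)]
  by (simp add: sd_dt_form_def Hom_iff)

text \<open>Only the summand \<open>d t\<close> uses that \<open>\<psi>\<close> is a chain map:
  there \<open>\<psi>\<close> has to pass the differential of the target. For composition on the
  other side the summand \<open>s d\<close> takes this role.\<close>

lemma sd_dt_form_left:
  assumes "is_chmap C \<phi>" "is_chmap C \<psi>" "cdom \<psi> = ccod \<phi>" "sd_dt_form C \<phi> s t"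
  shows "sd_dt_form C (Comp (cpx_cat C) \<psi> \<phi>)
    (\<lambda>i. ccomp \<psi> (i - 1) \<cdot> s i) (\<lambda>i. ccomp \<psi> (i - 1) \<cdot> t i)"
proof -
  note [simp] = cpx_simps[OF assms(1)] cpx_simps[OF assms(2)] sd_dt_formD(1-6)[OF assms(4)] assms(3)
  have "ccomp \<psi> i \<cdot> (cdiff (ccod \<phi>) (i - 1) \<cdot> t i)
      = cdiff (ccod \<psi>) (i - 1) \<cdot> (ccomp \<psi> (i - 1) \<cdot> t i)" for i
    using arg_cong[OF chmapD(6)[OF assms(2), of "i - 1"], of "\<lambda>f. f \<cdot> t i"] by simp
  then show ?thesis
    by (simp add: sd_dt_form_def Hom_iff sd_dt_formD(7)[OF assms(4)])
qed

lemma sd_dt_form_right: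
  assumes "is_chmap C \<phi>" "is_chmap C \<psi>" "ccod \<psi> = cdom \<phi>" "sd_dt_form C \<phi> s t"
  shows "sd_dt_form C (Comp (cpx_cat C) \<phi> \<psi>) (\<lambda>i. s i \<cdot> ccomp \<psi> i) (\<lambda>i. t i \<cdot> ccomp \<psi> i)"
proof -
  note [simp] = cpx_simps[OF assms(1)] cpx_simps[OF assms(2)] sd_dt_formD(1-6)[OF assms(4)] assms(3)
  have "cdiff (cdom \<phi>) i \<cdot> ccomp \<psi> i = ccomp \<psi> (i + 1) \<cdot> cdiff (cdom \<psi>) i" for i
    using chmapD(6)[OF assms(2), of i] by simp
  then show ?thesis
    by (simp add: sd_dt_form_def Hom_iff sd_dt_formD(7)[OF assms(4)])
qed

text \<open>Sums, negatives and composites change \<open>s\<close> and \<open>t\<close> by the same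
  formula, so the constraint \<open>s = t\<close>, when imposed, is inherited.\<close>

lemma hom_ideal_sd_dt_maps: "hom_ideal (cpx_cat C) (sd_dt_maps C same)"
proof -
  interpret K: preadditive_category "cpx_cat C" by (rule preadditive_cpx_cat)
  show ?thesis
  proof
    fix \<phi> \<psi> assume h: "\<phi> \<in> sd_dt_maps C same" "\<psi> \<in> sd_dt_maps C same"
      "Dom (cpx_cat C) \<psi> = Dom (cpx_cat C) \<phi>" "Cod (cpx_cat C) \<psi> = Cod (cpx_cat C) \<phi>"
    from h(1) obtain s t where 1: "is_chmap C \<phi>" "sd_dt_form C \<phi> s t" "same \<longrightarrow> s = t"
      by (rule sd_dt_mapsE)
    from h(2) obtain s' t' where 2: "is_chmap C \<psi>" "sd_dt_form C \<psi> s' t'" "same \<longrightarrow> s' = t'"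
      by (rule sd_dt_mapsE)
    show "AddM (cpx_cat C) \<phi> \<psi> \<in> sd_dt_maps C same"
      by (rule sd_dt_mapsI[OF _ sd_dt_form_Add[OF 1(1) 2(1) _ _ 1(2) 2(2)]])
        (use 1 2 h chmap_Add in simp_all)
  next
    fix \<phi> assume "\<phi> \<in> sd_dt_maps C same"
    then obtain s t where 1: "is_chmap C \<phi>" "sd_dt_form C \<phi> s t" "same \<longrightarrow> s = t"
      by (rule sd_dt_mapsE)
    show "neg (cpx_cat C) \<phi> \<in> sd_dt_maps C same"
      by (rule sd_dt_mapsI[OF _ sd_dt_form_neg[OF 1(1,2)]])
        (use 1 K.neg_props(1)[of \<phi>] in simp_all)
  next
    fix X Y assume "X \<in> Ob (cpx_cat C)" "Y \<in> Ob (cpx_cat C)"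
    then show "ZeroM (cpx_cat C) X Y \<in> sd_dt_maps C same"
      by (intro sd_dt_mapsI[OF _ sd_dt_form_zero]) (simp_all add: chmap_zero)
  next
    fix \<phi> \<psi> assume h: "\<phi> \<in> sd_dt_maps C same" "\<psi> \<in> Arr (cpx_cat C)"
    from h(1) obtain s t where 1: "is_chmap C \<phi>" "sd_dt_form C \<phi> s t" "same \<longrightarrow> s = t"
      by (rule sd_dt_mapsE)
    { assume d: "Dom (cpx_cat C) \<psi> = Cod (cpx_cat C) \<phi>"
      show "Comp (cpx_cat C) \<psi> \<phi> \<in> sd_dt_maps C same"
        by (rule sd_dt_mapsI[OF _ sd_dt_form_left[OF 1(1) _ _ 1(2)]])
          (use 1 h d chmap_Comp in simp_all) }
    { assume d: "Cod (cpx_cat C) \<psi> = Dom (cpx_cat C) \<phi>"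
      show "Comp (cpx_cat C) \<phi> \<psi> \<in> sd_dt_maps C same"
        by (rule sd_dt_mapsI[OF _ sd_dt_form_right[OF 1(1) _ _ 1(2)]])
          (use 1 h d chmap_Comp in simp_all) }
  qed (auto simp: sd_dt_maps_def)
qed

lemma null_homotopic_eq: "null_homotopic C = sd_dt_maps C True"
  by (simp add: null_homotopic_def sd_dt_maps_def)

lemma hom_ideal_null_homotopic: "hom_ideal (cpx_cat C) (null_homotopic C)"
  unfolding null_homotopic_eq by (rule hom_ideal_sd_dt_maps)

lemma Z_ideal_eq: "Z_ideal C = quot_class (cpx_cat C) (null_homotopic C) ` sd_dt_maps C False"
  by (auto simp: Z_ideal_def sd_dt_maps_def)

lemma null_homotopic_subset: "null_homotopic C \<subseteq> sd_dt_maps C False"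
  by (auto simp: null_homotopic_def sd_dt_maps_def)

lemma hom_ideal_Z_ideal: "hom_ideal (K_cat C) (Z_ideal C)"
  unfolding K_cat_def Z_ideal_eq
  by (rule hom_ideal.hom_ideal_quot_cat[OF hom_ideal_null_homotopic hom_ideal_sd_dt_maps
        null_homotopic_subset])

lemma preadditive_KZ_cat: "preadditive_category (KZ_cat C)"
  unfolding KZ_cat_def by (rule hom_ideal.preadditive_quot_cat[OF hom_ideal_Z_ideal])

text \<open>Three full projections are composed: modulo homotopy, modulo Z, and the identification
  of isomorphic complexes. Hence every morphism between images of complexes is represented by a
  chain map, and calculations may be done on representatives.\<close>

lemma full_additive_Kw_arr: "full_additive_functor (cpx_cat C) (Kw_cat C) (Kw_ob C) (Kw_arr C)"
proof -
  note full_additive_functor_comp[OF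
      full_additive_functor_comp[OF
        hom_ideal.full_additive_quot_class[OF hom_ideal_null_homotopic]
        hom_ideal.full_additive_quot_class[OF hom_ideal_Z_ideal[unfolded K_cat_def]]]
      preadditive_category.full_additive_ident_arr[OF preadditive_KZ_cat[unfolded KZ_cat_def K_cat_def]]]
  moreover have "Kw_ob C = (\<lambda>X. iso_class (KZ_cat C) X)" "Kw_arr C = (\<lambda>\<phi>. ident_arr (KZ_cat C)
     (quot_class (K_cat C) (Z_ideal C) (quot_class (cpx_cat C) (null_homotopic C) \<phi>)))"
    by (auto simp: Kw_ob_def Kw_arr_def)
  ultimately show ?thesis by (simp add: Kw_cat_def KZ_cat_def K_cat_def)
qed

text \<open>Injectivity of the last projection reduces equality to the quotient by Z, where it says
  that the difference lies in Z. Since Z is the image of an ideal of chain maps containing the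
  null-homotopic ones, this can be read off the given representatives.\<close>

lemma Kw_arr_eq_iff:
  assumes "is_chmap C \<phi>" "is_chmap C \<psi>" "cdom \<psi> = cdom \<phi>" "ccod \<psi> = ccod \<phi>"
  shows "Kw_arr C \<phi> = Kw_arr C \<psi> \<longleftrightarrow>
    (\<exists>s t. sd_dt_form C (ChMap (cdom \<phi>) (ccod \<phi>) (\<lambda>i. ccomp \<phi> i \<boxplus> neg C (ccomp \<psi> i))) s t)"
proof -
  interpret N: hom_ideal "cpx_cat C" "null_homotopic C" by (rule hom_ideal_null_homotopic)
  interpret Z: hom_ideal "K_cat C" "Z_ideal C" by (rule hom_ideal_Z_ideal)
  interpret KZ: preadditive_category "KZ_cat C" by (rule preadditive_KZ_cat)
  let ?q = "quot_class (cpx_cat C) (null_homotopic C)"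
  let ?r = "quot_class (K_cat C) (Z_ideal C)"
  let ?d = "ChMap (cdom \<phi>) (ccod \<phi>) (\<lambda>i. ccomp \<phi> i \<boxplus> neg C (ccomp \<psi> i))"
  have A: "\<phi> \<in> Arr (cpx_cat C)" "\<psi> \<in> Arr (cpx_cat C)"
    "Dom (cpx_cat C) \<psi> = Dom (cpx_cat C) \<phi>" "Cod (cpx_cat C) \<psi> = Cod (cpx_cat C) \<phi>"
    using assms by simp_all
  have q: "?q \<phi> \<in> Arr (K_cat C)" "?q \<psi> \<in> Arr (K_cat C)"
    "Dom (K_cat C) (?q \<psi>) = Dom (K_cat C) (?q \<phi>)" "Cod (K_cat C) (?q \<psi>) = Cod (K_cat C) (?q \<phi>)"
    using A by (simp_all add: K_cat_def del: cpx_cat_simps)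
  have d: "AddM (cpx_cat C) \<phi> (neg (cpx_cat C) \<psi>) = ?d" using assms by (simp add: neg_cpx_cat)
  have "is_chmap C ?d"
    using chmap_Add[OF assms(1) chmap_neg[OF assms(2)]] assms by simp
  have "Kw_arr C \<phi> = Kw_arr C \<psi> \<longleftrightarrow> ?r (?q \<phi>) = ?r (?q \<psi>)"
    unfolding Kw_arr_def using q by (intro KZ.ident_arr_inj) (simp_all add: KZ_cat_def)
  also have "\<dots> \<longleftrightarrow> ?q \<phi> \<boxplus>\<^bsub>K_cat C\<^esub> neg (K_cat C) (?q \<psi>) \<in> Z_ideal C"
    using q by (simp add: Z.quot_class_cong)
  also have "?q \<phi> \<boxplus>\<^bsub>K_cat C\<^esub> neg (K_cat C) (?q \<psi>) = ?q ?d"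
    using A unfolding K_cat_def d[symmetric] by (simp del: cpx_cat_simps)
  also have "?q ?d \<in> Z_ideal C \<longleftrightarrow> ?d \<in> sd_dt_maps C False"
    unfolding Z_ideal_eq using \<open>is_chmap C ?d\<close>
    by (intro N.quot_class_mem_image hom_ideal_sd_dt_maps null_homotopic_subset) simp
  finally show ?thesis using \<open>is_chmap C ?d\<close> by (simp add: sd_dt_maps_def)
qed

end

section \<open>Triangulated categories\<close>

lemma is_functorD:
  assumes "is_functor C D Fo Fm"
  shows "\<lbrakk>X \<in> Ob C; Y \<in> Ob C; f \<in> Hom C X Y\<rbrakk> \<Longrightarrow> Fm f \<in> Hom D (Fo X) (Fo Y)"
    "\<lbrakk>X \<in> Ob C; Y \<in> Ob C; Z \<in> Ob C; f \<in> Hom C X Y; g \<in> Hom C Y Z\<rbrakk>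
      \<Longrightarrow> Fm (g \<cdot>\<^bsub>C\<^esub> f) = Fm g \<cdot>\<^bsub>D\<^esub> Fm f"
  using assms by (simp_all add: is_functor_def)

context triangulated_category
begin

lemma ShO_Ob [simp]: "X \<in> Ob C \<Longrightarrow> ShO C X \<in> Ob C"
  using shift_functor by (simp add: is_functor_def)

lemma ShM_props [simp]:
  assumes "f \<in> Arr C"
  shows "ShM C f \<in> Arr C" "Dom C (ShM C f) = ShO C (Dom C f)" "Cod C (ShM C f) = ShO C (Cod C f)"
proof -
  have "ShM C f \<in> Hom C (ShO C (Dom C f)) (ShO C (Cod C f))"
    using assms by (intro is_functorD(1)[OF shift_functor]) (simp_all add: Hom_iff)
  then show "ShM C f \<in> Arr C" "Dom C (ShM C f) = ShO C (Dom C f)"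
    "Cod C (ShM C f) = ShO C (Cod C f)" by (simp_all add: Hom_iff)
qed

lemma ShM_Ide [simp]: "X \<in> Ob C \<Longrightarrow> ShM C (Ide C X) = Ide C (ShO C X)"
  using shift_functor by (simp add: is_functor_def)

lemma ShM_Comp [simp]:
  assumes "f \<in> Arr C" "g \<in> Arr C" "Dom C g = Cod C f"
  shows "ShM C (g \<cdot> f) = ShM C g \<cdot> ShM C f"
  using assms is_functorD(2)[OF shift_functor, of "Dom C f" "Cod C f" "Cod C g" f g]
  by (simp add: Hom_iff)

lemma ShM_Add [simp]:
  assumes "f \<in> Arr C" "g \<in> Arr C" "Dom C g = Dom C f" "Cod C g = Cod C f"
  shows "ShM C (f \<boxplus> g) = ShM C f \<boxplus> ShM C g"
  using shift_add[of f "Dom C f" "Cod C f" g] assms by (simp add: Hom_iff)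

lemma ShM_Zero [simp]:
  assumes "X \<in> Ob C" "Y \<in> Ob C"
  shows "ShM C (ZeroM C X Y) = ZeroM C (ShO C X) (ShO C Y)"
  using idem_zero[of "ShM C (ZeroM C X Y)"] assms by (simp flip: ShM_Add)

lemma ShM_neg [simp]: "f \<in> Arr C \<Longrightarrow> ShM C (neg C f) = neg C (ShM C f)"
  by (rule neg_unique) (simp_all flip: ShM_Add)

lemma ShO_inj: "\<lbrakk>X \<in> Ob C; Y \<in> Ob C\<rbrakk> \<Longrightarrow> ShO C X = ShO C Y \<longleftrightarrow> X = Y"
  using shift_bij_Ob by (auto simp: bij_betw_def inj_on_def)

lemma ShM_inj: "\<lbrakk>f \<in> Arr C; g \<in> Arr C\<rbrakk> \<Longrightarrow> ShM C f = ShM C g \<longleftrightarrow> f = g"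
  using shift_bij_Arr by (auto simp: bij_betw_def inj_on_def)

text \<open>Desuspension with prescribed ends: the preimage has the right domain and codomain
  because the shift is also injective on objects.\<close>

lemma ShM_surj:
  assumes "h \<in> Arr C" "Dom C h = ShO C X" "Cod C h = ShO C Y" "X \<in> Ob C" "Y \<in> Ob C"
  obtains g where "g \<in> Arr C" "Dom C g = X" "Cod C g = Y" "h = ShM C g"
proof -
  from assms(1) have "h \<in> ShM C ` Arr C" using shift_bij_Arr by (simp add: bij_betw_def)
  then obtain g where g: "g \<in> Arr C" "h = ShM C g" by auto
  then have "Dom C g = X" "Cod C g = Y" using assms by (simp_all add: ShO_inj)
  with g that show thesis by blast
qed

section \<open>Iterated shifts by arbitrary integers\<close>

lemma ShO_shO [simp]:
  assumes "X \<in> Ob C"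
  shows "shO C k X \<in> Ob C" "ShO C (shO C k X) = shO C (k + 1) X"
proof -
  have bij: "inv_into (Ob C) (ShO C) Y \<in> Ob C" "ShO C (inv_into (Ob C) (ShO C) Y) = Y"
    if "Y \<in> Ob C" for Y
    using that shift_bij_Ob by (simp_all add: bij_betw_def inv_into_into f_inv_into_f)
  have pos: "(ShO C ^^ n) X \<in> Ob C" and neg: "(inv_into (Ob C) (ShO C) ^^ n) X \<in> Ob C" for n
    by (induction n) (simp_all add: assms bij)
  then show "shO C k X \<in> Ob C" by (simp add: shO_def)
  show "ShO C (shO C k X) = shO C (k + 1) X"
  proof (cases "0 \<le> k")
    case True
    then have "nat (k + 1) = Suc (nat k)" by simp
    with True show ?thesis by (simp add: shO_def)
  next
    case False
    then have "nat (- k) = Suc (nat (- (k + 1)))" by simp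
    then have "shO C k X = inv_into (Ob C) (ShO C) ((inv_into (Ob C) (ShO C) ^^ nat (- (k + 1))) X)"
      using False by (simp add: shO_def)
    \<comment> \<open>For \<open>k = -1\<close> the index \<open>k + 1\<close> falls into the
      nonnegative branch of the definition, which agrees with zero iterations of the
      inverse.\<close>
    moreover have "shO C (k + 1) X = (inv_into (Ob C) (ShO C) ^^ nat (- (k + 1))) X"
      using False by (cases "k = - 1") (simp_all add: shO_def)
    ultimately show ?thesis using bij(2)[OF neg] by simp
  qed
qed

lemma ShM_shM [simp]:
  assumes "f \<in> Arr C"
  shows "shM C k f \<in> Arr C" "ShM C (shM C k f) = shM C (k + 1) f"
proof -
  have bij: "inv_into (Arr C) (ShM C) Y \<in> Arr C" "ShM C (inv_into (Arr C) (ShM C) Y) = Y"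
    if "Y \<in> Arr C" for Y
    using that shift_bij_Arr by (simp_all add: bij_betw_def inv_into_into f_inv_into_f)
  have pos: "(ShM C ^^ n) f \<in> Arr C" and neg: "(inv_into (Arr C) (ShM C) ^^ n) f \<in> Arr C" for n
    by (induction n) (simp_all add: assms bij)
  then show "shM C k f \<in> Arr C" by (simp add: shM_def)
  show "ShM C (shM C k f) = shM C (k + 1) f"
  proof (cases "0 \<le> k")
    case True
    then have "nat (k + 1) = Suc (nat k)" by simp
    with True show ?thesis by (simp add: shM_def)
  next
    case False
    then have "nat (- k) = Suc (nat (- (k + 1)))" by simp
    then have "shM C k f = inv_into (Arr C) (ShM C) ((inv_into (Arr C) (ShM C) ^^ nat (- (k + 1))) f)"
      using False by (simp add: shM_def)
    moreover have "shM C (k + 1) f = (inv_into (Arr C) (ShM C) ^^ nat (- (k + 1))) f"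
      using False by (cases "k = - 1") (simp_all add: shM_def)
    ultimately show ?thesis using bij(2)[OF neg] by simp
  qed
qed

lemma shO_0 [simp]: "shO C 0 X = X" and shM_0 [simp]: "shM C 0 f = f"
  by (simp_all add: shO_def shM_def)

text \<open>Identities about \<open>[k]\<close> propagate in both directions from \<open>k = 0\<close> because \<open>[1]\<close> is
  injective.\<close>

lemma shM_Dom_Cod [simp]:
  assumes "f \<in> Arr C"
  shows "Dom C (shM C k f) = shO C k (Dom C f)" "Cod C (shM C k f) = shO C k (Cod C f)"
proof -
  have "Dom C (shM C k f) = shO C k (Dom C f) \<and> Cod C (shM C k f) = shO C k (Cod C f)"
  proof (induction k rule: int_induct[where k = 0])
    case (step1 i)
    then show ?case using assms ShM_props[of "shM C i f"] by simp
  next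
    case (step2 i)
    then have "ShO C (Dom C (shM C (i - 1) f)) = ShO C (shO C (i - 1) (Dom C f))"
      "ShO C (Cod C (shM C (i - 1) f)) = ShO C (shO C (i - 1) (Cod C f))"
      using assms ShM_props[of "shM C (i - 1) f"] by simp_all
    then show ?case using assms by (subst (asm) (1 2) ShO_inj) simp_all
  qed (use assms in simp)
  then show "Dom C (shM C k f) = shO C k (Dom C f)" "Cod C (shM C k f) = shO C k (Cod C f)"
    by simp_all
qed

lemma shM_Ide [simp]:
  assumes "X \<in> Ob C"
  shows "shM C k (Ide C X) = Ide C (shO C k X)"
proof (induction k rule: int_induct[where k = 0])
  case (step1 i)
  then show ?case using assms ShM_shM(2)[of "Ide C X" i] by simp
next
  case (step2 i)
  then have "ShM C (shM C (i - 1) (Ide C X)) = ShM C (Ide C (shO C (i - 1) X))"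
    using assms by simp
  then show ?case using assms by (subst (asm) ShM_inj) simp_all
qed simp

lemma shM_Comp [simp]:
  assumes "f \<in> Arr C" "g \<in> Arr C" "Dom C g = Cod C f"
  shows "shM C k (g \<cdot> f) = shM C k g \<cdot> shM C k f"
proof (induction k rule: int_induct[where k = 0])
  case (step1 i)
  then show ?case using assms ShM_shM(2)[of "g \<cdot> f" i] by simp
next
  case (step2 i)
  then have "ShM C (shM C (i - 1) (g \<cdot> f)) = ShM C (shM C (i - 1) g \<cdot> shM C (i - 1) f)"
    using assms by simp
  then show ?case using assms by (subst (asm) ShM_inj) simp_all
qed simp

lemma shO_minus_1 [simp]:
  assumes "X \<in> Ob C"
  shows "shO C (- 1) (shO C k X) = shO C (k - 1) X"
  using assms ShO_inj[of "shO C (- 1) (shO C k X)" "shO C (k - 1) X"] by simp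

lemma shM_minus_1 [simp]:
  assumes "f \<in> Arr C"
  shows "shM C (- 1) (shM C k f) = shM C (k - 1) f"
proof -
  have "ShM C (shM C (- 1) (shM C k f)) = ShM C (shM C (k - 1) f)"
    using assms by simp
  then show ?thesis using assms by (subst (asm) ShM_inj) simp_all
qed

lemma ShO_zero_ob: "is_zero_ob C Z \<Longrightarrow> is_zero_ob C (ShO C Z)"
  using ShM_Ide[of Z] by (auto simp: is_zero_ob_iff)

section \<open>Distinguished triangles: completion of morphisms and exactness\<close>

lemma TriD:
  assumes "(u, v, w) \<in> Tri C"
  shows "u \<in> Arr C" "v \<in> Arr C" "w \<in> Arr C" "Dom C v = Cod C u" "Dom C w = Cod C v"
    "Cod C w = ShO C (Dom C u)"
  using Tri_triangle[OF assms] by (simp_all add: is_triangle_def)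

lemma Tri_rotate:
  assumes "(u, v, w) \<in> Tri C"
  shows "(v, w, neg C (ShM C u)) \<in> Tri C"
  using TR2[OF Tri_triangle[OF assms]] assms by simp

lemma tri_mor_iff:
  "tri_mor C (u, v, w) (u', v', w') f g h \<longleftrightarrow>
     f \<in> Hom C (Dom C u) (Dom C u') \<and> g \<in> Hom C (Cod C u) (Cod C u') \<and>
     h \<in> Hom C (Cod C v) (Cod C v') \<and>
     g \<cdot> u = u' \<cdot> f \<and> h \<cdot> v = v' \<cdot> g \<and> ShM C f \<cdot> w = w' \<cdot> h"
  by (simp add: tri_mor_def)

lemma tri_mor_Comp:
  assumes Tri: "\<Delta> \<in> Tri C" "\<Delta>' \<in> Tri C" "\<Delta>'' \<in> Tri C"
    and mor: "tri_mor C \<Delta> \<Delta>' f g h" "tri_mor C \<Delta>' \<Delta>'' f' g' h'"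
  shows "tri_mor C \<Delta> \<Delta>'' (f' \<cdot> f) (g' \<cdot> g) (h' \<cdot> h)"
proof -
  obtain u v w u' v' w' u'' v'' w'' where
    eq: "\<Delta> = (u, v, w)" "\<Delta>' = (u', v', w')" "\<Delta>'' = (u'', v'', w'')"
    by (metis prod_cases3)
  note D = TriD[OF Tri(1)[unfolded eq]] TriD[OF Tri(2)[unfolded eq]] TriD[OF Tri(3)[unfolded eq]]
  have A: "f \<in> Arr C" "Dom C f = Dom C u" "Cod C f = Dom C u'"
    "g \<in> Arr C" "Dom C g = Cod C u" "Cod C g = Cod C u'"
    "h \<in> Arr C" "Dom C h = Cod C v" "Cod C h = Cod C v'"
    "f' \<in> Arr C" "Dom C f' = Dom C u'" "Cod C f' = Dom C u''"
    "g' \<in> Arr C" "Dom C g' = Cod C u'" "Cod C g' = Cod C u''"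
    "h' \<in> Arr C" "Dom C h' = Cod C v'" "Cod C h' = Cod C v''"
    using mor unfolding eq by (simp_all add: tri_mor_iff Hom_iff)
  have E: "g \<cdot> u = u' \<cdot> f" "h \<cdot> v = v' \<cdot> g" "w' \<cdot> h = ShM C f \<cdot> w"
    "g' \<cdot> u' = u'' \<cdot> f'" "h' \<cdot> v' = v'' \<cdot> g'" "ShM C f' \<cdot> w' = w'' \<cdot> h'"
    using mor unfolding eq by (simp_all add: tri_mor_iff)
  have "g' \<cdot> (u' \<cdot> f) = u'' \<cdot> (f' \<cdot> f)" "h' \<cdot> (v' \<cdot> g) = v'' \<cdot> (g' \<cdot> g)"
    "ShM C f' \<cdot> (w' \<cdot> h) = w'' \<cdot> (h' \<cdot> h)"
    using arg_cong[OF E(4), of "\<lambda>k. k \<cdot> f"] arg_cong[OF E(5), of "\<lambda>k. k \<cdot> g"]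
      arg_cong[OF E(6), of "\<lambda>k. k \<cdot> h"] A D by simp_all
  then show ?thesis unfolding eq using A D E(1-3) by (simp add: tri_mor_iff Hom_iff)
qed

lemma neg_inj: "\<lbrakk>f \<in> Arr C; g \<in> Arr C\<rbrakk> \<Longrightarrow> neg C f = neg C g \<longleftrightarrow> f = g"
  by (metis neg_neg)

text \<open>TR3 supplies the third arrow of a morphism of triangles; for the rotated triangles it
  supplies the shift of the first one. This is what recovers \<open>g\<close> from a pair
  \<open>(h, i)\<close>.\<close>

lemma Tri_complete_first:
  assumes T: "(u, v, w) \<in> Tri C" and T': "(u', v', w') \<in> Tri C"
    and g: "g \<in> Hom C (Cod C u) (Cod C u')" and h: "h \<in> Hom C (Cod C v) (Cod C v')"
    and sq: "h \<cdot> v = v' \<cdot> g"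
  shows "\<exists>f. tri_mor C (u, v, w) (u', v', w') f g h"
proof -
  note D = TriD[OF T] and D' = TriD[OF T']
  obtain k where k: "tri_mor C (v, w, neg C (ShM C u)) (v', w', neg C (ShM C u')) g h k"
    using TR3[OF Tri_rotate[OF T] Tri_rotate[OF T'], of g h] g h sq D D' by auto
  then have "k \<in> Arr C" "Dom C k = ShO C (Dom C u)" "Cod C k = ShO C (Dom C u')"
    using D D' by (simp_all add: tri_mor_iff Hom_iff)
  then obtain f where f: "f \<in> Arr C" "Dom C f = Dom C u" "Cod C f = Dom C u'" "k = ShM C f"
    by (rule ShM_surj) (use D D' in simp_all)
  have gA: "g \<in> Arr C" "Dom C g = Cod C u" "Cod C g = Cod C u'" using g by (simp_all add: Hom_iff)
  \<comment> \<open>Rotation puts a sign on both \<open>u[1]\<close> and \<open>u'[1]\<close>; the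
    two signs cancel.\<close>
  have "ShM C g \<cdot> neg C (ShM C u) = neg C (ShM C u') \<cdot> k" using k by (simp add: tri_mor_iff)
  then have "neg C (ShM C (g \<cdot> u)) = neg C (ShM C (u' \<cdot> f))"
    using f gA D D' by simp
  then have "ShM C (g \<cdot> u) = ShM C (u' \<cdot> f)"
    using f gA D D' by (subst (asm) neg_inj) (simp_all del: ShM_Comp)
  then have "g \<cdot> u = u' \<cdot> f"
    using f gA D D' by (subst (asm) ShM_inj) (simp_all del: ShM_Comp)
  then show ?thesis
    using k f g h sq D D' by (auto simp: tri_mor_iff Hom_iff)
qed

text \<open>Comparison with the triangle of an identity: TR3 extends the pair
  \<open>(Ide, u)\<close>, and the middle square identifies \<open>v u\<close> with a composite
  through a zero object.\<close>

lemma Tri_comp_zero: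
  assumes T: "(u, v, w) \<in> Tri C"
  shows "v \<cdot> u = ZeroM C (Dom C u) (Cod C v)"
proof -
  note D = TriD[OF T]
  obtain Z where Z: "is_zero_ob C Z" using ex_zero_ob by blast
  then have "Z \<in> Ob C" by (simp add: is_zero_ob_iff)
  with D Z obtain h where
    "tri_mor C (Ide C (Dom C u), ZeroM C (Dom C u) Z, ZeroM C Z (ShO C (Dom C u))) (u, v, w)
      (Ide C (Dom C u)) u h"
    using TR3[OF TR1_id[of "Dom C u" Z] T, of "Ide C (Dom C u)" u] by (auto simp: Hom_iff)
  then show ?thesis using D \<open>Z \<in> Ob C\<close> by (auto simp: tri_mor_iff Hom_iff)
qed

text \<open>Exactness of \<open>Hom(Y, -)\<close>: a morphism out of the triangle of
  \<open>Ide C Y\<close> with second arrow \<open>f\<close> and third arrow zero has the wanted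
  factor as its first arrow.\<close>

lemma Tri_weak_kernel:
  assumes T: "(u, v, w) \<in> Tri C"
    and f: "f \<in> Hom C Y (Cod C u)" "v \<cdot> f = ZeroM C Y (Cod C v)"
  obtains g where "g \<in> Hom C Y (Dom C u)" "f = u \<cdot> g"
proof -
  note D = TriD[OF T]
  have fA: "f \<in> Arr C" "Dom C f = Y" "Cod C f = Cod C u" using f by (auto simp: Hom_iff)
  then have Y: "Y \<in> Ob C" by auto
  obtain Z where Z: "is_zero_ob C Z" using ex_zero_ob by blast
  then have ZO: "Z \<in> Ob C" by (simp add: is_zero_ob_iff)
  have "\<exists>g. tri_mor C (Ide C Y, ZeroM C Y Z, ZeroM C Z (ShO C Y)) (u, v, w) g f (ZeroM C Z (Cod C v))"
    by (rule Tri_complete_first[OF TR1_id T]) (use D Z ZO Y fA f in \<open>simp_all add: Hom_iff\<close>)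
  then show thesis using that Y fA by (auto simp: tri_mor_iff Hom_iff)
qed

text \<open>Exactness of \<open>Hom(-, Y)\<close>: in a morphism into a triangle
  \<open>Z \<rightarrow> Y \<rightarrow> Y\<close> with \<open>Z\<close> zero, the third arrow is
  the wanted factor.\<close>

lemma Tri_weak_cokernel:
  assumes T: "(u, v, w) \<in> Tri C"
    and f: "f \<in> Hom C (Cod C u) Y" "f \<cdot> u = ZeroM C (Dom C u) Y"
  obtains g where "g \<in> Hom C (Cod C v) Y" "f = g \<cdot> v"
proof -
  note D = TriD[OF T]
  have fA: "f \<in> Arr C" "Dom C f = Cod C u" "Cod C f = Y" using f by (auto simp: Hom_iff)
  then have Y: "Y \<in> Ob C" by auto
  obtain Z where Z: "is_zero_ob C Z" using ex_zero_ob by blast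
  then have ZO: "Z \<in> Ob C" by (simp add: is_zero_ob_iff)
  \<comment> \<open>This is an identity triangle rotated backwards. TR2 is an equivalence, so it
    suffices that the forward rotation is the identity triangle whose zero object is the shift of
    \<open>Z\<close>.\<close>
  have "is_triangle C (ZeroM C Z Y) (Ide C Y) (ZeroM C Y (ShO C Z))"
    using Y ZO by (simp add: is_triangle_def)
  from TR2[OF this] have T0: "(ZeroM C Z Y, Ide C Y, ZeroM C Y (ShO C Z)) \<in> Tri C"
    using TR1_id[OF Y ShO_zero_ob[OF Z]] Y ZO by simp
  obtain g where "tri_mor C (u, v, w) (ZeroM C Z Y, Ide C Y, ZeroM C Y (ShO C Z))
      (ZeroM C (Dom C u) Z) f g"
    using TR3[OF T T0, of "ZeroM C (Dom C u) Z" f] D Y ZO fA f by (auto simp: Hom_iff)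
  then show thesis using that[of g] Y fA by (auto simp: tri_mor_iff Hom_iff)
qed

end

section \<open>Weight decompositions\<close>

context additive_category
begin

lemma zero_ob_props: "is_zero_ob C (zero_ob C)" "zero_ob C \<in> Ob C"
proof -
  show "is_zero_ob C (zero_ob C)" unfolding zero_ob_def using ex_zero_ob by (rule someI_ex)
  then show "zero_ob C \<in> Ob C" by (simp add: is_zero_ob_iff)
qed

section \<open>Two-term complexes and their morphisms\<close>

lemma two_term_simps:
  "cob (two_term C f) i = (if i = 0 then Dom C f else if i = 1 then Cod C f else zero_ob C)"
  "cdiff (two_term C f) i =
     (if i = 0 then f else ZeroM C (cob (two_term C f) i) (cob (two_term C f) (i + 1)))"
  by (simp_all add: two_term_def Let_def)

lemma is_complex_two_term:
  assumes "f \<in> Arr C"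
  shows "is_complex C (two_term C f)"
proof -
  have ob: "cob (two_term C f) i \<in> Ob C" for i
    using assms by (simp add: two_term_simps zero_ob_props)
  moreover have hom: "cdiff (two_term C f) i \<in> Arr C" "Dom C (cdiff (two_term C f) i) = cob (two_term C f) i"
    "Cod C (cdiff (two_term C f) i) = cob (two_term C f) (i + 1)" for i
    using assms ob by (cases "i = 0"; simp add: two_term_simps zero_ob_props)+
  moreover have "cdiff (two_term C f) (i + 1) \<cdot> cdiff (two_term C f) i
      = ZeroM C (cob (two_term C f) i) (cob (two_term C f) (i + 2))" for i
  proof (cases "i = 0")
    case True
    have "cdiff (two_term C f) 1 = ZeroM C (Cod C f) (zero_ob C)" "cdiff (two_term C f) 0 = f"
      by (simp_all add: two_term_simps)
    with True show ?thesis using assms by (simp add: two_term_simps zero_ob_props)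
  next
    case False
    then have "cdiff (two_term C f) i = ZeroM C (cob (two_term C f) i) (cob (two_term C f) (i + 1))"
      by (simp add: two_term_simps(2))
    then show ?thesis using hom[of "i + 1"] ob by (simp add: add.assoc)
  qed
  ultimately show ?thesis by (simp add: is_complex_def Hom_iff)
qed

lemma two_term_map_simps:
  "cdom (two_term_map C f f' h i) = two_term C f" "ccod (two_term_map C f f' h i) = two_term C f'"
  "ccomp (two_term_map C f f' h i) n =
     (if n = 0 then h else if n = 1 then i else ZeroM C (zero_ob C) (zero_ob C))"
  by (simp_all add: two_term_map_def)

lemma is_chmap_two_term_map_iff:
  assumes f: "f \<in> Arr C" "f' \<in> Arr C"
    and h: "h \<in> Hom C (Dom C f) (Dom C f')" and i: "i \<in> Hom C (Cod C f) (Cod C f')"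
  shows "is_chmap C (two_term_map C f f' h i) \<longleftrightarrow> i \<cdot> f = f' \<cdot> h"
proof
  assume "is_chmap C (two_term_map C f f' h i)"
  from chmapD(6)[OF this, of 0] show "i \<cdot> f = f' \<cdot> h"
    by (simp add: two_term_map_simps two_term_simps)
next
  assume sq: "i \<cdot> f = f' \<cdot> h"
  let ?\<phi> = "two_term_map C f f' h i"
  have hom: "ccomp ?\<phi> n \<in> Hom C (cob (two_term C f) n) (cob (two_term C f') n)" for n
    using h i by (auto simp: two_term_map_simps two_term_simps Hom_iff zero_ob_props)
  note X = complexD[OF is_complex_two_term[OF f(1)]] and Y = complexD[OF is_complex_two_term[OF f(2)]]
  have "ccomp ?\<phi> (n + 1) \<cdot> cdiff (two_term C f) n = cdiff (two_term C f') n \<cdot> ccomp ?\<phi> n" for n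
  proof (cases "n = 0")
    case True
    then show ?thesis using sq by (simp add: two_term_map_simps two_term_simps)
  next
    case False
    then have "cdiff (two_term C f) n = ZeroM C (cob (two_term C f) n) (cob (two_term C f) (n + 1))"
      "cdiff (two_term C f') n = ZeroM C (cob (two_term C f') n) (cob (two_term C f') (n + 1))"
      by (simp_all add: two_term_simps(2))
    then show ?thesis using hom[of n] hom[of "n + 1"] X(1) Y(1) by (simp add: Hom_iff)
  qed
  then show "is_chmap C ?\<phi>"
    using hom is_complex_two_term f by (simp add: is_chmap_def two_term_map_simps(1,2))
qed

text \<open>In degree 0 the summand \<open>d t\<close>, and in degree 1 the summand
  \<open>s d\<close>, pass through a zero differential. The relation thus decouples:
  \<open>s\<close> in degree 1 governs \<open>h\<close>, and \<open>t\<close> in degree 1 governs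
  \<open>i\<close>.\<close>

lemma Kw_arr_two_term_eq_iff:
  assumes f: "f \<in> Arr C" "f' \<in> Arr C"
    and h: "h \<in> Hom C (Dom C f) (Dom C f')" "h' \<in> Hom C (Dom C f) (Dom C f')"
    and i: "i \<in> Hom C (Cod C f) (Cod C f')" "i' \<in> Hom C (Cod C f) (Cod C f')"
    and sq: "i \<cdot> f = f' \<cdot> h" "i' \<cdot> f = f' \<cdot> h'"
  shows "Kw_arr C (two_term_map C f f' h i) = Kw_arr C (two_term_map C f f' h' i') \<longleftrightarrow>
    (\<exists>s \<in> Hom C (Cod C f) (Dom C f'). \<exists>t \<in> Hom C (Cod C f) (Dom C f').
       h \<boxplus> neg C h' = s \<cdot> f \<and> i \<boxplus> neg C i' = f' \<cdot> t)"
proof -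
  let ?X = "two_term C f" and ?Y = "two_term C f'"
  let ?\<phi> = "two_term_map C f f' h i" and ?\<psi> = "two_term_map C f f' h' i'"
  let ?d = "ChMap ?X ?Y (\<lambda>n. ccomp ?\<phi> n \<boxplus> neg C (ccomp ?\<psi> n))"
  note XD = complexD[OF is_complex_two_term[OF f(1)]] and YD = complexD[OF is_complex_two_term[OF f(2)]]
  have "is_chmap C ?\<phi>" "is_chmap C ?\<psi>"
    using is_chmap_two_term_map_iff[OF f h(1) i(1)] is_chmap_two_term_map_iff[OF f h(2) i(2)] sq
    by simp_all
  from Kw_arr_eq_iff[OF this]
  have "Kw_arr C ?\<phi> = Kw_arr C ?\<psi> \<longleftrightarrow> (\<exists>s t. sd_dt_form C ?d s t)"
    by (simp add: two_term_map_simps(1,2))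
  also have "\<dots> \<longleftrightarrow> (\<exists>s \<in> Hom C (Cod C f) (Dom C f'). \<exists>t \<in> Hom C (Cod C f) (Dom C f').
       h \<boxplus> neg C h' = s \<cdot> f \<and> i \<boxplus> neg C i' = f' \<cdot> t)"
  proof
    assume "\<exists>s t. sd_dt_form C ?d s t"
    then obtain s t where st: "sd_dt_form C ?d s t" by blast
    note D = sd_dt_formD[OF st]
    have "h \<boxplus> neg C h' = s 1 \<cdot> f"
      using D(7)[of 0] D(1-6)[of 0] D(1-6)[of 1] f
      by (simp add: two_term_map_simps two_term_simps zero_ob_props)
    moreover have "i \<boxplus> neg C i' = f' \<cdot> t 1"
      using D(7)[of 1] D(1-6)[of 2] D(1-6)[of 1] f
      by (simp add: two_term_map_simps two_term_simps zero_ob_props)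
    moreover have "s 1 \<in> Hom C (Cod C f) (Dom C f')" "t 1 \<in> Hom C (Cod C f) (Dom C f')"
      using D(1-6)[of 1] by (simp_all add: Hom_iff two_term_simps)
    ultimately show "\<exists>s \<in> Hom C (Cod C f) (Dom C f'). \<exists>t \<in> Hom C (Cod C f) (Dom C f').
       h \<boxplus> neg C h' = s \<cdot> f \<and> i \<boxplus> neg C i' = f' \<cdot> t" by blast
  next
    assume "\<exists>s \<in> Hom C (Cod C f) (Dom C f'). \<exists>t \<in> Hom C (Cod C f) (Dom C f').
       h \<boxplus> neg C h' = s \<cdot> f \<and> i \<boxplus> neg C i' = f' \<cdot> t"
    then obtain s t where st: "s \<in> Hom C (Cod C f) (Dom C f')" "t \<in> Hom C (Cod C f) (Dom C f')"
      "h \<boxplus> neg C h' = s \<cdot> f" "i \<boxplus> neg C i' = f' \<cdot> t" by blast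
    \<comment> \<open>Both maps live in degree 1 and are continued by zero in all other
      degrees.\<close>
    define S where "S r n = (if n = 1 then r else ZeroM C (cob ?X n) (cob ?Y (n - 1)))" for r n
    have S: "S r n \<in> Hom C (cob ?X n) (cob ?Y (n - 1))" if "r \<in> Hom C (Cod C f) (Dom C f')" for r n
      using that XD(1)[of n] YD(1)[of "n - 1"]
      by (cases "n = 1") (simp_all add: S_def Hom_iff two_term_simps(1))
    have "ccomp ?\<phi> n \<boxplus> neg C (ccomp ?\<psi> n) = (S s (n + 1) \<cdot> cdiff ?X n) \<boxplus> (cdiff ?Y (n - 1) \<cdot> S t n)" for n
    proof -
      consider "n = 0" | "n = 1" | "n \<noteq> 0" "n \<noteq> 1" by blast
      then show ?thesis
      proof cases
        case 1
        then show ?thesis using st f S[OF st(2), of 0]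
          by (simp add: Hom_iff S_def two_term_map_simps two_term_simps zero_ob_props)
      next
        case 2
        then show ?thesis using st f S[OF st(1), of 2]
          by (simp add: Hom_iff S_def two_term_map_simps two_term_simps zero_ob_props)
      next
        case 3
        then show ?thesis using f S[OF st(1), of "n + 1"] S[OF st(2), of n]
          by (simp add: Hom_iff S_def two_term_map_simps two_term_simps zero_ob_props)
      qed
    qed
    then have "sd_dt_form C ?d (S s) (S t)"
      using S st by (simp add: sd_dt_form_def)
    then show "\<exists>s t. sd_dt_form C ?d s t" by blast
  qed
  finally show ?thesis .
qed

end

context triangulated_category
begin

text \<open>Two rotations make \<open>w\<close> and \<open>-u[1]\<close> consecutive arrows, so
  \<open>f[1]\<close>, which vanishes on \<open>w\<close>, factors through \<open>-u[1]\<close>;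
  desuspending the factor extends \<open>f\<close> along \<open>u\<close>.\<close>

lemma Tri_weak_cokernel_first:
  assumes T: "(u, v, w) \<in> Tri C"
    and f: "f \<in> Hom C (Dom C u) Y" "ShM C f \<cdot> w = ZeroM C (Dom C w) (ShO C Y)"
  obtains g where "g \<in> Hom C (Cod C u) Y" "f = g \<cdot> u"
proof -
  note D = TriD[OF T]
  have fA: "f \<in> Arr C" "Dom C f = Dom C u" "Cod C f = Y" using f by (auto simp: Hom_iff)
  then have Y: "Y \<in> Ob C" by auto
  obtain k where k: "k \<in> Hom C (Cod C (neg C (ShM C u))) (ShO C Y)" "ShM C f = k \<cdot> neg C (ShM C u)"
    by (rule Tri_weak_cokernel[OF Tri_rotate[OF Tri_rotate[OF T]], of "ShM C f" "ShO C Y"])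
      (use D fA f in \<open>simp_all add: Hom_iff\<close>)
  obtain g where g: "g \<in> Arr C" "Dom C g = Cod C u" "Cod C g = Y" "k = ShM C g"
    by (rule ShM_surj[of k "Cod C u" Y]) (use D k Y in \<open>simp_all add: Hom_iff\<close>)
  \<comment> \<open>The sign of the rotated arrow is moved into the factor.\<close>
  have "ShM C f = ShM C (neg C g \<cdot> u)"
    using k(2) g D by simp
  then have "f = neg C g \<cdot> u" using g D fA by (subst (asm) ShM_inj) (simp_all del: ShM_Comp)
  then show thesis using that[of "neg C g"] g by (simp add: Hom_iff)
qed

end

section \<open>Orthogonality and morphisms of weight decompositions\<close>

context weight_structure
begin

lemma Wge_Wle_shift_zero:
  assumes "f \<in> Arr C" "Dom C f \<in> Wge" "Cod C f = ShO C B" "B \<in> Wle"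
  shows "f = ZeroM C (Dom C f) (Cod C f)"
proof -
  have "Hom C (Dom C f) (ShO C B) = {ZeroM C (Dom C f) (ShO C B)}"
    using W_orthogonal assms by (simp add: orthogonal_def)
  moreover have "f \<in> Hom C (Dom C f) (ShO C B)" using assms by (simp add: Hom_iff)
  ultimately show ?thesis using assms(3) by simp
qed

lemma weight_dec_extend:
  assumes T: "(x, f, y) \<in> Tri C" and T': "(x', f', y') \<in> Tri C"
    and ge: "Cod C f \<in> Wge" and le: "Cod C x' \<in> Wle" and g: "g \<in> Hom C (Dom C x) (Dom C x')"
  shows "\<exists>h i. tri_mor C (x, f, y) (x', f', y') g h i"
proof -
  note D = TriD[OF T] and D' = TriD[OF T']
  have gA: "g \<in> Arr C" "Dom C g = Dom C x" "Cod C g = Dom C x'" using g by (simp_all add: Hom_iff)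
  \<comment> \<open>The obstruction to extending \<open>x' g\<close> along \<open>x\<close> is a map
    from \<open>X^(w\<ge>1)\<close> to \<open>X'^(w\<le>0)[1]\<close>, hence zero.\<close>
  have "ShM C (x' \<cdot> g) \<cdot> y = ZeroM C (Dom C y) (ShO C (Cod C x'))"
    using Wge_Wle_shift_zero[of "ShM C (x' \<cdot> g) \<cdot> y" "Cod C x'"] D D' gA ge le by simp
  then obtain h where h: "h \<in> Hom C (Cod C x) (Cod C x')" "x' \<cdot> g = h \<cdot> x"
    using Tri_weak_cokernel_first[OF T, of "x' \<cdot> g" "Cod C x'"] D D' gA by (auto simp: Hom_iff)
  show ?thesis using TR3[OF T T' g h(1)] h(2) by auto
qed

end

context preadditive_category
begin

text \<open>A left and a right inverse coincide; the lifting argument for isomorphisms produces the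
  two separately.\<close>

lemma isomorphicI:
  assumes f: "f \<in> Hom C X Y" and l: "l \<in> Hom C Y X" "l \<cdot> f = Ide C X"
    and r: "r \<in> Hom C Y X" "f \<cdot> r = Ide C Y"
  shows "isomorphic C X Y"
proof -
  have "l = l \<cdot> (f \<cdot> r)" using l(1) r by (auto simp: Hom_iff)
  also have "\<dots> = (l \<cdot> f) \<cdot> r" using f l(1) r(1) by (auto simp: Hom_iff)
  also have "\<dots> = r" using l(2) r(1) by (auto simp: Hom_iff)
  finally have "l = r" .
  then have "is_iso C f" using f l r by (intro is_isoI[of f l]) (auto simp: Hom_iff)
  then show ?thesis using f by (auto simp: isomorphic_def)
qed

end

lemma (in additive_category) two_term_map_Zero:
  "two_term_map C f f' (ZeroM C (Dom C f) (Dom C f')) (ZeroM C (Cod C f) (Cod C f'))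
     = ZeroM (cpx_cat C) (two_term C f) (two_term C f')"
  by (auto simp: two_term_map_simps two_term_simps intro!: chmap_eqI)

lemma (in additive_category) two_term_map_Add:
  "two_term_map C f f' (h \<boxplus> h') (i \<boxplus> i')
     = AddM (cpx_cat C) (two_term_map C f f' h i) (two_term_map C f f' h' i')"
  by (auto simp: two_term_map_simps zero_ob_props intro!: chmap_eqI)

lemma (in additive_category) two_term_map_Comp:
  "two_term_map C f f'' (h' \<cdot> h) (i' \<cdot> i)
     = Comp (cpx_cat C) (two_term_map C f' f'' h' i') (two_term_map C f f' h i)"
  by (auto simp: two_term_map_simps zero_ob_props intro!: chmap_eqI)

lemma (in additive_category) two_term_map_Ide:
  "two_term_map C f f (Ide C (Dom C f)) (Ide C (Cod C f)) = Ide (cpx_cat C) (two_term C f)"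
  using zero_ob_props by (auto simp: two_term_map_simps two_term_simps is_zero_ob_iff intro!: chmap_eqI)

text \<open>Outside degrees 0 and 1 the components are endomorphisms of a zero object, so a chain
  map amounts to a commutative square. This lets a class be represented by a pair
  \<open>(h, i)\<close>.\<close>

lemma (in additive_category) Hom_two_term:
  assumes "\<phi> \<in> Hom (cpx_cat C) (two_term C f) (two_term C f')"
  shows "\<phi> = two_term_map C f f' (ccomp \<phi> 0) (ccomp \<phi> 1)"
    "ccomp \<phi> 0 \<in> Hom C (Dom C f) (Dom C f')" "ccomp \<phi> 1 \<in> Hom C (Cod C f) (Cod C f')"
    "ccomp \<phi> 1 \<cdot> f = f' \<cdot> ccomp \<phi> 0"
proof -
  have \<phi>: "is_chmap C \<phi>" "cdom \<phi> = two_term C f" "ccod \<phi> = two_term C f'"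
    using assms by (auto simp: Hom_iff)
  note D = chmapD[OF \<phi>(1)]
  have "ccomp \<phi> n = ZeroM C (zero_ob C) (zero_ob C)" if "n \<noteq> 0" "n \<noteq> 1" for n
  proof -
    have f: "ccomp \<phi> n \<in> Arr C" "Dom C (ccomp \<phi> n) = zero_ob C" "Cod C (ccomp \<phi> n) = zero_ob C"
      using D(3-5)[of n] \<phi> that by (simp_all add: two_term_simps)
    have "ccomp \<phi> n = Ide C (zero_ob C) \<cdot> ccomp \<phi> n" using f by simp
    also have "Ide C (zero_ob C) = ZeroM C (zero_ob C) (zero_ob C)"
      using zero_ob_props(1) by (simp add: is_zero_ob_iff)
    finally show ?thesis using f zero_ob_props(2) by simp
  qed
  then show "\<phi> = two_term_map C f f' (ccomp \<phi> 0) (ccomp \<phi> 1)"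
    using \<phi> by (auto simp: two_term_map_simps intro!: chmap_eqI)
  show "ccomp \<phi> 0 \<in> Hom C (Dom C f) (Dom C f')" "ccomp \<phi> 1 \<in> Hom C (Cod C f) (Cod C f')"
    using D(3-5)[of 0] D(3-5)[of 1] \<phi> by (simp_all add: Hom_iff two_term_simps)
  show "ccomp \<phi> 1 \<cdot> f = f' \<cdot> ccomp \<phi> 0"
    using D(6)[of 0] \<phi> by (simp add: two_term_simps)
qed

section \<open>The functor \<open>WD\<close>\<close>

locale chosen_decompositions = weight_structure C Wle Wge
  for C :: "('o, 'm, 'z) tri_cat_scheme" (structure) and Wle Wge :: "'o set" +
  fixes W :: "'o \<Rightarrow> 'm \<times> 'm \<times> 'm"
  assumes decs: "X \<in> Ob C \<Longrightarrow> weight_dec C Wle Wge X (W X)"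
begin

abbreviation "dec_x X \<equiv> fst (W X)"
abbreviation "dec_f X \<equiv> dec_map W X"
abbreviation "dec_y X \<equiv> snd (snd (W X))"

lemma W_eq: "(dec_x X, dec_f X, dec_y X) = W X"
  by (simp add: dec_map_def)

lemma W_Tri: "X \<in> Ob C \<Longrightarrow> (dec_x X, dec_f X, dec_y X) \<in> Tri C"
  using decs[of X] by (auto simp: weight_dec_def dec_map_def split: prod.splits)

lemma W_Tri': "X \<in> Ob C \<Longrightarrow> W X \<in> Tri C"
  using W_Tri[of X] by (simp add: W_eq)

lemma W_props [simp]:
  assumes "X \<in> Ob C"
  shows "dec_x X \<in> Arr C" "dec_f X \<in> Arr C" "dec_y X \<in> Arr C" "Dom C (dec_x X) = X"
    "Cod C (dec_x X) = Dom C (dec_f X)" "Dom C (dec_y X) = Cod C (dec_f X)" "Cod C (dec_y X) = ShO C X"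
  using TriD[OF W_Tri[OF assms]] decs[OF assms] by (auto simp: weight_dec_def split: prod.splits)

lemma W_weights:
  assumes "X \<in> Ob C"
  shows "Dom C (dec_f X) \<in> Wle" "Cod C (dec_f X) \<in> Wge"
  using decs[OF assms] W_props(5)[OF assms]
  by (simp_all add: weight_dec_def dec_map_def split_beta)

lemma tri_mor_W_iff:
  assumes "X \<in> Ob C" "X' \<in> Ob C"
  shows "tri_mor C (W X) (W X') g h i \<longleftrightarrow>
    g \<in> Hom C X X' \<and> h \<in> Hom C (Dom C (dec_f X)) (Dom C (dec_f X')) \<and>
    i \<in> Hom C (Cod C (dec_f X)) (Cod C (dec_f X')) \<and>
    h \<cdot> dec_x X = dec_x X' \<cdot> g \<and> i \<cdot> dec_f X = dec_f X' \<cdot> h \<and> ShM C g \<cdot> dec_y X = dec_y X' \<cdot> i"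
  using assms tri_mor_iff[of "dec_x X" "dec_f X" "dec_y X" "dec_x X'" "dec_f X'" "dec_y X'" g h i]
  by (simp add: W_eq)

lemma tri_mor_ex:
  assumes "X \<in> Ob C" "X' \<in> Ob C" "g \<in> Hom C X X'"
  shows "\<exists>h i. tri_mor C (W X) (W X') g h i"
  using weight_dec_extend[OF W_Tri[OF assms(1)] W_Tri[OF assms(2)]] assms
  by (simp add: W_weights W_eq)

lemma pair_map_Hom_iff:
  assumes "X \<in> Ob C" "X' \<in> Ob C"
    "h \<in> Hom C (Dom C (dec_f X)) (Dom C (dec_f X'))" "i \<in> Hom C (Cod C (dec_f X)) (Cod C (dec_f X'))"
  shows "pair_map C W X X' h i \<in> Arr (cpx_cat C) \<longleftrightarrow> i \<cdot> dec_f X = dec_f X' \<cdot> h"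
  using is_chmap_two_term_map_iff[of "dec_f X" "dec_f X'" h i] assms
  by (simp add: pair_map_def)

lemma pair_map_Hom:
  assumes "X \<in> Ob C" "X' \<in> Ob C" "tri_mor C (W X) (W X') g h i"
  shows "pair_map C W X X' h i \<in> Hom (cpx_cat C) (two_term C (dec_f X)) (two_term C (dec_f X'))"
  using pair_map_Hom_iff[of X X' h i] assms
  by (simp add: tri_mor_W_iff Hom_iff[of _ "cpx_cat C"] pair_map_def two_term_map_simps)

text \<open>A map is killed by precomposition with \<open>dec_x X\<close> exactly when it factors
  through \<open>dec_f X\<close>, and by postcomposition with \<open>dec_y X'\<close> exactly when
  it lifts along \<open>dec_f X'\<close>. Applied to the differences of the two pairs, this says
  that a difference in Z and compatibility with the same \<open>g\<close> are one condition.\<close>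

lemma Kw_arr_pair_map_eq_iff:
  assumes X: "X \<in> Ob C" "X' \<in> Ob C" and T: "tri_mor C (W X) (W X') g h i"
    and h': "h' \<in> Hom C (Dom C (dec_f X)) (Dom C (dec_f X'))" and i': "i' \<in> Hom C (Cod C (dec_f X)) (Cod C (dec_f X'))"
    and sq: "i' \<cdot> dec_f X = dec_f X' \<cdot> h'"
  shows "Kw_arr C (pair_map C W X X' h' i') = Kw_arr C (pair_map C W X X' h i)
    \<longleftrightarrow> tri_mor C (W X) (W X') g h' i'"
proof -
  have T': "g \<in> Hom C X X'" "h \<in> Hom C (Dom C (dec_f X)) (Dom C (dec_f X'))"
    "i \<in> Hom C (Cod C (dec_f X)) (Cod C (dec_f X'))"
    "h \<cdot> dec_x X = dec_x X' \<cdot> g" "i \<cdot> dec_f X = dec_f X' \<cdot> h" "ShM C g \<cdot> dec_y X = dec_y X' \<cdot> i"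
    using T X by (simp_all add: tri_mor_W_iff)
  have A: "h \<in> Arr C" "Dom C h = Dom C (dec_f X)" "Cod C h = Dom C (dec_f X')"
    "i \<in> Arr C" "Dom C i = Cod C (dec_f X)" "Cod C i = Cod C (dec_f X')"
    "h' \<in> Arr C" "Dom C h' = Dom C (dec_f X)" "Cod C h' = Dom C (dec_f X')"
    "i' \<in> Arr C" "Dom C i' = Cod C (dec_f X)" "Cod C i' = Cod C (dec_f X')"
    "g \<in> Arr C" "Dom C g = X" "Cod C g = X'"
    using T' h' i' by (simp_all add: Hom_iff)
  have "Kw_arr C (pair_map C W X X' h' i') = Kw_arr C (pair_map C W X X' h i) \<longleftrightarrow>
    (\<exists>s \<in> Hom C (Cod C (dec_f X)) (Dom C (dec_f X')). \<exists>t \<in> Hom C (Cod C (dec_f X)) (Dom C (dec_f X')).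
       h' \<boxplus> neg C h = s \<cdot> dec_f X \<and> i' \<boxplus> neg C i = dec_f X' \<cdot> t)"
    unfolding pair_map_def using X h' i' T' sq by (intro Kw_arr_two_term_eq_iff) simp_all
  also have "\<dots> \<longleftrightarrow> tri_mor C (W X) (W X') g h' i'"
  proof
    assume "\<exists>s \<in> Hom C (Cod C (dec_f X)) (Dom C (dec_f X')). \<exists>t \<in> Hom C (Cod C (dec_f X)) (Dom C (dec_f X')).
       h' \<boxplus> neg C h = s \<cdot> dec_f X \<and> i' \<boxplus> neg C i = dec_f X' \<cdot> t"
    then obtain s t where st: "s \<in> Hom C (Cod C (dec_f X)) (Dom C (dec_f X'))"
      "t \<in> Hom C (Cod C (dec_f X)) (Dom C (dec_f X'))"
      "h' \<boxplus> neg C h = s \<cdot> dec_f X" "i' \<boxplus> neg C i = dec_f X' \<cdot> t" by blast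
    have st': "s \<in> Arr C" "Dom C s = Cod C (dec_f X)" "Cod C s = Dom C (dec_f X')"
      "t \<in> Arr C" "Dom C t = Cod C (dec_f X)" "Cod C t = Dom C (dec_f X')" using st by (simp_all add: Hom_iff)
    have z: "dec_f X \<cdot> dec_x X = ZeroM C X (Cod C (dec_f X))"
      using Tri_comp_zero[OF W_Tri[OF X(1)]] X by simp
    have z': "dec_y X' \<cdot> dec_f X' = ZeroM C (Dom C (dec_f X')) (ShO C X')"
      using Tri_comp_zero[OF Tri_rotate[OF W_Tri[OF X(2)]]] X by simp
    have "(h' \<boxplus> neg C h) \<cdot> dec_x X = ZeroM C X (Dom C (dec_f X'))"
      unfolding st(3) using X st' A by (simp add: z)
    then have "h' \<cdot> dec_x X = h \<cdot> dec_x X"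
      using diff_zero_iff[of "h' \<cdot> dec_x X" "h \<cdot> dec_x X"] X A by simp
    moreover have "dec_y X' \<cdot> (i' \<boxplus> neg C i) = ZeroM C (Cod C (dec_f X)) (ShO C X')"
      unfolding st(4) using X st' A by (simp flip: Comp_assoc' add: z')
    then have "dec_y X' \<cdot> i' = dec_y X' \<cdot> i"
      using diff_zero_iff[of "dec_y X' \<cdot> i'" "dec_y X' \<cdot> i"] X A by simp
    ultimately show "tri_mor C (W X) (W X') g h' i'"
      using X T' h' i' sq by (simp add: tri_mor_W_iff)
  next
    assume "tri_mor C (W X) (W X') g h' i'"
    then have T'': "h' \<cdot> dec_x X = dec_x X' \<cdot> g" "ShM C g \<cdot> dec_y X = dec_y X' \<cdot> i'"
      using X by (simp_all add: tri_mor_W_iff)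
    have "(h' \<boxplus> neg C h) \<cdot> dec_x X = ZeroM C X (Dom C (dec_f X'))"
      using X A T' T'' by simp
    then obtain s where s: "s \<in> Hom C (Cod C (dec_f X)) (Dom C (dec_f X'))" "h' \<boxplus> neg C h = s \<cdot> dec_f X"
      using Tri_weak_cokernel[OF W_Tri[OF X(1)], of "h' \<boxplus> neg C h" "Dom C (dec_f X')"] X A
      by (auto simp: Hom_iff)
    have "dec_y X' \<cdot> (i' \<boxplus> neg C i) = ZeroM C (Cod C (dec_f X)) (ShO C X')"
      using X A T'(6) T''(2) by simp
    then obtain t where t: "t \<in> Hom C (Cod C (dec_f X)) (Dom C (dec_f X'))" "i' \<boxplus> neg C i = dec_f X' \<cdot> t"
      using Tri_weak_kernel[OF Tri_rotate[OF W_Tri[OF X(2)]], of "i' \<boxplus> neg C i" "Cod C (dec_f X)"] X A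
      by (auto simp: Hom_iff)
    show "\<exists>s \<in> Hom C (Cod C (dec_f X)) (Dom C (dec_f X')). \<exists>t \<in> Hom C (Cod C (dec_f X)) (Dom C (dec_f X')).
       h' \<boxplus> neg C h = s \<cdot> dec_f X \<and> i' \<boxplus> neg C i = dec_f X' \<cdot> t"
      using s t by blast
  qed
  finally show ?thesis .
qed

text \<open>Two extensions of one \<open>g\<close> have equal classes by the preceding criterion, so
  the pair picked by \<open>SOME\<close> may be replaced by any other.\<close>

lemma WD_arr_eq:
  assumes X: "X \<in> Ob C" "X' \<in> Ob C" and g: "g \<in> Hom C X X'" and T: "tri_mor C (W X) (W X') g h i"
  shows "WD_arr C W g = Kw_arr C (pair_map C W X X' h i)"
proof -
  define hi where "hi = (SOME (h, i). tri_mor C (W X) (W X') g h i)"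
  have "case hi of (h, i) \<Rightarrow> tri_mor C (W X) (W X') g h i"
    unfolding hi_def by (rule someI[of _ "(h, i)"]) (simp add: T)
  then obtain h' i' where hi': "hi = (h', i')" "tri_mor C (W X) (W X') g h' i'"
    by (auto split: prod.splits)
  have "WD_arr C W g = Kw_arr C (pair_map C W X X' h' i')"
    using g hi'(1) by (auto simp: WD_arr_def Hom_iff hi_def Let_def)
  then show ?thesis
    using Kw_arr_pair_map_eq_iff[OF X T, of h' i'] hi'(2) X by (simp add: tri_mor_W_iff)
qed

text \<open>Being an arrow of \<open>cpx_cat C\<close> accounts for the middle square; equality of
  classes accounts for the two squares that involve \<open>g\<close>.\<close>

lemma tri_mor_iff_WD_arr:
  assumes X: "X \<in> Ob C" "X' \<in> Ob C" and g: "g \<in> Hom C X X'"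
    and h: "h \<in> Hom C (Dom C (dec_f X)) (Dom C (dec_f X'))" and i: "i \<in> Hom C (Cod C (dec_f X)) (Cod C (dec_f X'))"
  shows "tri_mor C (W X) (W X') g h i \<longleftrightarrow> pair_map C W X X' h i \<in> Arr (cpx_cat C)
              \<and> Kw_arr C (pair_map C W X X' h i) = WD_arr C W g"
proof -
  obtain h' i' where T: "tri_mor C (W X) (W X') g h' i'" using tri_mor_ex[OF X g] by blast
  show ?thesis
    using Kw_arr_pair_map_eq_iff[OF X T h i] pair_map_Hom_iff[OF X h i] X
    unfolding WD_arr_eq[OF X g T] by (auto simp: tri_mor_W_iff)
qed

lemmas Kw_functorD = full_additive_functorD[OF full_additive_Kw_arr]

lemma WD_arr_Hom:
  assumes "X \<in> Ob C" "X' \<in> Ob C" "g \<in> Hom C X X'"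
  shows "WD_arr C W g \<in> Hom (Kw_cat C) (WD_ob C W X) (WD_ob C W X')"
proof -
  obtain h i where T: "tri_mor C (W X) (W X') g h i" using tri_mor_ex[OF assms] by blast
  have "Kw_arr C ` Hom (cpx_cat C) (two_term C (dec_f X)) (two_term C (dec_f X'))
      = Hom (Kw_cat C) (WD_ob C W X) (WD_ob C W X')"
    unfolding WD_ob_def using assms by (intro Kw_functorD(2)) (simp_all add: is_complex_two_term)
  with pair_map_Hom[OF assms(1,2) T] show ?thesis
    unfolding WD_arr_eq[OF assms T] by blast
qed

text \<open>A class is represented by a commutative square on the two maps \<open>dec_f\<close>;
  completing it on the left produces a \<open>g\<close> that this very square extends.\<close>

lemma WD_arr_surj:
  assumes X: "X \<in> Ob C" "X' \<in> Ob C" and F: "F \<in> Hom (Kw_cat C) (WD_ob C W X) (WD_ob C W X')"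
  obtains g where "g \<in> Hom C X X'" "WD_arr C W g = F"
proof -
  have "Kw_arr C ` Hom (cpx_cat C) (two_term C (dec_f X)) (two_term C (dec_f X'))
      = Hom (Kw_cat C) (WD_ob C W X) (WD_ob C W X')"
    unfolding WD_ob_def using X by (intro Kw_functorD(2)) (simp_all add: is_complex_two_term)
  with F obtain \<phi> where \<phi>: "\<phi> \<in> Hom (cpx_cat C) (two_term C (dec_f X)) (two_term C (dec_f X'))" "F = Kw_arr C \<phi>"
    by blast
  note H = Hom_two_term[OF \<phi>(1)]
  obtain g where T: "tri_mor C (W X) (W X') g (ccomp \<phi> 0) (ccomp \<phi> 1)"
    using Tri_complete_first[OF W_Tri[OF X(1)] W_Tri[OF X(2)], of "ccomp \<phi> 0" "ccomp \<phi> 1"] H X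
    by (auto simp: W_eq)
  then have "g \<in> Hom C X X'" using X by (simp add: tri_mor_W_iff)
  moreover from WD_arr_eq[OF X this T] H(1) have "WD_arr C W g = F" by (simp add: pair_map_def \<phi>(2))
  ultimately show thesis by (rule that)
qed

lemma WD_arr_Ide:
  assumes "X \<in> Ob C"
  shows "WD_arr C W (Ide C X) = Ide (Kw_cat C) (WD_ob C W X)"
proof -
  have "tri_mor C (W X) (W X) (Ide C X) (Ide C (Dom C (dec_f X))) (Ide C (Cod C (dec_f X)))"
    using assms by (simp add: tri_mor_W_iff Hom_iff)
  from WD_arr_eq[OF assms assms _ this] assms
  have "WD_arr C W (Ide C X) = Kw_arr C (Ide (cpx_cat C) (two_term C (dec_f X)))"
    by (simp only: pair_map_def two_term_map_Ide Ide_Hom)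
  also have "\<dots> = Ide (Kw_cat C) (WD_ob C W X)"
    unfolding WD_ob_def using assms by (intro Kw_functorD(3)) (simp add: is_complex_two_term)
  finally show ?thesis .
qed

lemma tri_mor_W_Add:
  assumes "X \<in> Ob C" "X' \<in> Ob C" "tri_mor C (W X) (W X') g h i" "tri_mor C (W X) (W X') g' h' i'"
  shows "tri_mor C (W X) (W X') (g \<boxplus> g') (h \<boxplus> h') (i \<boxplus> i')"
  using assms by (auto simp: tri_mor_W_iff Hom_iff)

lemma tri_mor_W_neg:
  assumes "X \<in> Ob C" "X' \<in> Ob C" "tri_mor C (W X) (W X') g h i"
  shows "tri_mor C (W X) (W X') (neg C g) (neg C h) (neg C i)"
  using assms by (auto simp: tri_mor_W_iff Hom_iff)

lemma WD_arr_Comp: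
  assumes X: "X \<in> Ob C" "X' \<in> Ob C" "X'' \<in> Ob C" and g: "g \<in> Hom C X X'" "g' \<in> Hom C X' X''"
  shows "WD_arr C W (g' \<cdot> g) = WD_arr C W g' \<cdot>\<^bsub>Kw_cat C\<^esub> WD_arr C W g"
proof -
  obtain h i where T: "tri_mor C (W X) (W X') g h i" using tri_mor_ex[OF X(1,2) g(1)] by blast
  obtain h' i' where T': "tri_mor C (W X') (W X'') g' h' i'" using tri_mor_ex[OF X(2,3) g(2)] by blast
  have "WD_arr C W (g' \<cdot> g) = Kw_arr C (Comp (cpx_cat C) (pair_map C W X' X'' h' i') (pair_map C W X X' h i))"
    using WD_arr_eq[OF X(1,3) Comp_Hom[OF g] tri_mor_Comp[OF W_Tri'[OF X(1)] W_Tri'[OF X(2)] W_Tri'[OF X(3)] T T']]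
    by (simp only: pair_map_def two_term_map_Comp[of _ _ _ _ _ _ "dec_f X'"])
  also have "\<dots> = WD_arr C W g' \<cdot>\<^bsub>Kw_cat C\<^esub> WD_arr C W g"
    unfolding WD_arr_eq[OF X(1,2) g(1) T] WD_arr_eq[OF X(2,3) g(2) T']
    by (rule Kw_functorD(4)[OF _ _ _ pair_map_Hom[OF X(1,2) T] pair_map_Hom[OF X(2,3) T']])
      (simp_all add: is_complex_two_term X)
  finally show ?thesis .
qed

lemma WD_arr_Add:
  assumes X: "X \<in> Ob C" "X' \<in> Ob C" and g: "g \<in> Hom C X X'" "g' \<in> Hom C X X'"
  shows "WD_arr C W (g \<boxplus> g') = WD_arr C W g \<boxplus>\<^bsub>Kw_cat C\<^esub> WD_arr C W g'"
proof -
  obtain h i where T: "tri_mor C (W X) (W X') g h i" using tri_mor_ex[OF X g(1)] by blast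
  obtain h' i' where T': "tri_mor C (W X) (W X') g' h' i'" using tri_mor_ex[OF X g(2)] by blast
  have "g \<boxplus> g' \<in> Hom C X X'" using g by (auto simp: Hom_iff)
  from WD_arr_eq[OF X this tri_mor_W_Add[OF X T T']]
  have "WD_arr C W (g \<boxplus> g') = Kw_arr C (AddM (cpx_cat C) (pair_map C W X X' h i) (pair_map C W X X' h' i'))"
    by (simp only: pair_map_def two_term_map_Add)
  also have "\<dots> = WD_arr C W g \<boxplus>\<^bsub>Kw_cat C\<^esub> WD_arr C W g'"
    unfolding WD_arr_eq[OF X g(1) T] WD_arr_eq[OF X g(2) T']
    by (rule Kw_functorD(6)[OF _ _ pair_map_Hom[OF X T] pair_map_Hom[OF X T']])
      (simp_all add: is_complex_two_term X)
  finally show ?thesis .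
qed

lemma WD_ob_Ob:
  assumes "X \<in> Ob C"
  shows "WD_ob C W X \<in> Ob (Kw_cat C)" "WD_ob C W X \<in> Ob (Kw01_cat C)"
proof -
  show ob: "WD_ob C W X \<in> Ob (Kw_cat C)"
    unfolding WD_ob_def using assms by (intro Kw_functorD(1)) (simp add: is_complex_two_term)
  have "is_complex C (two_term C (dec_f X))"
    "\<forall>i. i \<noteq> 0 \<and> i \<noteq> 1 \<longrightarrow> is_zero_ob C (cob (two_term C (dec_f X)) i)"
    using assms by (simp_all add: is_complex_two_term two_term_simps zero_ob_props)
  with ob show "WD_ob C W X \<in> Ob (Kw01_cat C)"
    unfolding Kw01_cat_def full_subcat_def WD_ob_def by auto
qed

lemma Hom_Kw01_cat:
  assumes "X \<in> Ob C" "X' \<in> Ob C"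
  shows "Hom (Kw01_cat C) (WD_ob C W X) (WD_ob C W X') = Hom (Kw_cat C) (WD_ob C W X) (WD_ob C W X')"
  unfolding Kw01_cat_def
  by (rule Hom_full_subcat) (use WD_ob_Ob(2)[OF assms(1)] WD_ob_Ob(2)[OF assms(2)] in
      \<open>simp_all add: Kw01_cat_def full_subcat_def\<close>)

lemma Kw01_cat_simps:
  "Comp (Kw01_cat C) = Comp (Kw_cat C)" "AddM (Kw01_cat C) = AddM (Kw_cat C)"
  "Ide (Kw01_cat C) = Ide (Kw_cat C)"
  by (simp_all add: Kw01_cat_def full_subcat_def)

theorem is_functor_WD: "is_functor C (Kw01_cat C) (WD_ob C W) (WD_arr C W)"
  unfolding is_functor_def
  by (intro conjI ballI)
    (simp_all add: WD_ob_Ob Hom_Kw01_cat WD_arr_Hom Kw01_cat_simps WD_arr_Ide WD_arr_Comp)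

theorem WD_epi:
  assumes "X \<in> Ob C" "X' \<in> Ob C"
  shows "WD_arr C W \<in> epi (hom_grp C X X') (hom_grp (Kw01_cat C) (WD_ob C W X) (WD_ob C W X'))"
proof -
  have "WD_arr C W ` Hom C X X' = Hom (Kw_cat C) (WD_ob C W X) (WD_ob C W X')"
    using WD_arr_Hom[OF assms] WD_arr_surj[OF assms] by (auto simp: image_iff) metis
  then show ?thesis
    using assms by (auto simp: epi_def hom_def Hom_Kw01_cat Kw01_cat_simps WD_arr_Add WD_arr_Hom)
qed

end

section \<open>The kernel ideal of \<open>WD\<close>\<close>

context chosen_decompositions
begin

lemma WD_arr_Zero:
  assumes X: "X \<in> Ob C" "X' \<in> Ob C"
  shows "Kw_arr C (pair_map C W X X' (ZeroM C (Dom C (dec_f X)) (Dom C (dec_f X')))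
      (ZeroM C (Cod C (dec_f X)) (Cod C (dec_f X')))) = ZeroM (Kw_cat C) (WD_ob C W X) (WD_ob C W X')"
  unfolding pair_map_def two_term_map_Zero WD_ob_def
  by (rule Kw_functorD(5)) (simp_all add: is_complex_two_term X)

text \<open>The pair of zero morphisms has zero class and a trivial middle square, so the general
  criterion leaves the outer squares as two equations on \<open>g\<close> alone. The ideal axioms
  are then checked on these equations.\<close>

lemma WD_ker_eq:
  assumes X: "X \<in> Ob C" "X' \<in> Ob C"
  shows "WD_ker C W X X' = {g \<in> Hom C X X'. dec_x X' \<cdot> g = ZeroM C X (Dom C (dec_f X'))
    \<and> ShM C g \<cdot> dec_y X = ZeroM C (Cod C (dec_f X)) (ShO C X')}"
proof -
  let ?h = "ZeroM C (Dom C (dec_f X)) (Dom C (dec_f X'))"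
  let ?i = "ZeroM C (Cod C (dec_f X)) (Cod C (dec_f X'))"
  have h: "?h \<in> Hom C (Dom C (dec_f X)) (Dom C (dec_f X'))"
    and i: "?i \<in> Hom C (Cod C (dec_f X)) (Cod C (dec_f X'))" using X by (simp_all add: Hom_iff)
  have "WD_arr C W g = ZeroM (Kw_cat C) (WD_ob C W X) (WD_ob C W X')
    \<longleftrightarrow> dec_x X' \<cdot> g = ZeroM C X (Dom C (dec_f X'))
      \<and> ShM C g \<cdot> dec_y X = ZeroM C (Cod C (dec_f X)) (ShO C X')" if g: "g \<in> Hom C X X'" for g
  proof -
    have "WD_arr C W g = ZeroM (Kw_cat C) (WD_ob C W X) (WD_ob C W X')
        \<longleftrightarrow> tri_mor C (W X) (W X') g ?h ?i"
      using tri_mor_iff_WD_arr[OF X g h i] pair_map_Hom_iff[OF X h i] X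
      unfolding WD_arr_Zero[OF X, symmetric] by auto
    also have "\<dots> \<longleftrightarrow> dec_x X' \<cdot> g = ZeroM C X (Dom C (dec_f X'))
      \<and> ShM C g \<cdot> dec_y X = ZeroM C (Cod C (dec_f X)) (ShO C X')"
      using X g h i by (auto simp: tri_mor_W_iff)
    finally show ?thesis .
  qed
  then show ?thesis by (auto simp: WD_ker_def kernel_def)
qed

lemma WD_ideal_iff:
  "g \<in> WD_ideal C W \<longleftrightarrow> g \<in> Arr C \<and> dec_x (Cod C g) \<cdot> g = ZeroM C (Dom C g) (Dom C (dec_f (Cod C g)))
    \<and> ShM C g \<cdot> dec_y (Dom C g) = ZeroM C (Cod C (dec_f (Dom C g))) (ShO C (Cod C g))"
  by (auto simp: WD_ideal_def WD_ker_eq Hom_iff)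

text \<open>Morphisms with equal classes share an extension \<open>(h, i)\<close>, which cancels in
  the difference. This converts equalities in the target into membership in a square-zero
  ideal.\<close>

lemma WD_ideal_diff:
  assumes X: "X \<in> Ob C" "X' \<in> Ob C" and g: "g \<in> Hom C X X'" "g' \<in> Hom C X X'"
    and eq: "WD_arr C W g = WD_arr C W g'"
  shows "g \<boxplus> neg C g' \<in> WD_ideal C W"
proof -
  obtain h i where T: "tri_mor C (W X) (W X') g' h i" using tri_mor_ex[OF X g(2)] by blast
  then have hi: "h \<in> Hom C (Dom C (dec_f X)) (Dom C (dec_f X'))"
    "i \<in> Hom C (Cod C (dec_f X)) (Cod C (dec_f X'))" using X by (simp_all add: tri_mor_W_iff)
  have "tri_mor C (W X) (W X') g h i"
    using T tri_mor_iff_WD_arr[OF X g(1) hi] tri_mor_iff_WD_arr[OF X g(2) hi] eq by simp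
  from tri_mor_W_Add[OF X this tri_mor_W_neg[OF X T]]
  have "tri_mor C (W X) (W X') (g \<boxplus> neg C g') (h \<boxplus> neg C h) (i \<boxplus> neg C i)" .
  then show ?thesis
    using X hi g by (auto simp: WD_ideal_iff tri_mor_W_iff Hom_iff)
qed

text \<open>An extension \<open>h\<close> of \<open>g\<close> carries the vanishing across:
  \<open>x'' g f = h x' f = 0\<close>, with \<open>x'\<close> and \<open>x''\<close> the first
  arrows at the two ends of \<open>g\<close>. The condition at the source of \<open>f\<close>
  survives postcomposition.\<close>

lemma WD_ideal_comp_left:
  assumes f: "f \<in> WD_ideal C W" and g: "g \<in> Arr C" "Dom C g = Cod C f"
  shows "g \<cdot> f \<in> WD_ideal C W"
proof -
  have F: "f \<in> Arr C" "dec_x (Dom C g) \<cdot> f = ZeroM C (Dom C f) (Dom C (dec_f (Dom C g)))"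
    "ShM C f \<cdot> dec_y (Dom C f) = ZeroM C (Cod C (dec_f (Dom C f))) (ShO C (Dom C g))"
    using f g(2) by (simp_all add: WD_ideal_iff)
  have X: "Dom C g \<in> Ob C" "Cod C g \<in> Ob C" "g \<in> Hom C (Dom C g) (Cod C g)"
    using g F(1) by (simp_all add: Hom_iff)
  obtain h i where T: "tri_mor C (W (Dom C g)) (W (Cod C g)) g h i" using tri_mor_ex[OF X] by blast
  then have h: "h \<in> Arr C" "Dom C h = Dom C (dec_f (Dom C g))" "Cod C h = Dom C (dec_f (Cod C g))"
    "dec_x (Cod C g) \<cdot> g = h \<cdot> dec_x (Dom C g)" using X by (simp_all add: tri_mor_W_iff Hom_iff)
  have "dec_x (Cod C g) \<cdot> (g \<cdot> f) = h \<cdot> (dec_x (Dom C g) \<cdot> f)"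
    using arg_cong[OF h(4), of "\<lambda>k. k \<cdot> f"] h(1-3) F(1) g X by simp
  also have "\<dots> = ZeroM C (Dom C f) (Dom C (dec_f (Cod C g)))"
    using F(1) h(1-3) X unfolding F(2) by simp
  finally show ?thesis
    using F(1) F(3) g X by (simp add: WD_ideal_iff)
qed

text \<open>Dual to composition on the left, using the other component of an extension of
  \<open>g\<close>: \<open>f[1] g[1] y = f[1] y' i = 0\<close>.\<close>

lemma WD_ideal_comp_right:
  assumes f: "f \<in> WD_ideal C W" and g: "g \<in> Arr C" "Cod C g = Dom C f"
  shows "f \<cdot> g \<in> WD_ideal C W"
proof -
  have F: "f \<in> Arr C" "dec_x (Cod C f) \<cdot> f = ZeroM C (Cod C g) (Dom C (dec_f (Cod C f)))"
    "ShM C f \<cdot> dec_y (Cod C g) = ZeroM C (Cod C (dec_f (Cod C g))) (ShO C (Cod C f))"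
    using f g(2) by (simp_all add: WD_ideal_iff)
  have X: "Dom C g \<in> Ob C" "Cod C g \<in> Ob C" "g \<in> Hom C (Dom C g) (Cod C g)"
    using g F(1) by (simp_all add: Hom_iff)
  obtain h i where T: "tri_mor C (W (Dom C g)) (W (Cod C g)) g h i" using tri_mor_ex[OF X] by blast
  then have i: "i \<in> Arr C" "Dom C i = Cod C (dec_f (Dom C g))" "Cod C i = Cod C (dec_f (Cod C g))"
    "ShM C g \<cdot> dec_y (Dom C g) = dec_y (Cod C g) \<cdot> i" using X by (simp_all add: tri_mor_W_iff Hom_iff)
  have "dec_x (Cod C f) \<cdot> (f \<cdot> g) = (dec_x (Cod C f) \<cdot> f) \<cdot> g" using F(1) g X by simp
  also have "\<dots> = ZeroM C (Dom C g) (Dom C (dec_f (Cod C f)))" using F(1) g X unfolding F(2) by simp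
  finally have 1: "dec_x (Cod C f) \<cdot> (f \<cdot> g) = ZeroM C (Dom C g) (Dom C (dec_f (Cod C f)))" .
  have "ShM C (f \<cdot> g) \<cdot> dec_y (Dom C g) = ShM C f \<cdot> (dec_y (Cod C g) \<cdot> i)"
    unfolding i(4)[symmetric] using F(1) g X by simp
  also have "\<dots> = (ShM C f \<cdot> dec_y (Cod C g)) \<cdot> i" using F(1) g X i(1-3) by simp
  also have "\<dots> = ZeroM C (Cod C (dec_f (Dom C g))) (ShO C (Cod C f))"
    using F(1) X i(1-3) unfolding F(3) by simp
  finally show ?thesis using 1 F(1) g by (simp add: WD_ideal_iff)
qed

lemma WD_ideal_Add:
  "\<lbrakk>f \<in> WD_ideal C W; g \<in> WD_ideal C W; Dom C g = Dom C f; Cod C g = Cod C f\<rbrakk>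
    \<Longrightarrow> f \<boxplus> g \<in> WD_ideal C W"
  by (simp add: WD_ideal_iff)

lemma hom_ideal_WD_ideal: "hom_ideal C (WD_ideal C W)"
  by unfold_locales
    (auto simp: WD_ideal_Add WD_ideal_comp_left WD_ideal_comp_right, auto simp: WD_ideal_iff)

end

lemma (in hom_ideal) two_sided: "two_sided_ideal C T"
proof
  fix f f' X Y X' Y' S i i' p p' S' j j' q q'
  assume f: "f \<in> T" "f' \<in> T" "f \<in> Hom C X Y" "f' \<in> Hom C X' Y'"
    and S: "is_dsum C X X' S i i' p p'" "is_dsum C Y Y' S' j j' q q'"
  have h: "p \<in> Arr C" "Dom C p = S" "Cod C p = Dom C f" "p' \<in> Arr C" "Dom C p' = S" "Cod C p' = Dom C f'"
    "j \<in> Arr C" "Dom C j = Cod C f" "Cod C j = S'" "j' \<in> Arr C" "Dom C j' = Cod C f'" "Cod C j' = S'"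
    "f \<in> Arr C" "f' \<in> Arr C"
    using S f(3,4) by (auto simp: is_dsum_def Hom_iff)
  then show "(j \<cdot> f \<cdot> p) \<boxplus> (j' \<cdot> f' \<cdot> p') \<in> T"
    by (intro T_add T_right T_left f(1,2)) simp_all
qed (auto simp: Hom_iff T_Arr TD is_zero_ob_iff T_zero intro!: T_add T_neg intro: T_left T_right)

context chosen_decompositions
begin

text \<open>An element of the ideal factors through \<open>X'^(w\<ge>1)[-1] \<rightarrow> X'\<close>, and the next one kills
  that arrow; the shift by \<open>[1]\<close> avoids \<open>[-1]\<close>.\<close>

lemma WD_ideal_square:
  assumes f: "f \<in> WD_ideal C W" and g: "g \<in> WD_ideal C W" and comp: "Dom C g = Cod C f"
  shows "g \<cdot> f = ZeroM C (Dom C f) (Cod C g)"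
proof -
  define X where "X = Cod C f"
  have F: "f \<in> Arr C" "Cod C f = X" "dec_x X \<cdot> f = ZeroM C (Dom C f) (Dom C (dec_f X))"
    using f by (simp_all add: WD_ideal_iff X_def)
  have G: "g \<in> Arr C" "Dom C g = X" "ShM C g \<cdot> dec_y X = ZeroM C (Cod C (dec_f X)) (ShO C (Cod C g))"
    using g comp by (simp_all add: WD_ideal_iff X_def)
  have X: "X \<in> Ob C" using F by auto
  have "neg C (ShM C (dec_x X)) \<cdot> ShM C f = neg C (ShM C (dec_x X \<cdot> f))"
    using F(1,2) X by simp
  also have "\<dots> = ZeroM C (ShO C (Dom C f)) (ShO C (Dom C (dec_f X)))"
    unfolding F(3) using F(1,2) X by simp
  finally obtain k where k: "k \<in> Hom C (ShO C (Dom C f)) (Cod C (dec_f X))" "ShM C f = dec_y X \<cdot> k"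
    using Tri_weak_kernel[OF Tri_rotate[OF Tri_rotate[OF W_Tri[OF X]]], of "ShM C f" "ShO C (Dom C f)"] F X
    by (auto simp: Hom_iff)
  have "ShM C (g \<cdot> f) = (ShM C g \<cdot> dec_y X) \<cdot> k"
    using k F(1,2) G(1,2) X by (simp add: Hom_iff)
  also have "\<dots> = ShM C (ZeroM C (Dom C f) (Cod C g))"
    unfolding G(3) using k F(1,2) G(1,2) X by (simp add: Hom_iff)
  finally show ?thesis
    using F G X by (subst (asm) ShM_inj) simp_all
qed

section \<open>Lifting isomorphisms and idempotents along the square-zero ideal\<close>

theorem WD_reflects_isomorphic:
  assumes X: "X \<in> Ob C" "X' \<in> Ob C" and iso: "isomorphic (Kw_cat C) (WD_ob C W X) (WD_ob C W X')"
  shows "isomorphic C X X'"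
proof -
  obtain F G where F: "F \<in> Hom (Kw_cat C) (WD_ob C W X) (WD_ob C W X')"
    and G: "G \<in> Hom (Kw_cat C) (WD_ob C W X') (WD_ob C W X)"
    and FG: "G \<cdot>\<^bsub>Kw_cat C\<^esub> F = Ide (Kw_cat C) (WD_ob C W X)" "F \<cdot>\<^bsub>Kw_cat C\<^esub> G = Ide (Kw_cat C) (WD_ob C W X')"
    using iso by (auto simp: isomorphic_def is_iso_def Hom_iff)
  obtain f where f: "f \<in> Hom C X X'" "WD_arr C W f = F" using WD_arr_surj[OF X F] by blast
  obtain g where g: "g \<in> Hom C X' X" "WD_arr C W g = G" using WD_arr_surj[OF X(2,1) G] by blast
  have unit: "\<exists>k \<in> Hom C Y Y. k \<cdot> e = Ide C Y \<and> e \<cdot> k = Ide C Y"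
    if Y: "Y \<in> Ob C" and e: "e \<in> Hom C Y Y" and id: "WD_arr C W e = Ide (Kw_cat C) (WD_ob C W Y)"
    for Y e
  proof -
    let ?n = "e \<boxplus> neg C (Ide C Y)"
    \<comment> \<open>\<open>e = 1 + n\<close> with \<open>n\<close> in the ideal, so
      \<open>n n = 0\<close> and \<open>1 - n\<close> is a two-sided inverse.\<close>
    let ?k = "Ide C Y \<boxplus> neg C ?n"
    have eA: "e \<in> Arr C" "Dom C e = Y" "Cod C e = Y" using e by (simp_all add: Hom_iff)
    have "?n \<in> WD_ideal C W"
      using Y e id by (intro WD_ideal_diff[OF Y Y]) (simp_all add: WD_arr_Ide Ide_Hom)
    from WD_ideal_square[OF this this] have "?n \<cdot> ?n = ZeroM C Y Y" using eA Y by simp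
    moreover have "?k \<cdot> e = Ide C Y \<boxplus> neg C (?n \<cdot> ?n)" "e \<cdot> ?k = Ide C Y \<boxplus> neg C (?n \<cdot> ?n)"
      using eA Y by (simp_all add: Add_ac)
    ultimately have "?k \<cdot> e = Ide C Y" "e \<cdot> ?k = Ide C Y"
      using Y by simp_all
    then show ?thesis using eA Y by (intro bexI[of _ ?k]) (simp_all add: Hom_iff)
  qed
  have "WD_arr C W (g \<cdot> f) = Ide (Kw_cat C) (WD_ob C W X)"
    "WD_arr C W (f \<cdot> g) = Ide (Kw_cat C) (WD_ob C W X')"
    using WD_arr_Comp[OF X(1,2,1) f(1) g(1)] WD_arr_Comp[OF X(2,1,2) g(1) f(1)] f g FG by simp_all
  then obtain k l where k: "k \<in> Hom C X X" "k \<cdot> (g \<cdot> f) = Ide C X"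
    and l: "l \<in> Hom C X' X'" "(f \<cdot> g) \<cdot> l = Ide C X'"
    using unit[OF X(1) Comp_Hom[OF f(1) g(1)]] unit[OF X(2) Comp_Hom[OF g(1) f(1)]] by auto
  \<comment> \<open>Invertibility of \<open>g f\<close> and of \<open>f g\<close> gives
    \<open>k g\<close> as a left inverse and \<open>g l\<close> as a right inverse of
    \<open>f\<close>.\<close>
  show ?thesis
    by (rule isomorphicI[OF f(1) Comp_Hom[OF g(1) k(1)] _ Comp_Hom[OF l(1) g(1)]])
      (use k l f g in \<open>auto simp: Hom_iff\<close>)
qed

text \<open>With \<open>d = p\<^sup>2 - p\<close>, so that \<open>d\<^sup>2 = 0\<close>, the lift is \<open>p + d - 2 p d = 3 p\<^sup>2 - 2 p\<^sup>3\<close>.\<close>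

theorem WD_lift_idempotent:
  assumes X: "X \<in> Ob C" and p: "p \<in> Hom C X X"
    and idem: "WD_arr C W p \<cdot>\<^bsub>Kw_cat C\<^esub> WD_arr C W p = WD_arr C W p"
  shows "\<exists>p' \<in> Hom C X X. p' \<cdot> p' = p' \<and> WD_arr C W p' = WD_arr C W p"
proof -
  define d where "d = p \<cdot> p \<boxplus> neg C p"
  have pA [simp]: "p \<in> Arr C" "Dom C p = X" "Cod C p = X" using p by (simp_all add: Hom_iff)
  have dA [simp]: "d \<in> Arr C" "Dom C d = X" "Cod C d = X" by (simp_all add: d_def)
  note [simp] = X
  have WDpp: "WD_arr C W (p \<cdot> p) = WD_arr C W p"
    using WD_arr_Comp[OF X X X p p] idem by simp
  have dT: "d \<in> WD_ideal C W"
    unfolding d_def using WDpp p by (intro WD_ideal_diff[OF X X]) (simp_all add: Hom_iff)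
  have dd: "d \<cdot> d = ZeroM C X X" using WD_ideal_square[OF dT dT] by simp
  have pp: "p \<cdot> p = p \<boxplus> d" by (simp add: d_def Add_ac)
  have dp: "d \<cdot> p = p \<cdot> d" by (simp add: d_def Add_ac)
  define m where "m = p \<cdot> d"
  have mA [simp]: "m \<in> Arr C" "Dom C m = X" "Cod C m = X" by (simp_all add: m_def)
  \<comment> \<open>\<open>p p d = (p + d) d = p d\<close>, as \<open>d d = 0\<close>; so
    multiplication by \<open>p\<close> fixes \<open>m\<close>.\<close>
  have pm: "p \<cdot> m = m"
  proof -
    have "p \<cdot> m = (p \<cdot> p) \<cdot> d" by (simp add: m_def)
    also have "\<dots> = m" unfolding pp by (simp add: m_def dd)
    finally show ?thesis .
  qed
  have mp: "m \<cdot> p = m" using pm by (simp add: m_def dp)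
  have dm: "d \<cdot> m = ZeroM C X X"
  proof -
    have "d \<cdot> m = (d \<cdot> p) \<cdot> d" by (simp add: m_def)
    also have "\<dots> = ZeroM C X X" unfolding dp by (simp add: dd)
    finally show ?thesis .
  qed
  have md: "m \<cdot> d = ZeroM C X X" by (simp add: m_def dd)
  have mm: "m \<cdot> m = ZeroM C X X" by (simp add: m_def dm[unfolded m_def])
  \<comment> \<open>Here \<open>p n = n p = m - 2 m = -m\<close> and \<open>n n = 0\<close>, so the
    square of \<open>p + n\<close> is \<open>p + d - 2 m\<close>, which is \<open>p + n\<close>
    again.\<close>
  define n where "n = d \<boxplus> neg C (m \<boxplus> m)"
  have nA [simp]: "n \<in> Arr C" "Dom C n = X" "Cod C n = X" by (simp_all add: n_def)
  have "(p \<boxplus> n) \<cdot> (p \<boxplus> n)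
      = d \<boxplus> (m \<boxplus> (m \<boxplus> (p \<boxplus> (neg C m \<boxplus> (neg C m \<boxplus> (neg C m \<boxplus> neg C m))))))"
    by (simp add: n_def pp dp dd pm mp dm md mm m_def[symmetric] Add_ac)
  \<comment> \<open>Moving \<open>p\<close> in front of both copies of \<open>m\<close> brings them
    next to copies of \<open>neg C m\<close>, where they cancel.\<close>
  also have "\<dots> = d \<boxplus> (p \<boxplus> (neg C m \<boxplus> neg C m))"
    by (simp add: Add_left_commute[of m p])
  also have "\<dots> = p \<boxplus> n" by (simp add: n_def Add_ac)
  finally have "(p \<boxplus> n) \<cdot> (p \<boxplus> n) = p \<boxplus> n" .
  moreover have "WD_arr C W (p \<boxplus> n) = WD_arr C W p"
  proof -
    interpret T: hom_ideal C "WD_ideal C W" by (rule hom_ideal_WD_ideal)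
    have "n \<in> WD_ideal C W"
      unfolding n_def m_def by (intro T.T_add T.T_neg T.T_left dT) simp_all
    then have "n \<in> WD_ker C W X X" using X by (auto simp: WD_ideal_iff WD_ker_eq Hom_iff)
    then have n0: "WD_arr C W n = ZeroM (Kw_cat C) (WD_ob C W X) (WD_ob C W X)"
      by (simp add: WD_ker_def kernel_def)
    \<comment> \<open>Zero lies in the kernel too, so \<open>n\<close> and zero have the same image
      and can be exchanged inside the sum.\<close>
    have z: "ZeroM C X X \<in> WD_ker C W X X" by (simp add: WD_ker_eq Hom_iff)
    then have "WD_arr C W n = WD_arr C W (ZeroM C X X)"
      using n0 by (simp add: WD_ker_def kernel_def)
    then have "WD_arr C W (p \<boxplus> n) = WD_arr C W (p \<boxplus> ZeroM C X X)"
      by (simp only: WD_arr_Add[OF X X p] Hom_iff nA Zero_props X)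
    then show ?thesis by simp
  qed
  ultimately show ?thesis by (intro bexI[of _ "p \<boxplus> n"]) (simp_all add: Hom_iff)
qed

end

section \<open>The weight complex\<close>

context weight_structure
begin

lemma Wge_Ob: "X \<in> Wge \<Longrightarrow> X \<in> Ob C" and Wle_Ob: "X \<in> Wle \<Longrightarrow> X \<in> Ob C"
  using Wge_additive Wle_additive by (auto simp: additive_subclass_def)

end

section \<open>A single weight Postnikov tower\<close>

locale weight_tower = weight_structure C Wle Wge
  for C :: "('o, 'm, 'z) tri_cat_scheme" (structure) and Wle Wge :: "'o set" +
  fixes X :: 'o and Q :: "('o, 'm) tower"
  assumes X: "X \<in> Ob C" and tower: "is_tower C Wle Wge X Q"
begin

abbreviation "uT \<equiv> tw_u Q"
abbreviation "fT \<equiv> tw_f Q"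
abbreviation "vT \<equiv> tw_v Q"
abbreviation "cT \<equiv> tw_c Q"
abbreviation "dT \<equiv> tw_d Q"
abbreviation "leT \<equiv> tw_le C Q"
abbreviation "geT \<equiv> tw_ge C Q"
abbreviation "obT \<equiv> tw_ob Q"

lemma tower_dec: "weight_dec C Wle Wge (shO C k X) (uT k, fT k, vT k)"
  using tower by (simp add: is_tower_def tw_u_def tw_f_def tw_v_def)

lemma dec_Tri: "(uT k, fT k, vT k) \<in> Tri C"
  using tower_dec[of k] by (simp add: weight_dec_def)

lemma dec_props [simp]:
  "uT k \<in> Arr C" "fT k \<in> Arr C" "vT k \<in> Arr C" "Dom C (uT k) = shO C k X" "Cod C (uT k) = leT k"
  "Dom C (fT k) = leT k" "Cod C (fT k) = geT (k + 1)" "Dom C (vT k) = geT (k + 1)"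
  "Cod C (vT k) = shO C (k + 1) X"
  using TriD[OF dec_Tri[of k]] tower_dec[of k] X by (simp_all add: weight_dec_def tw_le_def tw_ge_def)

lemma weights [simp]: "leT k \<in> Wle" "geT k \<in> Wge" "obT k \<in> Wge" "obT k \<in> Wle"
  \<comment> \<open>\<open>geT k\<close> is the third object of the decomposition with index
    \<open>k - 1\<close>.\<close>
  using tower_dec[of k] tower_dec[of "k - 1"] tower
  by (simp_all add: weight_dec_def tw_le_def tw_ge_def is_tower_def del: dec_props)

lemma weights_Ob [simp]: "leT k \<in> Ob C" "geT k \<in> Ob C" "obT k \<in> Ob C"
  by (simp_all add: Wle_Ob Wge_Ob)

lemma tower_props [simp]:
  "tw_a Q k \<in> Arr C" "Dom C (tw_a Q k) = shO C (- 1) (leT k)" "Cod C (tw_a Q k) = leT (k - 1)"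
  "tw_e Q k \<in> Arr C" "Dom C (tw_e Q k) = shO C (- 1) (geT (k + 1))" "Cod C (tw_e Q k) = geT k"
  "cT k \<in> Arr C" "Dom C (cT k) = leT (k - 1)" "Cod C (cT k) = obT k"
  "dT k \<in> Arr C" "Dom C (dT k) = obT k" "Cod C (dT k) = leT k"
  "tw_y Q k \<in> Arr C" "Dom C (tw_y Q k) = geT k" "Cod C (tw_y Q k) = obT k"
  using tower by (simp_all add: is_tower_def Hom_iff)

lemma tower_eqs:
  "tw_a Q k \<cdot> shM C (- 1) (uT k) = uT (k - 1)" "(tw_a Q k, cT k, dT k) \<in> Tri C"
  "(tw_x Q k, tw_e Q k, tw_y Q k) \<in> Tri C" "cT k = tw_y Q k \<cdot> fT (k - 1)"
  using tower unfolding is_tower_def by blast+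

lemma d_c: "dT k \<cdot> cT k = ZeroM C (leT (k - 1)) (leT k)"
  using Tri_comp_zero[OF Tri_rotate[OF tower_eqs(2)]] by simp

text \<open>The obstruction to lifting is the composite with the next arrow \<open>-a^k[1]\<close>
  of the triangle, a map from \<open>Wge\<close> into \<open>X^(w\<le>k-1)[1]\<close>, which
  orthogonality kills.\<close>

lemma lift_d:
  assumes "\<sigma> \<in> Hom C B (leT k)" "B \<in> Wge"
  obtains s where "s \<in> Hom C B (obT k)" "\<sigma> = dT k \<cdot> s"
proof -
  have "neg C (ShM C (tw_a Q k)) \<cdot> \<sigma> = ZeroM C B (ShO C (leT (k - 1)))"
    using Wge_Wle_shift_zero[of "neg C (ShM C (tw_a Q k)) \<cdot> \<sigma>" "leT (k - 1)"] assms
    by (auto simp: Hom_iff)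
  then show thesis
    using Tri_weak_kernel[OF Tri_rotate[OF Tri_rotate[OF tower_eqs(2)[of k]]], of \<sigma> B] assms that
    by (auto simp: Hom_iff)
qed

text \<open>Dual to lifting along \<open>d\<close>: the obstruction is the composite with
  \<open>e^k\<close>, whose shift is a map from \<open>X^(w\<ge>k+1)\<close> into
  \<open>B[1]\<close>.\<close>

lemma extend_y:
  assumes s: "s \<in> Hom C (geT k) B" and B: "B \<in> Wle"
  obtains \<sigma> where "\<sigma> \<in> Hom C (obT k) B" "s = \<sigma> \<cdot> tw_y Q k"
proof -
  have sA: "s \<in> Arr C" "Dom C s = geT k" "Cod C s = B" using s by (simp_all add: Hom_iff)
  have "ShM C (s \<cdot> tw_e Q k) = ShM C (ZeroM C (shO C (- 1) (geT (k + 1))) B)"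
    using Wge_Wle_shift_zero[of "ShM C (s \<cdot> tw_e Q k)" B] sA B Wle_Ob[OF B] by simp
  then have "s \<cdot> tw_e Q k = ZeroM C (shO C (- 1) (geT (k + 1))) B"
    using sA Wle_Ob[OF B] by (subst (asm) ShM_inj) simp_all
  then show thesis
    using Tri_weak_cokernel[OF Tri_rotate[OF tower_eqs(3)[of k]], of s B] that sA
    by (auto simp: Hom_iff)
qed

lemma is_complex_weight_complex: "is_complex (heart C Wle Wge) (weight_complex C Q)"
proof -
  \<comment> \<open>Keeping \<open>i\<close> and \<open>j\<close> apart lets the index
    \<open>j - 1\<close> of the tower match without rewriting \<open>i + 1 - 1\<close> inside
    terms.\<close>
  have zero: "(cT (j + 1) \<cdot> dT j) \<cdot> (cT j \<cdot> dT i) = ZeroM C (obT i) (obT (j + 1))"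
    if "j - 1 = i" for i j
  proof -
    have "(cT (j + 1) \<cdot> dT j) \<cdot> (cT j \<cdot> dT i) = cT (j + 1) \<cdot> ((dT j \<cdot> cT j) \<cdot> dT i)"
      using that by simp
    also have "\<dots> = ZeroM C (obT i) (obT (j + 1))" unfolding d_c using that by simp
    finally show ?thesis .
  qed
  show ?thesis
    using zero[of "i + 1" i for i]
    by (simp add: is_complex_def weight_complex_def heart_def Hom_iff add.commute)
qed

end

section \<open>Morphisms of towers and their ambiguity\<close>

locale weight_tower_pair = A: weight_tower C Wle Wge X Q + B: weight_tower C Wle Wge X' Q'
  for C :: "('o, 'm, 'z) tri_cat_scheme" (structure) and Wle Wge :: "'o set" and X X' Q Q'
begin

text \<open>In the third square of the triangle on \<open>a\<close>, \<open>c\<close>,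
  \<open>d\<close> the shift undoes the \<open>[-1]\<close> on \<open>h k\<close>, which leaves the
  unshifted last equation.\<close>

lemma tower_mor_iff:
  assumes g: "g \<in> Hom C X X'"
  shows "is_tower_mor C Q Q' g h i \<phi> \<longleftrightarrow> (\<forall>k.
     h k \<in> Hom C (A.leT k) (B.leT k) \<and> i k \<in> Hom C (A.geT (k + 1)) (B.geT (k + 1)) \<and>
     \<phi> k \<in> Hom C (A.obT k) (B.obT k) \<and>
     h k \<cdot> A.uT k = B.uT k \<cdot> shM C k g \<and> i k \<cdot> A.fT k = B.fT k \<cdot> h k \<and>
     shM C (k + 1) g \<cdot> A.vT k = B.vT k \<cdot> i k \<and>
     h (k - 1) \<cdot> tw_a Q k = tw_a Q' k \<cdot> shM C (- 1) (h k) \<and>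
     \<phi> k \<cdot> A.cT k = B.cT k \<cdot> h (k - 1) \<and> h k \<cdot> A.dT k = B.dT k \<cdot> \<phi> k)"
proof -
  have dec: "tri_mor C (tw_dec R k) (tw_dec R' k) = tri_mor C (tw_u R k, tw_f R k, tw_v R k)
      (tw_u R' k, tw_f R' k, tw_v R' k)" for R R' k
    by (simp add: tw_u_def tw_f_def tw_v_def)
  show ?thesis
    unfolding is_tower_mor_def dec A.tri_mor_iff using g by (auto simp: Hom_iff cong: conj_cong)
qed

text \<open>The decompositions are extended independently for each \<open>k\<close>. Orthogonality
  forces the squares with \<open>a\<close> to commute for any such choice, and TR3 then supplies the
  maps on the \<open>X^k\<close>.\<close>

lemma tower_mor_ex:
  assumes g: "g \<in> Hom C X X'"
  shows "\<exists>h i \<phi>. is_tower_mor C Q Q' g h i \<phi>"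
proof -
  have gk: "shM C k g \<in> Arr C" "Dom C (shM C k g) = shO C k X" "Cod C (shM C k g) = shO C k X'" for k
    using g by (auto simp: Hom_iff)
  have "\<exists>h i. tri_mor C (A.uT k, A.fT k, A.vT k) (B.uT k, B.fT k, B.vT k) (shM C k g) h i" for k
    using gk[of k] by (intro A.weight_dec_extend A.dec_Tri B.dec_Tri) (simp_all add: Hom_iff)
  then obtain h i where hi: "tri_mor C (A.uT k, A.fT k, A.vT k) (B.uT k, B.fT k, B.vT k) (shM C k g) (h k) (i k)" for k
    by metis
  have h: "h k \<in> Arr C" "Dom C (h k) = A.leT k" "Cod C (h k) = B.leT k" "h k \<cdot> A.uT k = B.uT k \<cdot> shM C k g" for k
    using hi[of k] by (simp_all add: A.tri_mor_iff Hom_iff)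
  have sq: "h (k - 1) \<cdot> tw_a Q k = tw_a Q' k \<cdot> shM C (- 1) (h k)" for k
  proof -
    let ?D = "h (k - 1) \<cdot> tw_a Q k \<boxplus> neg C (tw_a Q' k \<cdot> shM C (- 1) (h k))"
    have D: "?D \<in> Arr C" "Dom C ?D = shO C (- 1) (A.leT k)" "Cod C ?D = B.leT (k - 1)"
      using h(1-3) by simp_all
    \<comment> \<open>After precomposition with \<open>u^k[-1]\<close> both sides of the square
      become \<open>u'^(k-1) g[k-1]\<close>, by the compatibility of \<open>a\<close> and
      \<open>a'\<close> with the arrows from the shifts of \<open>X\<close> and
      \<open>X'\<close>.\<close>
    have "h (k - 1) \<cdot> tw_a Q k \<cdot> shM C (- 1) (A.uT k) = h (k - 1) \<cdot> A.uT (k - 1)"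
      using h(1-3) by (simp add: A.tower_eqs(1))
    also have "\<dots> = B.uT (k - 1) \<cdot> shM C (k - 1) g" by (rule h(4))
    also have "\<dots> = (tw_a Q' k \<cdot> shM C (- 1) (B.uT k)) \<cdot> shM C (k - 1) g"
      by (simp add: B.tower_eqs(1))
    also have "\<dots> = tw_a Q' k \<cdot> shM C (- 1) (B.uT k \<cdot> shM C k g)"
      using g gk B.X by (simp add: Hom_iff)
    also have "\<dots> = tw_a Q' k \<cdot> shM C (- 1) (h k) \<cdot> shM C (- 1) (A.uT k)"
      unfolding h(4)[symmetric] using h(1-3) by simp
    finally have "?D \<cdot> shM C (- 1) (A.uT k) = ZeroM C (shO C (k - 1) X) (B.leT (k - 1))"
      using h(1-3) A.X by simp
    then have "ShM C (?D \<cdot> shM C (- 1) (A.uT k)) = ZeroM C (shO C k X) (ShO C (B.leT (k - 1)))"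
      using A.X by simp
    then have "ShM C ?D \<cdot> A.uT k = ZeroM C (shO C k X) (ShO C (B.leT (k - 1)))"
      using D A.X by (subst (asm) A.ShM_Comp) simp_all
    \<comment> \<open>\<open>r\<close> goes from \<open>X^(w\<ge>k+1)\<close> to
      \<open>X'^(w\<le>k-1)[1]\<close>, so orthogonality makes it zero.\<close>
    then obtain r where r: "r \<in> Hom C (A.geT (k + 1)) (ShO C (B.leT (k - 1)))" "ShM C ?D = r \<cdot> A.fT k"
      using A.Tri_weak_cokernel[OF A.dec_Tri[of k], of "ShM C ?D" "ShO C (B.leT (k - 1))"] D
      by (auto simp: Hom_iff simp del: A.ShM_Add A.ShM_neg A.ShM_Comp)
    then have "r = ZeroM C (A.geT (k + 1)) (ShO C (B.leT (k - 1)))"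
      using A.Wge_Wle_shift_zero[of r "B.leT (k - 1)"] by (simp add: Hom_iff)
    with r(2) have "ShM C ?D = ShM C (ZeroM C (shO C (- 1) (A.leT k)) (B.leT (k - 1)))"
      by (simp del: A.ShM_Add A.ShM_neg A.ShM_Comp)
    then have "?D = ZeroM C (shO C (- 1) (A.leT k)) (B.leT (k - 1))"
      using D by (subst (asm) A.ShM_inj) (simp_all del: A.ShM_Add A.ShM_neg A.ShM_Comp)
    then show ?thesis
      using A.diff_zero_iff[of "h (k - 1) \<cdot> tw_a Q k" "tw_a Q' k \<cdot> shM C (- 1) (h k)"] h(1-3)
      by simp
  qed
  have "\<exists>\<phi>. tri_mor C (tw_a Q k, A.cT k, A.dT k) (tw_a Q' k, B.cT k, B.dT k)
      (shM C (- 1) (h k)) (h (k - 1)) \<phi>" for k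
    using h(1-3) sq by (intro A.TR3 A.tower_eqs B.tower_eqs) (simp_all add: Hom_iff)
  then obtain \<phi> where "tri_mor C (tw_a Q k, A.cT k, A.dT k) (tw_a Q' k, B.cT k, B.dT k)
      (shM C (- 1) (h k)) (h (k - 1)) (\<phi> k)" for k
    by metis
  then have "is_tower_mor C Q Q' g h i \<phi>"
    unfolding is_tower_mor_def using hi by (simp add: tw_u_def tw_f_def tw_v_def)
  then show ?thesis by blast
qed

text \<open>Two extensions of the same morphism differ on \<open>X^(w\<le>k)\<close> by a map vanishing on
  \<open>X[k]\<close>. By orthogonality it factors through \<open>X^(k+1)\<close> and lifts to \<open>X'^k\<close>.\<close>

lemma homotopy_step:
  assumes \<eta>: "\<eta> \<in> Hom C (A.leT k) (B.leT k)" "\<eta> \<cdot> A.uT k = ZeroM C (shO C k X) (B.leT k)"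
    and \<psi>: "\<psi> \<in> Hom C (A.obT k) (B.obT k)" "B.dT k \<cdot> \<psi> = \<eta> \<cdot> A.dT k"
  shows "\<exists>s \<in> Hom C (A.obT (k + 1)) (B.obT k). \<exists>t \<in> Hom C (A.obT k) (B.obT (k - 1)).
    \<psi> = (s \<cdot> (A.cT (k + 1) \<cdot> A.dT k)) \<boxplus> ((B.cT k \<cdot> B.dT (k - 1)) \<cdot> t)"
proof -
  have \<eta>A: "\<eta> \<in> Arr C" "Dom C \<eta> = A.leT k" "Cod C \<eta> = B.leT k"
    and \<psi>A: "\<psi> \<in> Arr C" "Dom C \<psi> = A.obT k" "Cod C \<psi> = B.obT k"
    using \<eta> \<psi> by (simp_all add: Hom_iff)
  obtain r where r: "r \<in> Hom C (A.geT (k + 1)) (B.leT k)" "\<eta> = r \<cdot> A.fT k"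
    using A.Tri_weak_cokernel[OF A.dec_Tri[of k], of \<eta> "B.leT k"] \<eta> by auto
  \<comment> \<open>The target of \<open>r\<close> lies in \<open>Wle\<close>, so \<open>r\<close>
    extends along \<open>y^(k+1)\<close>; the extension starts in the heart, so it lifts along
    \<open>d'^k\<close>.\<close>
  obtain \<sigma> where \<sigma>: "\<sigma> \<in> Hom C (A.obT (k + 1)) (B.leT k)" "r = \<sigma> \<cdot> tw_y Q (k + 1)"
    using A.extend_y[OF r(1)] by auto
  obtain s where s: "s \<in> Hom C (A.obT (k + 1)) (B.obT k)" "\<sigma> = B.dT k \<cdot> s"
    using B.lift_d[OF \<sigma>(1)] by auto
  have sA: "s \<in> Arr C" "Dom C s = A.obT (k + 1)" "Cod C s = B.obT k"
    using s by (simp_all add: Hom_iff)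
  let ?s = "s \<cdot> (A.cT (k + 1) \<cdot> A.dT k)"
  \<comment> \<open>The relation \<open>c^(k+1) = y^(k+1) f^k\<close> turns the factorization of
    \<open>\<eta>\<close> into a term containing the differential of the weight complex of
    \<open>X\<close>.\<close>
  have "\<eta> \<cdot> A.dT k = B.dT k \<cdot> ?s"
    unfolding r(2) \<sigma>(2) s(2) using sA by (simp add: A.tower_eqs(4))
  then have "B.dT k \<cdot> (\<psi> \<boxplus> neg C ?s) = ZeroM C (A.obT k) (B.leT k)"
    using \<psi>A \<psi>(2) sA by simp
  then obtain \<tau> where \<tau>: "\<tau> \<in> Hom C (A.obT k) (B.leT (k - 1))" "\<psi> \<boxplus> neg C ?s = B.cT k \<cdot> \<tau>"
    using A.Tri_weak_kernel[OF A.Tri_rotate[OF B.tower_eqs(2)], of "\<psi> \<boxplus> neg C ?s" "A.obT k" k] \<psi>A sA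
    by (auto simp: Hom_iff)
  obtain t where t: "t \<in> Hom C (A.obT k) (B.obT (k - 1))" "\<tau> = B.dT (k - 1) \<cdot> t"
    using B.lift_d[OF \<tau>(1)] by auto
  have "\<psi> = ?s \<boxplus> (\<psi> \<boxplus> neg C ?s)"
    using \<psi>A sA by (simp add: A.Add_ac)
  then have "\<psi> = ?s \<boxplus> ((B.cT k \<cdot> B.dT (k - 1)) \<cdot> t)"
    unfolding \<tau>(2) t(2) using t(1) by (simp add: Hom_iff)
  with s(1) t(1) show ?thesis by blast
qed

lemma wc_map_chmap:
  assumes g: "g \<in> Hom C X X'" and T: "is_tower_mor C Q Q' g h i \<phi>"
  shows "is_chmap (heart C Wle Wge) (ChMap (weight_complex C Q) (weight_complex C Q') \<phi>)"
proof -
  note T' = T[unfolded tower_mor_iff[OF g], rule_format]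
  have \<phi>: "\<phi> k \<in> Arr C" "Dom C (\<phi> k) = A.obT k" "Cod C (\<phi> k) = B.obT k"
    and h: "h k \<in> Arr C" "Dom C (h k) = A.leT k" "Cod C (h k) = B.leT k"
    and c: "\<phi> (k + 1) \<cdot> A.cT (k + 1) = B.cT (k + 1) \<cdot> h k" and d: "h k \<cdot> A.dT k = B.dT k \<cdot> \<phi> k" for k
    using T'[of k] T'[of "k + 1"] by (simp_all add: Hom_iff)
  have "\<phi> (k + 1) \<cdot> (A.cT (k + 1) \<cdot> A.dT k) = (B.cT (k + 1) \<cdot> B.dT k) \<cdot> \<phi> k" for k
  proof -
    have "\<phi> (k + 1) \<cdot> (A.cT (k + 1) \<cdot> A.dT k) = (\<phi> (k + 1) \<cdot> A.cT (k + 1)) \<cdot> A.dT k"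
      using \<phi> by simp
    also have "\<dots> = B.cT (k + 1) \<cdot> (h k \<cdot> A.dT k)" unfolding c using h by simp
    also have "\<dots> = (B.cT (k + 1) \<cdot> B.dT k) \<cdot> \<phi> k" unfolding d using \<phi> by simp
    finally show ?thesis .
  qed
  then show ?thesis
    using A.is_complex_weight_complex B.is_complex_weight_complex \<phi>
    by (simp add: is_chmap_def weight_complex_def heart_def Hom_iff)
qed

lemma Kw_arr_wc_map_eq:
  assumes g: "g \<in> Hom C X X'"
    and T1: "is_tower_mor C Q Q' g h i \<phi>" and T2: "is_tower_mor C Q Q' g h' i' \<phi>'"
  shows "Kw_arr (heart C Wle Wge) (ChMap (weight_complex C Q) (weight_complex C Q') \<phi>)
    = Kw_arr (heart C Wle Wge) (ChMap (weight_complex C Q) (weight_complex C Q') \<phi>')"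
proof -
  interpret H: preadditive_category "heart C Wle Wge"
    unfolding heart_def by (rule A.preadditive_full_subcat)
  note T1' = T1[unfolded tower_mor_iff[OF g], rule_format]
    and T2' = T2[unfolded tower_mor_iff[OF g], rule_format]
  have hom: "h k \<in> Arr C" "Dom C (h k) = A.leT k" "Cod C (h k) = B.leT k"
    "h' k \<in> Arr C" "Dom C (h' k) = A.leT k" "Cod C (h' k) = B.leT k"
    "\<phi> k \<in> Arr C" "Dom C (\<phi> k) = A.obT k" "Cod C (\<phi> k) = B.obT k"
    "\<phi>' k \<in> Arr C" "Dom C (\<phi>' k) = A.obT k" "Cod C (\<phi>' k) = B.obT k"
    and eq: "h k \<cdot> A.uT k = B.uT k \<cdot> shM C k g" "h' k \<cdot> A.uT k = B.uT k \<cdot> shM C k g"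
    "h k \<cdot> A.dT k = B.dT k \<cdot> \<phi> k" "h' k \<cdot> A.dT k = B.dT k \<cdot> \<phi>' k" for k
    using T1'[of k] T2'[of k] by (simp_all add: Hom_iff)
  have gA: "g \<in> Arr C" "Dom C g = X" "Cod C g = X'" using g by (simp_all add: Hom_iff)
  have "\<exists>s \<in> Hom C (A.obT (k + 1)) (B.obT k). \<exists>t \<in> Hom C (A.obT k) (B.obT (k - 1)).
    \<phi> k \<boxplus> neg C (\<phi>' k) = (s \<cdot> (A.cT (k + 1) \<cdot> A.dT k)) \<boxplus> ((B.cT k \<cdot> B.dT (k - 1)) \<cdot> t)" for k
    by (rule homotopy_step[of "h k \<boxplus> neg C (h' k)"]) (simp_all add: hom eq gA Hom_iff)
  then obtain s t where st: "s k \<in> Hom C (A.obT (k + 1)) (B.obT k)" "t k \<in> Hom C (A.obT k) (B.obT (k - 1))"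
    "\<phi> k \<boxplus> neg C (\<phi>' k) = (s k \<cdot> (A.cT (k + 1) \<cdot> A.dT k)) \<boxplus> ((B.cT k \<cdot> B.dT (k - 1)) \<cdot> t k)" for k
    by metis
  \<comment> \<open>A full subcategory has the same morphism groups, hence the same
    negatives.\<close>
  have "neg (heart C Wle Wge) (\<phi>' k) = neg C (\<phi>' k)" for k
    unfolding heart_def by (rule neg_full_subcat) (simp add: hom)
  \<comment> \<open>\<open>s k\<close> starts at \<open>X^(k+1)\<close>, while
    \<open>sd_dt_form\<close> indexes by the source degree; hence the shift to
    \<open>s (k - 1)\<close>.\<close>
  then have "sd_dt_form (heart C Wle Wge) (ChMap (weight_complex C Q) (weight_complex C Q')
      (\<lambda>i. \<phi> i \<boxplus>\<^bsub>heart C Wle Wge\<^esub> neg (heart C Wle Wge) (\<phi>' i))) (\<lambda>k. s (k - 1)) t"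
    using st(1)[of "k - 1" for k] st(2,3)
    by (simp add: sd_dt_form_def weight_complex_def heart_def Hom_iff)
  then show ?thesis
    using H.Kw_arr_eq_iff[OF wc_map_chmap[OF g T1] wc_map_chmap[OF g T2]] by auto
qed

end

section \<open>The weight complex functor\<close>

locale chosen_towers = weight_structure C Wle Wge
  for C :: "('o, 'm, 'z) tri_cat_scheme" (structure) and Wle Wge :: "'o set" +
  fixes P :: "'o \<Rightarrow> ('o, 'm) tower"
  assumes towers: "X \<in> Ob C \<Longrightarrow> is_tower C Wle Wge X (P X)"
begin

lemma tower: "X \<in> Ob C \<Longrightarrow> weight_tower C Wle Wge X (P X)"
  by unfold_locales (simp_all add: towers)

lemma tower_pair:
  "\<lbrakk>X \<in> Ob C; X' \<in> Ob C\<rbrakk> \<Longrightarrow> weight_tower_pair C Wle Wge X X' (P X) (P X')"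
  by (simp add: weight_tower_pair_def tower)

sublocale heart: preadditive_category "heart C Wle Wge"
  unfolding heart_def by (rule preadditive_full_subcat)

lemmas heart_functorD = full_additive_functorD[OF heart.full_additive_Kw_arr]

lemma wc_map_Arr:
  assumes "X \<in> Ob C" "X' \<in> Ob C" "g \<in> Hom C X X'" "is_tower_mor C (P X) (P X') g h i \<phi>"
  shows "wc_map C P X X' \<phi> \<in> Hom (cpx_cat (heart C Wle Wge)) (weight_complex C (P X)) (weight_complex C (P X'))"
  using weight_tower_pair.wc_map_chmap[OF tower_pair[OF assms(1,2)] assms(3,4)]
  by (simp add: wc_map_def Hom_iff)

text \<open>The choice by \<open>SOME\<close> is harmless because any two extensions of one morphism
  of \<open>C\<close> have equal classes.\<close>

lemma wc_arr_eq:
  assumes X: "X \<in> Ob C" "X' \<in> Ob C" and g: "g \<in> Hom C X X'"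
    and T: "is_tower_mor C (P X) (P X') g h i \<phi>"
  shows "wc_arr C Wle Wge P g = Kw_arr (heart C Wle Wge) (wc_map C P X X' \<phi>)"
proof -
  define \<psi> where "\<psi> = (SOME \<phi>. \<exists>h i. is_tower_mor C (P X) (P X') g h i \<phi>)"
  have "\<exists>h i. is_tower_mor C (P X) (P X') g h i \<psi>"
    unfolding \<psi>_def by (rule someI[of _ \<phi>]) (use T in blast)
  then obtain h' i' where T': "is_tower_mor C (P X) (P X') g h' i' \<psi>" by blast
  have "wc_arr C Wle Wge P g = Kw_arr (heart C Wle Wge) (wc_map C P X X' \<psi>)"
    using g by (auto simp: wc_arr_def Hom_iff Let_def \<psi>_def)
  then show ?thesis
    using weight_tower_pair.Kw_arr_wc_map_eq[OF tower_pair[OF X] g T' T] by (simp add: wc_map_def)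
qed

lemma weight_complex_Ob:
  "X \<in> Ob C \<Longrightarrow> weight_complex C (P X) \<in> Ob (cpx_cat (heart C Wle Wge))"
  using weight_tower.is_complex_weight_complex[OF tower] by simp

lemma wc_arr_Hom:
  assumes X: "X \<in> Ob C" "X' \<in> Ob C" and g: "g \<in> Hom C X X'"
  shows "wc_arr C Wle Wge P g \<in> Hom (Kw_cat (heart C Wle Wge)) (wc_ob C Wle Wge P X) (wc_ob C Wle Wge P X')"
proof -
  obtain h i \<phi> where T: "is_tower_mor C (P X) (P X') g h i \<phi>"
    using weight_tower_pair.tower_mor_ex[OF tower_pair[OF X] g] by blast
  then show ?thesis
    unfolding wc_arr_eq[OF X g T] wc_ob_def
      heart_functorD(2)[OF weight_complex_Ob[OF X(1)] weight_complex_Ob[OF X(2)], symmetric]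
    by (intro imageI wc_map_Arr[OF X g])
qed

lemma wc_arr_Ide:
  assumes X: "X \<in> Ob C"
  shows "wc_arr C Wle Wge P (Ide C X) = Ide (Kw_cat (heart C Wle Wge)) (wc_ob C Wle Wge P X)"
proof -
  interpret T: weight_tower_pair C Wle Wge X X "P X" "P X" by (rule tower_pair[OF X X])
  have "is_tower_mor C (P X) (P X) (Ide C X) (\<lambda>k. Ide C (T.A.leT k)) (\<lambda>k. Ide C (T.A.geT (k + 1)))
      (\<lambda>k. Ide C (T.A.obT k))"
    using X by (simp add: T.tower_mor_iff[OF Ide_Hom[OF X]] Ide_Hom)
  from wc_arr_eq[OF X X Ide_Hom[OF X] this]
  have "wc_arr C Wle Wge P (Ide C X)
      = Kw_arr (heart C Wle Wge) (Ide (cpx_cat (heart C Wle Wge)) (weight_complex C (P X)))"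
    by (simp add: wc_map_def weight_complex_def heart_def)
  also have "\<dots> = Ide (Kw_cat (heart C Wle Wge)) (wc_ob C Wle Wge P X)"
    unfolding wc_ob_def by (rule heart_functorD(3)[OF weight_complex_Ob[OF X]])
  finally show ?thesis .
qed

lemma wc_arr_Comp:
  assumes X: "X \<in> Ob C" "X' \<in> Ob C" "X'' \<in> Ob C" and g: "g \<in> Hom C X X'" "g' \<in> Hom C X' X''"
  shows "wc_arr C Wle Wge P (g' \<cdot> g)
    = wc_arr C Wle Wge P g' \<cdot>\<^bsub>Kw_cat (heart C Wle Wge)\<^esub> wc_arr C Wle Wge P g"
proof -
  obtain h i \<phi> where T: "is_tower_mor C (P X) (P X') g h i \<phi>"
    using weight_tower_pair.tower_mor_ex[OF tower_pair[OF X(1,2)] g(1)] by blast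
  obtain h' i' \<phi>' where T': "is_tower_mor C (P X') (P X'') g' h' i' \<phi>'"
    using weight_tower_pair.tower_mor_ex[OF tower_pair[OF X(2,3)] g(2)] by blast
  \<comment> \<open>Extensions compose componentwise, so the composite is an admissible extension of
    \<open>g' g\<close> and may be used to compute its class.\<close>
  have "is_tower_mor C (P X) (P X'') (g' \<cdot> g) (\<lambda>k. h' k \<cdot> h k) (\<lambda>k. i' k \<cdot> i k) (\<lambda>k. \<phi>' k \<cdot> \<phi> k)"
    unfolding is_tower_mor_def
  proof (intro allI conjI)
    fix k
    have h: "h k \<in> Arr C" "h' k \<in> Arr C" "Dom C (h' k) = Cod C (h k)"
      using T[unfolded weight_tower_pair.tower_mor_iff[OF tower_pair[OF X(1,2)] g(1)]]
        T'[unfolded weight_tower_pair.tower_mor_iff[OF tower_pair[OF X(2,3)] g(2)]]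
      by (simp_all add: Hom_iff)
    have gg: "g \<in> Arr C" "g' \<in> Arr C" "Dom C g' = Cod C g" using g by (simp_all add: Hom_iff)
    have Tri: "tw_dec (P Y) k \<in> Tri C" "(tw_a (P Y) k, tw_c (P Y) k, tw_d (P Y) k) \<in> Tri C"
      if "Y \<in> Ob C" for Y
      using weight_tower.dec_Tri[OF tower[OF that], of k] weight_tower.tower_eqs(2)[OF tower[OF that]]
      by (simp_all add: tw_u_def tw_f_def tw_v_def)
    show "tri_mor C (tw_dec (P X) k) (tw_dec (P X'') k) (shM C k (g' \<cdot> g)) (h' k \<cdot> h k) (i' k \<cdot> i k)"
      unfolding shM_Comp[OF gg]
      by (rule tri_mor_Comp[OF Tri(1)[OF X(1)] Tri(1)[OF X(2)] Tri(1)[OF X(3)]])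
        (use T T' in \<open>simp_all add: is_tower_mor_def\<close>)
    show "tri_mor C (tw_a (P X) k, tw_c (P X) k, tw_d (P X) k) (tw_a (P X'') k, tw_c (P X'') k, tw_d (P X'') k)
        (shM C (- 1) (h' k \<cdot> h k)) (h' (k - 1) \<cdot> h (k - 1)) (\<phi>' k \<cdot> \<phi> k)"
      unfolding shM_Comp[OF h]
      by (rule tri_mor_Comp[OF Tri(2)[OF X(1)] Tri(2)[OF X(2)] Tri(2)[OF X(3)]])
        (use T T' in \<open>simp_all add: is_tower_mor_def\<close>)
  qed
  from wc_arr_eq[OF X(1,3) Comp_Hom[OF g] this]
  have "wc_arr C Wle Wge P (g' \<cdot> g) = Kw_arr (heart C Wle Wge)
      (Comp (cpx_cat (heart C Wle Wge)) (wc_map C P X' X'' \<phi>') (wc_map C P X X' \<phi>))"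
    by (simp add: wc_map_def weight_complex_def heart_def)
  also have "\<dots> = wc_arr C Wle Wge P g' \<cdot>\<^bsub>Kw_cat (heart C Wle Wge)\<^esub> wc_arr C Wle Wge P g"
    unfolding wc_arr_eq[OF X(1,2) g(1) T] wc_arr_eq[OF X(2,3) g(2) T']
    by (rule heart_functorD(4)[OF weight_complex_Ob weight_complex_Ob weight_complex_Ob
          wc_map_Arr[OF X(1,2) g(1) T] wc_map_Arr[OF X(2,3) g(2) T']]) (rule X)+
  finally show ?thesis .
qed

theorem is_functor_wc:
  "is_functor C (Kw_cat (heart C Wle Wge)) (wc_ob C Wle Wge P) (wc_arr C Wle Wge P)"
proof -
  have "wc_ob C Wle Wge P X \<in> Ob (Kw_cat (heart C Wle Wge))" if "X \<in> Ob C" for X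
    unfolding wc_ob_def by (rule heart_functorD(1)[OF weight_complex_Ob[OF that]])
  then show ?thesis
    unfolding is_functor_def
    by (intro conjI ballI) (simp_all add: wc_arr_Hom wc_arr_Ide wc_arr_Comp)
qed

end

theorem theorem3p2p2:
  fixes C :: "('o, 'm, 'z) tri_cat_scheme"
    and Wle Wge :: "'o set"
    and W :: "'o \<Rightarrow> 'm \<times> 'm \<times> 'm"
    and P :: "'o \<Rightarrow> ('o, 'm) tower"
  assumes weight: "weight_structure C Wle Wge"
    and decs: "\<And>X. X \<in> Ob C \<Longrightarrow> weight_dec C Wle Wge X (W X)"
  shows
   "(is_functor C (Kw01_cat C) (WD_ob C W) (WD_arr C W)
      \<and> (\<forall>X \<in> Ob C. \<forall>X' \<in> Ob C. \<forall>g \<in> Hom C X X'.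
           (\<exists>h i. tri_mor C (W X) (W X') g h i)
         \<and> (\<forall>h i. tri_mor C (W X) (W X') g h i
              \<longrightarrow> pair_map C W X X' h i \<in> Arr (cpx_cat C)
                \<and> WD_arr C W g = Kw_arr C (pair_map C W X X' h i))))
    \<and> (\<forall>X \<in> Ob C. \<forall>X' \<in> Ob C. \<forall>g \<in> Hom C X X'.
        \<forall>h \<in> Hom C (Dom C (dec_map W X)) (Dom C (dec_map W X')).
        \<forall>i \<in> Hom C (Cod C (dec_map W X)) (Cod C (dec_map W X')).
          tri_mor C (W X) (W X') g h i
            \<longleftrightarrow> pair_map C W X X' h i \<in> Arr (cpx_cat C)
              \<and> Kw_arr C (pair_map C W X X' h i) = WD_arr C W g)
    \<and> (\<forall>X \<in> Ob C. \<forall>X' \<in> Ob C.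
        WD_arr C W \<in> epi (hom_grp C X X') (hom_grp (Kw01_cat C) (WD_ob C W X) (WD_ob C W X')))
    \<and> (two_sided_ideal C (WD_ideal C W) \<and> ideal_square_zero C (WD_ideal C W))
    \<and> (\<forall>X \<in> Ob C. \<forall>X' \<in> Ob C.
        isomorphic (Kw_cat C) (WD_ob C W X) (WD_ob C W X') \<longrightarrow> isomorphic C X X')
    \<and> (\<forall>X \<in> Ob C. \<forall>p \<in> Hom C X X.
        WD_arr C W p \<cdot>\<^bsub>Kw_cat C\<^esub> WD_arr C W p = WD_arr C W p
          \<longrightarrow> (\<exists>p' \<in> Hom C X X. p' \<cdot>\<^bsub>C\<^esub> p' = p' \<and> WD_arr C W p' = WD_arr C W p))
    \<and> ((\<forall>X \<in> Ob C. is_tower C Wle Wge X (P X)) \<longrightarrow>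
        is_functor C (Kw_cat (heart C Wle Wge)) (wc_ob C Wle Wge P) (wc_arr C Wle Wge P)
      \<and> (\<forall>X \<in> Ob C. \<forall>X' \<in> Ob C. \<forall>g \<in> Hom C X X'.
           (\<exists>h i \<phi>. is_tower_mor C (P X) (P X') g h i \<phi>)
         \<and> (\<forall>h i \<phi>. is_tower_mor C (P X) (P X') g h i \<phi>
              \<longrightarrow> wc_map C P X X' \<phi> \<in> Arr (cpx_cat (heart C Wle Wge))
                \<and> wc_arr C Wle Wge P g = Kw_arr (heart C Wle Wge) (wc_map C P X X' \<phi>))))"
proof -
  interpret weight_structure C Wle Wge by (rule weight)
  interpret chosen_decompositions C Wle Wge W by unfold_locales (rule decs)
  have WD: "\<forall>X \<in> Ob C. \<forall>X' \<in> Ob C. \<forall>g \<in> Hom C X X'.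
           (\<exists>h i. tri_mor C (W X) (W X') g h i)
         \<and> (\<forall>h i. tri_mor C (W X) (W X') g h i
              \<longrightarrow> pair_map C W X X' h i \<in> Arr (cpx_cat C)
                \<and> WD_arr C W g = Kw_arr C (pair_map C W X X' h i))"
    using tri_mor_ex pair_map_Hom WD_arr_eq unfolding Hom_iff[of _ "cpx_cat C"] by blast
  have wc: "is_functor C (Kw_cat (heart C Wle Wge)) (wc_ob C Wle Wge P) (wc_arr C Wle Wge P)
      \<and> (\<forall>X \<in> Ob C. \<forall>X' \<in> Ob C. \<forall>g \<in> Hom C X X'.
           (\<exists>h i \<phi>. is_tower_mor C (P X) (P X') g h i \<phi>)
         \<and> (\<forall>h i \<phi>. is_tower_mor C (P X) (P X') g h i \<phi>
              \<longrightarrow> wc_map C P X X' \<phi> \<in> Arr (cpx_cat (heart C Wle Wge))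
                \<and> wc_arr C Wle Wge P g = Kw_arr (heart C Wle Wge) (wc_map C P X X' \<phi>)))"
    if "\<forall>X \<in> Ob C. is_tower C Wle Wge X (P X)"
  proof -
    \<comment> \<open>The towers \<open>P\<close> enter only in this claim, so their locale is
      interpreted inside it.\<close>
    interpret T: chosen_towers C Wle Wge P by unfold_locales (use that in blast)
    show ?thesis
      using T.is_functor_wc weight_tower_pair.tower_mor_ex[OF T.tower_pair] T.wc_map_Arr T.wc_arr_eq
      unfolding Hom_iff[of _ "cpx_cat (heart C Wle Wge)"] by blast
  qed
  have square: "ideal_square_zero C (WD_ideal C W)"
    unfolding ideal_square_zero_def by (blast intro: WD_ideal_square)
  show ?thesis
    by (intro conjI is_functor_WD WD hom_ideal.two_sided[OF hom_ideal_WD_ideal] square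
        ballI; (intro impI)?;
        (rule tri_mor_iff_WD_arr WD_epi WD_reflects_isomorphic WD_lift_idempotent wc; assumption))
qed

end
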